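(* Let $c\in\mathbb{C}$, $q(x)=x^2+c$, $H_b(x,y)=(x^2+c-by,x)$, let $\Lambda\subseteq J(q)$ be an expanding compact invariant set of $q$, and let $\mathcal{A}:=\{(q(x),x):x\in\Lambda\}$. Then there exists $\epsilon_0>0$ such that the holomorphic functions $\theta(\cdot;\mathbf{w}^\dagger)$, $\mathbf{w}^\dagger\in\Sigma(\mathcal{A},H_0)$, described in the context are all defined on $\{|b|<\epsilon_0\}$ and, for every $b$ with $0<|b|<\epsilon_0$, the set $\mathcal{A}_b:=\{\theta(b;\mathbf{w}^\dagger)_0:\mathbf{w}^\dagger\in\Sigma(\mathcal{A},H_0)\}$ is a hyperbolic compact invariant set of $H_b$, the map $\mathbf{w}^\dagger\mapsto\theta(b;\mathbf{w}^\dagger)_0$ is a homeomorphism $\Sigma(\mathcal{A},H_0)\to\mathcal{A}_b$ conjugating the shift to $H_b|_{\mathcal{A}_b}$, and $$\mathcal{A}_b=J(H_b)\quad\text{if and only if}\quad\Lambda=J(q).$$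
   Context: A set $S$ is invariant under a map $f$ if $f^{-1}(S)=S$. $K(q)$ is the set of points with bounded forward $q$-orbit; $J(q)=\partial K(q)$. For $b\ne0$, $K^{\pm}(H_b)$ is the set of points of $\mathbb{C}^2$ with bounded forward (resp. backward) $H_b$-orbit, $J^{\pm}(H_b)=\partial K^{\pm}(H_b)$, and $J(H_b)=J^+(H_b)\cap J^-(H_b)$. An invariant set $S\subset\mathbb{C}$ of a differentiable map $f$ is expanding if there are $C_u>0,\lambda_u>1$ with $\|Df^n(z)\|\ge C_u\lambda_u^n$ for all $z\in S$, $n\ge1$, for some norm on $\mathbb{C}$. A compact invariant set $S$ of a diffeomorphism $f$ of $\mathbb{C}^2$ is hyperbolic if there are $C_s,C_u>0$, $0<\lambda_s<1<\lambda_u$ and a $Df$-invariant splitting $T_z\mathbb{C}^2=E^s_z\oplus E^u_z$ ($z\in S$), continuous in $z$, with $\|Df^n(z)|_{E^s_z}\|\le C_s\lambda_s^n$ and $\|Df^{-n}(z)|_{E^u_z}\|\le C_u\lambda_u^{-n}$ for all $n\ge1$. $\Sigma(\mathcal{A},H_0)=\{(w_i)_{i\in\mathbb{Z}}\in\mathcal{A}^{\mathbb{Z}}:H_0(w_i)=w_{i+1}\ \forall i\}$ with the product topology (canonically homeomorphic to the projective limit $\varprojlim(\mathcal{A},H_0)$), with shift $(w_i)\mapsto(w_{i+1})$. $l_\infty(\mathbb{Z},\mathbb{C}^2)$ is the Banach space of bounded sequences with the supremum norm, and $F(\mathbf{z};H_b)_i=z_{i+1}-H_b(z_i)$, $i\in\mathbb{Z}$.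 For each $\mathbf{w}^\dagger\in\Sigma(\mathcal{A},H_0)$ the linear operator $DF(\mathbf{w}^\dagger;H_0)$ on $l_\infty(\mathbb{Z},\mathbb{C}^2)$ is invertible, and $\theta(\cdot;\mathbf{w}^\dagger)$ denotes the unique holomorphic $l_\infty(\mathbb{Z},\mathbb{C}^2)$-valued function of $b$ near $0$ given by the implicit function theorem with $F(\theta(b;\mathbf{w}^\dagger);H_b)=0$ and $\theta(0;\mathbf{w}^\dagger)=\mathbf{w}^\dagger$ (extended holomorphically to a larger disc about $0$ where possible); $\theta(b;\mathbf{w}^\dagger)_0\in\mathbb{C}^2$ is its $0$-th entry. *)

theory Defs
  imports "HOL-Analysis.Analysis"
begin

section \<open>Invariant sets, bounded orbits, Julia sets\<close>

definition invariant_set :: "('a \<Rightarrow> 'a) \<Rightarrow> 'a set \<Rightarrow> bool" where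
  "invariant_set f S \<longleftrightarrow> f -` S = S"

definition bounded_orbit_set :: "('a::metric_space \<Rightarrow> 'a) \<Rightarrow> 'a set" where
  "bounded_orbit_set f = {z. bounded (range (\<lambda>n::nat. (f ^^ n) z))}"

definition quad :: "complex \<Rightarrow> complex \<Rightarrow> complex" where
  "quad c x = x\<^sup>2 + c"

definition julia :: "(complex \<Rightarrow> complex) \<Rightarrow> complex set" where
  "julia q = frontier (bounded_orbit_set q)"

definition henon :: "complex \<Rightarrow> complex \<Rightarrow> complex \<times> complex \<Rightarrow> complex \<times> complex" where
  "henon c b = (\<lambda>(x, y). (x\<^sup>2 + c - b * y, x))"

text \<open>For a bijection of \<open>\<complex>\<^sup>2\<close> only: \<open>inv\<close> is meaningless otherwise,
  in particular for \<open>henon c 0\<close>.\<close>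

definition henon_julia :: "(complex \<times> complex \<Rightarrow> complex \<times> complex) \<Rightarrow> (complex \<times> complex) set" where
  "henon_julia f = frontier (bounded_orbit_set f) \<inter> frontier (bounded_orbit_set (inv f))"

section \<open>Expanding sets\<close>

definition is_norm_on_C :: "(complex \<Rightarrow> real) \<Rightarrow> bool" where
  "is_norm_on_C N \<longleftrightarrow>
     (\<forall>v. N v = 0 \<longleftrightarrow> v = 0) \<and>
     (\<forall>a v. N (a * v) = cmod a * N v) \<and>
     (\<forall>u v. N (u + v) \<le> N u + N v)"

definition operator_norm_wrt :: "(complex \<Rightarrow> real) \<Rightarrow> (complex \<Rightarrow> complex) \<Rightarrow> real" where
  "operator_norm_wrt N D = (SUP v\<in>{v. N v = 1}. N (D v))"

definition expanding_set :: "(complex \<Rightarrow> complex) \<Rightarrow> complex set \<Rightarrow> bool" where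
  "expanding_set f S \<longleftrightarrow>
     f differentiable_on UNIV \<and> invariant_set f S \<and>
     (\<exists>N Cu lu. is_norm_on_C N \<and> Cu > 0 \<and> lu > 1 \<and>
        (\<forall>z\<in>S. \<forall>n\<ge>1.
           operator_norm_wrt N (frechet_derivative (f ^^ n) (at z)) \<ge> Cu * lu ^ n))"

section \<open>Hyperbolic sets of diffeomorphisms of complex 2-space\<close>

definition scaleC2 :: "complex \<Rightarrow> complex \<times> complex \<Rightarrow> complex \<times> complex" where
  "scaleC2 a v = (a * fst v, a * snd v)"

lemma vector_space_scaleC2: "vector_space scaleC2"
  by unfold_locales (auto simp: scaleC2_def algebra_simps)

definition csubspace2 :: "(complex \<times> complex) set \<Rightarrow> bool" where
  "csubspace2 V \<longleftrightarrow> module.subspace scaleC2 V"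

definition C1_map :: "('a::real_normed_vector \<Rightarrow> 'a) \<Rightarrow> bool" where
  "C1_map f \<longleftrightarrow> f differentiable_on UNIV \<and>
     (\<forall>v. continuous_on UNIV (\<lambda>z. frechet_derivative f (at z) v))"

definition diffeomorphism :: "('a::real_normed_vector \<Rightarrow> 'a) \<Rightarrow> bool" where
  "diffeomorphism f \<longleftrightarrow> bij f \<and> C1_map f \<and> C1_map (inv f)"

definition direct_sum2 :: "(complex \<times> complex) set \<Rightarrow> (complex \<times> complex) set \<Rightarrow> bool" where
  "direct_sum2 V W \<longleftrightarrow> csubspace2 V \<and> csubspace2 W \<and>
     V \<inter> W = {0} \<and> (\<forall>v. \<exists>x\<in>V. \<exists>y\<in>W. v = x + y)"

text \<open>\<open>splitting_proj V W v\<close> is the component of \<open>v\<close> in \<open>V\<close> along \<open>W\<close>.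
  In finite dimension a splitting \<open>Es z \<oplus> Eu z\<close> depends continuously on \<open>z\<close> if and only if
  the projections onto \<open>Es z\<close> along \<open>Eu z\<close> do, and it suffices to test these on each vector.\<close>

definition splitting_proj ::
  "(complex \<times> complex) set \<Rightarrow> (complex \<times> complex) set \<Rightarrow> complex \<times> complex \<Rightarrow> complex \<times> complex" where
  "splitting_proj V W v = (THE x. x \<in> V \<and> v - x \<in> W)"

definition continuous_splitting_on ::
  "(complex \<times> complex) set \<Rightarrow> (complex \<times> complex \<Rightarrow> (complex \<times> complex) set) \<Rightarrow>
   (complex \<times> complex \<Rightarrow> (complex \<times> complex) set) \<Rightarrow> bool" where
  "continuous_splitting_on S Es Eu \<longleftrightarrow>
     (\<forall>z\<in>S. direct_sum2 (Es z) (Eu z)) \<and>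
     (\<forall>v. continuous_on S (\<lambda>z. splitting_proj (Es z) (Eu z) v))"

definition hyperbolic_set ::
  "(complex \<times> complex \<Rightarrow> complex \<times> complex) \<Rightarrow> (complex \<times> complex) set \<Rightarrow> bool" where
  "hyperbolic_set f S \<longleftrightarrow>
     diffeomorphism f \<and> compact S \<and> invariant_set f S \<and>
     (\<exists>Es Eu Cs Cu ls lu.
        Cs > 0 \<and> Cu > 0 \<and> 0 < ls \<and> ls < 1 \<and> 1 < lu \<and>
        continuous_splitting_on S Es Eu \<and>
        (\<forall>z\<in>S. frechet_derivative f (at z) ` Es z = Es (f z) \<and>
                frechet_derivative f (at z) ` Eu z = Eu (f z)) \<and>
        (\<forall>z\<in>S. \<forall>n\<ge>1. \<forall>v\<in>Es z.
           norm (frechet_derivative (f ^^ n) (at z) v) \<le> Cs * ls ^ n * norm v) \<and>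
        (\<forall>z\<in>S. \<forall>n\<ge>1. \<forall>v\<in>Eu z.
           norm (frechet_derivative (inv f ^^ n) (at z) v) \<le> Cu * (1 / lu) ^ n * norm v))"

section \<open>Orbit space\<close>

text \<open>As a set of functions \<open>int \<Rightarrow> complex \<times> complex\<close>, this carries the product topology
  of \<open>HOL-Analysis.Function_Topology\<close>.\<close>

definition Sigma_orbits ::
  "(complex \<times> complex) set \<Rightarrow> (complex \<times> complex \<Rightarrow> complex \<times> complex) \<Rightarrow>
   (int \<Rightarrow> complex \<times> complex) set" where
  "Sigma_orbits A f = {w. (\<forall>i. w i \<in> A) \<and> (\<forall>i. f (w i) = w (i + 1))}"

definition shift :: "(int \<Rightarrow> 'a) \<Rightarrow> int \<Rightarrow> 'a" where
  "shift w = (\<lambda>i. w (i + 1))"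

section \<open>Bounded bi-infinite sequences and the operator F\<close>

text \<open>Since \<open>int\<close> is discrete, bounded continuous functions on it are just bounded sequences,
  with the supremum norm.\<close>

type_synonym linf = "int \<Rightarrow>\<^sub>C (complex \<times> complex)"

definition linf_scaleC :: "complex \<Rightarrow> linf \<Rightarrow> linf" where
  "linf_scaleC a z = Bcontfun (\<lambda>i. scaleC2 a (apply_bcontfun z i))"

lemma apply_linf_scaleC:
  "apply_bcontfun (linf_scaleC a z) i = scaleC2 a (apply_bcontfun z i)"
proof -
  have "bounded (range (apply_bcontfun z))" by simp
  then obtain B where B: "\<And>i. norm (apply_bcontfun z i) \<le> B"
    by (auto simp: bounded_iff)
  have "norm (scaleC2 a (apply_bcontfun z i)) = norm a * norm (apply_bcontfun z i)" for i
    by (simp add: scaleC2_def norm_prod_def norm_mult power_mult_distrib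
        real_sqrt_mult flip: distrib_left)
  then have "norm (scaleC2 a (apply_bcontfun z i)) \<le> norm a * B" for i
    using B by (simp add: mult_left_mono)
  then have "(\<lambda>i. scaleC2 a (apply_bcontfun z i)) \<in> bcontfun"
    by (auto simp: bcontfun_def bounded_iff)
  then show ?thesis
    by (simp add: linf_scaleC_def Bcontfun_inverse)
qed

definition henon_F :: "complex \<Rightarrow> complex \<Rightarrow> linf \<Rightarrow> linf" where
  "henon_F c b z =
     Bcontfun (\<lambda>i. apply_bcontfun z (i + 1) - henon c b (apply_bcontfun z i))"

lemma apply_henon_F:
  "apply_bcontfun (henon_F c b z) i = apply_bcontfun z (i + 1) - henon c b (apply_bcontfun z i)"
proof -
  let ?z = "apply_bcontfun z"
  have bd: "bounded (range ?z)" by simp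
  have "bounded (henon c b ` closure (range ?z))"
    by (intro compact_imp_bounded compact_continuous_image)
      (use bd in \<open>auto simp: henon_def case_prod_unfold compact_closure intro!: continuous_intros\<close>)
  then have 1: "bounded (range (\<lambda>i. henon c b (?z i)))"
    by (rule bounded_subset) (use closure_subset in blast)
  have 2: "bounded (range (\<lambda>i. ?z (i + 1)))"
    by (rule bounded_subset[OF bd]) auto
  have "(\<lambda>i. ?z (i + 1) - henon c b (?z i)) \<in> bcontfun"
    using bounded_minus_comp[OF 2 1] by (simp add: bcontfun_def)
  then show ?thesis
    by (simp add: henon_F_def Bcontfun_inverse)
qed

text \<open>Complex differentiability of a function with values in \<open>linf\<close>:
  its Frechet derivative is complex linear.\<close>

definition linf_holomorphic_on :: "(complex \<Rightarrow> linf) \<Rightarrow> complex set \<Rightarrow> bool" where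
  "linf_holomorphic_on \<phi> U \<longleftrightarrow>
     (\<forall>b\<in>U. \<exists>D. (\<phi> has_derivative (\<lambda>h. linf_scaleC h D)) (at b))"

text \<open>\<open>is_theta c w r \<phi>\<close>: on the disc of radius \<open>r\<close>, \<open>\<phi>\<close> is a holomorphic extension
  of the germ at \<open>0\<close> solving \<open>henon_F c b (\<phi> b) = 0\<close>, \<open>\<phi> 0 = w\<close>. Where the implicit function theorem
  applies this germ is unique, hence so is \<open>\<phi>\<close> on the disc, and
  \<open>theta c w\<close> is its extension to the largest disc about \<open>0\<close>.\<close>

definition is_theta ::
  "complex \<Rightarrow> (int \<Rightarrow> complex \<times> complex) \<Rightarrow> real \<Rightarrow> (complex \<Rightarrow> linf) \<Rightarrow> bool" where
  "is_theta c w r \<phi> \<longleftrightarrow>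
     r > 0 \<and> linf_holomorphic_on \<phi> (ball 0 r) \<and> apply_bcontfun (\<phi> 0) = w \<and>
     (\<forall>\<^sub>F b in nhds 0. henon_F c b (\<phi> b) = 0)"

definition theta :: "complex \<Rightarrow> (int \<Rightarrow> complex \<times> complex) \<Rightarrow> complex \<Rightarrow> linf" where
  "theta c w b = (THE z. \<exists>r \<phi>. is_theta c w r \<phi> \<and> b \<in> ball 0 r \<and> \<phi> b = z)"

definition lifted_set :: "complex \<Rightarrow> complex set \<Rightarrow> (complex \<times> complex) set" where
  "lifted_set c L = {(quad c x, x) | x. x \<in> L}"

definition continued_set :: "complex \<Rightarrow> complex set \<Rightarrow> complex \<Rightarrow> (complex \<times> complex) set" where
  "continued_set c L b =
     {apply_bcontfun (theta c w b) 0 | w. w \<in> Sigma_orbits (lifted_set c L) (henon c 0)}"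

end

theory Submission
  imports Defs "HOL-Complex_Analysis.Complex_Analysis"
begin

text \<open>
  Write \<open>q = quad c\<close>. The orbits of \<open>henon c b\<close> are the two-sided sequences \<open>s\<close> with
  \<open>s (n + 1) = q (s n) - b * s (n - 1)\<close>, so for small \<open>b\<close> they are pseudo-orbits of \<open>q\<close>, and
  expansion makes them shadow true orbits. For an orbit \<open>x\<close> of \<open>q\<close> in \<open>\<Lambda>\<close>, put \<open>s = x + e\<close> and
  solve the recurrence for the linear term in \<open>e n\<close>. This gives a fixed point equation whose right hand
  side contracts the supremum norm weighted by Mane's adapted weight
  (\<open>expanding_set_adapted_weight\<close>, \<open>correction_step_contracts\<close>). The iterates are polynomials
  in \<open>b\<close> and depend on finitely many entries of \<open>x\<close>, so the limit is holomorphic in \<open>b\<close> and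
  continuous in \<open>x\<close>. Uniqueness of solutions close to \<open>x\<close> (\<open>recurrence_near_orbit_unique\<close>)
  yields injectivity, equivariance under the shift, and, with the identity theorem, the fact that the limit is
  \<open>theta\<close>.

  Hyperbolicity: the unstable direction at a point \<open>z\<close> of the continued set is spanned by
  \<open>(1, m z)\<close> and the stable one by \<open>(k z, 1)\<close>. Invariance of these lines amounts to functional equations
  for \<open>m\<close> and \<open>k\<close> that are contractions for small \<open>b\<close> (\<open>invariant_section\<close>). The stable
  rate is of order \<open>cmod b\<close>, and the unstable one is inherited from the weight.

  The Julia set: the continued set lies in \<open>henon_julia (henon c b)\<close>, because bounded iterates near a
  point would, by Cauchy's estimate, bound the derivatives along its unstable or stable direction. In the
  criterion, total invariance leaves only two cases. A nonempty \<open>\<Lambda>\<close> is all of \<open>julia q\<close> by Schottky's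
  theorem (\<open>totally_invariant_eq_julia\<close>). Then the complement of a small neighbourhood of \<open>\<Lambda>\<close> is
  mapped into itself even under perturbation: there, points inside the filled Julia set are trapped and so
  interior to the set of bounded orbits, and points outside it escape. Hence an orbit in \<open>henon_julia (henon c b)\<close>
  stays near \<open>\<Lambda>\<close>, and pulling back along contracting inverse branches produces the orbit that it shadows
  (\<open>henon_julia_subset\<close>). For empty \<open>\<Lambda>\<close> both sides of the criterion fail: \<open>julia q\<close> is nonempty, and so
  is \<open>henon_julia (henon c b)\<close>, since it contains the continuation of a repelling cycle of \<open>q\<close>
  (\<open>henon_julia_nonempty\<close>).
\<close>

section \<open>Expanding sets and adapted weights\<close>

definition multiplier :: "complex \<Rightarrow> nat \<Rightarrow> complex \<Rightarrow> complex" where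
  "multiplier c n z = (\<Prod>j<n. 2 * (quad c ^^ j) z)"

lemma multiplier_0 [simp]: "multiplier c 0 z = 1"
  by (simp add: multiplier_def)

lemma multiplier_Suc: "multiplier c (Suc n) z = 2 * z * multiplier c n (quad c z)"
  by (simp add: multiplier_def prod.lessThan_Suc_shift funpow_swap1 del: prod.lessThan_Suc)

lemma multiplier_Suc': "multiplier c (Suc n) z = 2 * (quad c ^^ n) z * multiplier c n z"
  by (simp add: multiplier_def)

lemma has_field_derivative_quad_iterate:
  "((quad c ^^ n) has_field_derivative multiplier c n z) (at z)"
proof (induction n)
  case 0
  then show ?case by (simp add: id_def)
next
  case (Suc n)
  have "((\<lambda>x. ((quad c ^^ n) x)\<^sup>2 + c) has_field_derivative multiplier c (Suc n) z) (at z)"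
    unfolding multiplier_Suc' by (rule derivative_eq_intros Suc refl)+ simp
  then show ?case by (simp add: quad_def[abs_def] o_def)
qed

lemma continuous_on_multiplier: "continuous_on UNIV (multiplier c n)"
proof -
  have "continuous_on UNIV (quad c ^^ j)" for j
    using has_field_derivative_quad_iterate[where c=c and n=j]
    by (meson DERIV_continuous_on has_field_derivative_at_within)
  then show ?thesis unfolding multiplier_def[abs_def] by (intro continuous_intros)
qed

text \<open>A norm on \<open>\<complex>\<close> that is homogeneous over \<open>\<complex>\<close> is a multiple of the modulus, and the factor cancels.\<close>

lemma operator_norm_wrt_mult:
  assumes "is_norm_on_C N"
  shows "operator_norm_wrt N (\<lambda>v. d * v) = cmod d"
proof -
  have N: "N (a * v) = cmod a * N v" "N v = 0 \<longleftrightarrow> v = 0" for a v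
    using assms by (auto simp: is_norm_on_C_def)
  have "N 1 \<noteq> 0" by (simp add: N)
  moreover have "N 1 \<ge> 0"
  proof -
    have "N (1 + -1 * 1) \<le> N 1 + N (-1 * 1)" using assms unfolding is_norm_on_C_def by blast
    moreover have "N (-1 * 1) = N 1" by (subst N) simp
    moreover have "N (1 + -1 * 1) = 0" using N by simp
    ultimately show ?thesis by simp
  qed
  ultimately have "N 1 > 0" by simp
  have "N (of_real (1 / N 1) * 1) = 1" using \<open>N 1 > 0\<close> by (subst N) (simp add: norm_divide)
  then have ne: "{v. N v = 1} \<noteq> {}" by blast
  have "(\<lambda>v. N (d * v)) ` {v. N v = 1} = {cmod d}" using ne by (auto simp: N)
  then show ?thesis unfolding operator_norm_wrt_def by simp
qed

lemma expanding_set_quadD: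
  assumes "expanding_set (quad c) S"
  obtains C l where "C > 0" "l > 1" "\<And>z n. z \<in> S \<Longrightarrow> n \<ge> 1 \<Longrightarrow> C * l ^ n \<le> cmod (multiplier c n z)"
proof -
  obtain N C l where N: "is_norm_on_C N" and Cl: "C > 0" "l > 1"
    and e: "\<And>z n. z \<in> S \<Longrightarrow> n \<ge> 1 \<Longrightarrow>
       operator_norm_wrt N (frechet_derivative (quad c ^^ n) (at z)) \<ge> C * l ^ n"
    using assms unfolding expanding_set_def by blast
  have "frechet_derivative (quad c ^^ n) (at z) = (\<lambda>v. multiplier c n z * v)" for n z
    using has_field_derivative_quad_iterate[where c=c and n=n and z=z]
    unfolding has_field_derivative_def by (rule frechet_derivative_at[symmetric])
  with e operator_norm_wrt_mult[OF N] Cl show ?thesis by (intro that[of C l]) auto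
qed

text \<open>In the metric \<open>\<rho> y * \<bar>dy\<bar>\<close> every single step of \<open>quad c\<close> on \<open>\<Lambda>\<close> expands by at least \<open>\<kappa>\<close>,
  which is the content of \<open>expand\<close>. Invariance is asked in the forward direction, so that the notion covers
  finite repelling cycles as well as Julia sets.\<close>

locale repeller =
  fixes c :: complex and \<Lambda> :: "complex set" and \<rho> :: "complex \<Rightarrow> real" and \<kappa> M a :: real
  assumes compact: "compact \<Lambda>"
    and forward: "y \<in> \<Lambda> \<Longrightarrow> quad c y \<in> \<Lambda>"
    and rho_ge_1: "y \<in> \<Lambda> \<Longrightarrow> 1 \<le> \<rho> y"
    and rho_le: "y \<in> \<Lambda> \<Longrightarrow> \<rho> y \<le> M"
    and M_pos: "0 < M"
    and kappa: "1 < \<kappa>"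
    and a_pos: "0 < a"
    and a_le: "y \<in> \<Lambda> \<Longrightarrow> a \<le> cmod y"
    and expand: "y \<in> \<Lambda> \<Longrightarrow> \<kappa> * \<rho> y \<le> 2 * cmod y * \<rho> (quad c y)"

text \<open>Mane's trick. With \<open>\<rho> z = (\<Sum>j\<le>N. \<bar>(q ^^ j)' z\<bar> / k ^ j)\<close> and \<open>k\<close> below the expansion rate, passing from
  \<open>z\<close> to \<open>q z\<close> shifts the sum by one index. It loses the term \<open>1\<close> and gains one that is at least
  \<open>1\<close> as soon as \<open>N\<close> is large enough.\<close>

lemma expanding_set_adapted_weight:
  assumes "compact \<Lambda>" "expanding_set (quad c) \<Lambda>"
  obtains \<rho> \<kappa> M a where "repeller c \<Lambda> \<rho> \<kappa> M a"
proof -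
  obtain C l where C: "C > 0" and l: "l > 1"
    and e: "\<And>z n. z \<in> \<Lambda> \<Longrightarrow> n \<ge> 1 \<Longrightarrow> C * l ^ n \<le> cmod (multiplier c n z)"
    using expanding_set_quadD[OF assms(2)] by blast
  have inv: "quad c -` \<Lambda> = \<Lambda>" using assms(2) by (simp add: expanding_set_def invariant_set_def)
  define k where "k = (1 + l) / 2"
  have k: "1 < k" "k < l" using l by (auto simp: k_def)
  then have "1 < l / k" by simp
  then obtain N where N: "1 / C < (l / k) ^ N" using real_arch_pow by blast
  define \<rho> where "\<rho> z = (\<Sum>j<Suc N. cmod (multiplier c j z) / k ^ j)" for z
  have cont: "continuous_on \<Lambda> \<rho>"
    unfolding \<rho>_def using k
    by (auto intro!: continuous_intros continuous_on_subset[OF continuous_on_multiplier])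
  then have "bounded (\<rho> ` \<Lambda>)" using assms(1) compact_continuous_image compact_imp_bounded by blast
  then obtain M where M: "M > 0" "\<And>z. z \<in> \<Lambda> \<Longrightarrow> norm (\<rho> z) \<le> M" unfolding bounded_pos by auto
  have "repeller c \<Lambda> \<rho> k M (C * l / 2)"
  proof
    fix y assume y: "y \<in> \<Lambda>"
    show "quad c y \<in> \<Lambda>" using y inv by blast
    have "\<rho> y = 1 + (\<Sum>j<N. cmod (multiplier c (Suc j) y) / k ^ Suc j)"
      unfolding \<rho>_def by (subst sum.lessThan_Suc_shift) simp
    also have "\<dots> \<ge> 1" using k by (simp add: sum_nonneg)
    finally show "1 \<le> \<rho> y" .
    show "\<rho> y \<le> M" using M(2)[OF y] by simp
    show "C * l / 2 \<le> cmod y" using e[OF y, of 1] by (simp add: multiplier_def norm_mult)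
    have "C * l ^ Suc N \<le> cmod (multiplier c (Suc N) y)" using e[OF y, of "Suc N"] by simp
    moreover have "k ^ Suc N \<le> C * l ^ Suc N"
    proof -
      have "1 \<le> C * (l / k) ^ N" using N C by (simp add: field_simps)
      also have "\<dots> \<le> C * (l / k) ^ Suc N" using C \<open>1 < l / k\<close> by (intro mult_left_mono power_increasing) auto
      finally show ?thesis using k by (simp add: power_divide field_simps)
    qed
    ultimately have big: "1 \<le> cmod (multiplier c (Suc N) y) / k ^ Suc N"
      using k by (simp add: field_simps)
    have "2 * cmod y * \<rho> (quad c y) = k * (\<Sum>j<Suc N. cmod (multiplier c (Suc j) y) / k ^ Suc j)"
      using k unfolding \<rho>_def sum_distrib_left
      by (intro sum.cong refl) (simp add: multiplier_Suc norm_mult)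
    also have "(\<Sum>j<Suc N. cmod (multiplier c (Suc j) y) / k ^ Suc j)
        = \<rho> y - 1 + cmod (multiplier c (Suc N) y) / k ^ Suc N"
      unfolding \<rho>_def by (subst (2) sum.lessThan_Suc_shift) simp
    also have "k * \<dots> \<ge> k * \<rho> y" using big k by simp
    finally show "k * \<rho> y \<le> 2 * cmod y * \<rho> (quad c y)" .
  qed (use assms k M C l in auto)
  then show ?thesis by (rule that)
qed

section \<open>Escape to infinity\<close>

text \<open>Once a term exceeds \<open>R\<close> and its predecessor, the sequence doubles forever. A bounded sequence therefore never
  rises above \<open>R\<close>, so that boundedness is equivalent to a family of closed conditions.\<close>

lemma escape_dichotomy:
  fixes t :: "nat \<Rightarrow> real"
  assumes grow: "\<And>n. R < t (Suc n) \<Longrightarrow> t n \<le> t (Suc n) \<Longrightarrow> 2 * t (Suc n) \<le> t (Suc (Suc n))"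
    and "0 < R" "\<And>n. 0 \<le> t n"
  shows "bounded (range t) \<longleftrightarrow> (\<forall>n. t n \<le> max R (t 0))"
proof
  assume "bounded (range t)"
  then obtain B where B: "\<And>n. t n \<le> B" unfolding bounded_iff by (auto simp: abs_le_iff)
  have no: "\<not> (R < t (Suc n) \<and> t n \<le> t (Suc n))" for n
  proof
    assume a: "R < t (Suc n) \<and> t n \<le> t (Suc n)"
    have *: "2 ^ k * R \<le> t (Suc (n + k)) \<and> R < t (Suc (n + k)) \<and> t (n + k) \<le> t (Suc (n + k))" for k
    proof (induction k)
      case 0
      then show ?case using a by auto
    next
      case (Suc k)
      then have "2 * t (Suc (n + k)) \<le> t (Suc (Suc (n + k)))" using grow by blast
      then show ?case using Suc \<open>0 < R\<close> by auto
    qed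
    obtain k where "B / R < 2 ^ k" using real_arch_pow[of 2 "B / R"] by auto
    then have "B < 2 ^ k * R" using \<open>0 < R\<close> by (simp add: field_simps)
    then show False using *[of k] B[of "Suc (n + k)"] by linarith
  qed
  show "\<forall>n. t n \<le> max R (t 0)"
  proof
    fix n
    show "t n \<le> max R (t 0)"
    proof (induction n)
      case (Suc n)
      then show ?case using no[of n] by linarith
    qed simp
  qed
next
  assume "\<forall>n. t n \<le> max R (t 0)"
  then have "norm (t n) \<le> max R (t 0)" for n using assms(3) by simp
  then show "bounded (range t)" unfolding bounded_iff by blast
qed

lemma henon_growth:
  assumes R: "3 + cmod c \<le> R" and "R < cmod x" and "cmod y \<le> cmod x" "cmod b \<le> 1"
  shows "2 * cmod x \<le> cmod (x\<^sup>2 + c - b * y)"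
    and "b \<noteq> 0 \<Longrightarrow> 2 * cmod x \<le> cmod ((x\<^sup>2 + c - y) / b)"
proof -
  have big: "2 * cmod x \<le> cmod (x\<^sup>2 + c - w)" if w: "cmod w \<le> cmod x" for w
  proof -
    have "(3 + cmod c) * cmod x \<le> cmod x * cmod x" using assms by (intro mult_right_mono) auto
    moreover have "cmod c * 1 \<le> cmod c * cmod x" 
      using assms norm_ge_zero[of c] by (intro mult_left_mono) linarith+
    moreover have "cmod (x\<^sup>2 + (c - w)) \<ge> cmod (x\<^sup>2) - cmod (c - w)" by (rule norm_diff_ineq)
    moreover have "cmod (c - w) \<le> cmod c + cmod w" by (rule norm_triangle_ineq4)
    ultimately show ?thesis using w by (simp add: norm_power norm_mult power2_eq_square algebra_simps)
  qed
  have "cmod (b * y) \<le> 1 * cmod x" unfolding norm_mult using assms by (intro mult_mono) auto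
  then show "2 * cmod x \<le> cmod (x\<^sup>2 + c - b * y)" using big by simp
  show "2 * cmod x \<le> cmod ((x\<^sup>2 + c - y) / b)" if "b \<noteq> 0"
  proof -
    have "2 * cmod x * cmod b \<le> 2 * cmod x * 1" using assms by (intro mult_left_mono) auto
    also have "\<dots> \<le> cmod (x\<^sup>2 + c - y)" using big[of y] assms by simp
    finally show ?thesis using that by (simp add: norm_divide field_simps)
  qed
qed

lemma bounded_orbit_quad_iff:
  assumes R: "3 + cmod c \<le> R"
  shows "x \<in> bounded_orbit_set (quad c) \<longleftrightarrow> (\<forall>n. cmod ((quad c ^^ n) x) \<le> R)"
proof -
  have pos: "0 < R" using R norm_ge_zero[of c] by linarith
  \<comment> \<open>A fictitious zeroth term \<open>0\<close> turns the bound \<open>max R (t 0)\<close> into \<open>R\<close>.\<close>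
  define t where "t = case_nat 0 (\<lambda>n. cmod ((quad c ^^ n) x))"
  have "bounded (range t) \<longleftrightarrow> (\<forall>n. t n \<le> max R (t 0))"
  proof (rule escape_dichotomy)
    fix n assume "R < t (Suc n)" 
    then have "R < cmod ((quad c ^^ n) x)" by (simp add: t_def)
    then show "2 * t (Suc n) \<le> t (Suc (Suc n))"
      using henon_growth(1)[OF R, of "(quad c ^^ n) x" 0 0] by (simp add: t_def quad_def)
  qed (use pos in \<open>auto simp: t_def split: nat.splits\<close>)
  also have "\<dots> \<longleftrightarrow> (\<forall>n. cmod ((quad c ^^ n) x) \<le> R)"
    using pos by (auto simp: t_def max_def dest: spec[of _ "Suc _"] split: nat.splits)
  also have "range t = insert 0 (range (\<lambda>n. cmod ((quad c ^^ n) x)))"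
    by (auto simp: t_def image_iff split: nat.splits)
  finally show ?thesis unfolding bounded_insert by (simp add: bounded_orbit_set_def bounded_iff)
qed

lemma quad_bounded_orbit_invariant:
  "quad c x \<in> bounded_orbit_set (quad c) \<longleftrightarrow> x \<in> bounded_orbit_set (quad c)"
proof -
  have 1: "(\<forall>n. cmod ((quad c ^^ n) x) \<le> R) \<longrightarrow> (\<forall>n. cmod ((quad c ^^ n) (quad c x)) \<le> R)" for R
    by (metis funpow_Suc_right o_apply)
  have "cmod ((quad c ^^ n) x) \<le> max R (cmod x)" if "\<forall>n. cmod ((quad c ^^ n) (quad c x)) \<le> R" for n R
    using that[rule_format, of "n - 1"] by (cases n) (auto simp: funpow_swap1)
  then have 2: "bounded (range (\<lambda>n. (quad c ^^ n) x))" 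
    if "\<forall>n. cmod ((quad c ^^ n) (quad c x)) \<le> R" for R
    using that unfolding bounded_iff by blast
  show ?thesis
  proof
    assume "quad c x \<in> bounded_orbit_set (quad c)"
    then have "\<forall>n. cmod ((quad c ^^ n) (quad c x)) \<le> 3 + cmod c"
      using bounded_orbit_quad_iff[OF order_refl] by blast
    then show "x \<in> bounded_orbit_set (quad c)" unfolding bounded_orbit_set_def using 2 by blast
  next
    assume "x \<in> bounded_orbit_set (quad c)"
    then show "quad c x \<in> bounded_orbit_set (quad c)" using 1 unfolding bounded_orbit_quad_iff[OF order_refl] by blast
  qed
qed

lemma quad_fixed_point: obtains p where "quad c p = p"
proof
  show "quad c ((1 + csqrt (1 - 4 * c)) / 2) = (1 + csqrt (1 - 4 * c)) / 2"
    unfolding quad_def power_divide power2_sum power2_csqrt by (simp add: field_simps)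
qed

lemma julia_quad_nonempty: "julia (quad c) \<noteq> {}"
proof -
  obtain p where p: "quad c p = p" by (rule quad_fixed_point)
  then have "(quad c ^^ n) p = p" for n by (induction n) auto
  then have "p \<in> bounded_orbit_set (quad c)" by (simp add: bounded_orbit_set_def)
  moreover have "of_real (4 + cmod c) \<notin> bounded_orbit_set (quad c)"
    unfolding bounded_orbit_quad_iff[OF order_refl] not_all
    by (rule exI[of _ 0]) (simp del: of_real_add)
  ultimately show ?thesis unfolding julia_def frontier_eq_empty by blast
qed

text \<open>Suppose that a disc around a point of the Julia set misses \<open>\<Lambda>\<close>. By total invariance all iterates map the disc
  into the complement of \<open>\<Lambda>\<close>, so they omit the two square roots \<open>p\<close> and \<open>- p\<close> of \<open>y - c\<close>
  for some \<open>y \<in> \<Lambda>\<close>. As their values at the centre are bounded, Schottky's theorem bounds them on a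
  smaller disc, which puts the centre into the interior of the filled Julia set.\<close>

lemma totally_invariant_eq_julia:
  assumes sub: "\<Lambda> \<subseteq> julia (quad c)" and inv: "invariant_set (quad c) \<Lambda>" and "compact \<Lambda>"
    and ne: "\<Lambda> \<noteq> {}" and nz: "0 \<notin> \<Lambda>"
  shows "\<Lambda> = julia (quad c)"
proof (rule ccontr)
  let ?K = "bounded_orbit_set (quad c)" let ?R = "3 + cmod c"
  have inv: "quad c x \<in> \<Lambda> \<longleftrightarrow> x \<in> \<Lambda>" for x using inv unfolding invariant_set_def by blast
  obtain y where y: "y \<in> \<Lambda>" using ne by blast
  define p where "p = csqrt (y - c)"
  have "quad c p = y" "quad c (- p) = y" by (auto simp: p_def quad_def)
  then have p: "p \<in> \<Lambda>" "- p \<in> \<Lambda>" using inv y by metis+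
  then have "p \<noteq> 0" using nz by auto
  assume "\<Lambda> \<noteq> julia (quad c)"
  then obtain x0 where x0: "x0 \<in> julia (quad c)" "x0 \<notin> \<Lambda>" using sub by blast
  have "open (- \<Lambda>)" using \<open>compact \<Lambda>\<close> compact_imp_closed by blast
  then obtain r where r: "r > 0" "cball x0 r \<subseteq> - \<Lambda>" using x0 open_contains_cball_eq[of "-\<Lambda>"] by blast
  have "closed ?K"
  proof -
    have "closed {x. cmod ((quad c ^^ n) x) \<le> ?R}" for n
      using has_field_derivative_quad_iterate[where c=c and n=n]
      by (intro closed_Collect_le continuous_intros)
         (meson DERIV_continuous_on has_field_derivative_at_within)
    moreover have "?K = (\<Inter>n. {x. cmod ((quad c ^^ n) x) \<le> ?R})"
      using bounded_orbit_quad_iff[OF order_refl] by auto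
    ultimately show ?thesis by auto
  qed
  then have x0K: "x0 \<in> ?K" using x0 frontier_subset_closed unfolding julia_def by blast
  define B where "B = exp (pi * exp (pi * (2 + 2 * ((?R + cmod p) / (2 * cmod p)) + 12 * (1/2) / (1 - 1/2))))"
  have "ball x0 (r / 2) \<subseteq> ?K"
  proof
    fix z assume z: "z \<in> ball x0 (r / 2)"
    define w where "w = (z - x0) / of_real r"
    have w: "cmod w \<le> 1/2" "x0 + of_real r * w = z"
      using z r by (auto simp: w_def norm_divide dist_norm norm_minus_commute field_simps)
    have "cmod ((quad c ^^ n) z) \<le> 2 * cmod p * B + cmod p" for n
    proof -
      \<comment> \<open>Affine normalisation: \<open>h\<close> omits \<open>0\<close> and \<open>1\<close> because the iterate omits \<open>- p\<close> and \<open>p\<close>.\<close>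
      define h where "h u = ((quad c ^^ n) (x0 + of_real r * u) + p) / (2 * p)" for u
      have avoid: "(quad c ^^ n) u \<in> \<Lambda> \<longleftrightarrow> u \<in> \<Lambda>" for u
        by (induction n) (auto simp: inv)
      have hol: "h holomorphic_on cball 0 1"
      proof -
        have "(quad c ^^ n) holomorphic_on UNIV"
          using has_field_derivative_quad_iterate[where c=c and n=n] 
          by (auto simp: holomorphic_on_def field_differentiable_def)
        then have "(quad c ^^ n \<circ> (\<lambda>u. x0 + of_real r * u)) holomorphic_on cball 0 1"
          by (intro holomorphic_on_compose holomorphic_intros) (auto intro: holomorphic_on_subset)
        then show ?thesis unfolding h_def[abs_def] using \<open>p \<noteq> 0\<close> by (auto simp: o_def intro!: holomorphic_intros)
      qed
      have "cmod (h w) \<le> B" unfolding B_def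
      proof (rule Schottky[OF hol])
        have "cmod ((quad c ^^ n) x0) \<le> ?R" using x0K bounded_orbit_quad_iff[OF order_refl] by blast
        then have "cmod ((quad c ^^ n) x0 + p) \<le> ?R + cmod p" using norm_triangle_mono by blast
        then show "cmod (h 0) \<le> (?R + cmod p) / (2 * cmod p)"
          by (simp add: h_def norm_divide norm_mult divide_right_mono)
        fix u :: complex assume "u \<in> cball 0 1"
        then have "x0 + of_real r * u \<in> cball x0 r" using r by (auto simp: dist_norm norm_mult)
        then have "(quad c ^^ n) (x0 + of_real r * u) \<notin> \<Lambda>" using r avoid by blast
        then have "(quad c ^^ n) (x0 + of_real r * u) \<noteq> p" "(quad c ^^ n) (x0 + of_real r * u) \<noteq> - p"
          using p by auto
        then show "\<not> (h u = 0 \<or> h u = 1)" 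
          using \<open>p \<noteq> 0\<close> by (auto simp: h_def field_simps add_eq_0_iff2)
      qed (use w in auto)
      moreover have "(quad c ^^ n) z = 2 * p * h w - p" using w \<open>p \<noteq> 0\<close> by (simp add: h_def)
      then have "cmod ((quad c ^^ n) z) \<le> 2 * cmod p * cmod (h w) + cmod p"
        by (metis norm_triangle_ineq4 norm_mult norm_numeral)
      moreover have "2 * cmod p * cmod (h w) \<le> 2 * cmod p * B" 
        using calculation by (intro mult_left_mono) auto
      ultimately show ?thesis by linarith
    qed
    then show "z \<in> ?K" unfolding bounded_orbit_set_def bounded_iff by blast
  qed
  then have "x0 \<in> interior ?K" using r by (meson centre_in_ball half_gt_zero interior_maximal open_ball subset_eq)
  then show False using x0 by (simp add: julia_def frontier_def)
qed

section \<open>Complex differentiable self-maps of the plane with delayed coordinates\<close>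

lemma scaleC2_simps [simp]: "fst (scaleC2 a v) = a * fst v" "snd (scaleC2 a v) = a * snd v"
  by (simp_all add: scaleC2_def)

lemma norm_scaleC2: "norm (scaleC2 a v) = cmod a * norm v"
  by (simp add: scaleC2_def norm_prod_def norm_mult power_mult_distrib real_sqrt_mult
      flip: distrib_left)

lemma bounded_linear_scaleC2: "bounded_linear (\<lambda>t. scaleC2 t v)"
  unfolding scaleC2_def
  by (intro bounded_linear_Pair bounded_linear_mult_left)

text \<open>Complex differentiability in two variables, as real differentiability with complex linear derivative.\<close>

definition complex_differentiable2 :: "(complex \<times> complex \<Rightarrow> complex \<times> complex) \<Rightarrow> bool" where
  "complex_differentiable2 f \<longleftrightarrow>
     (\<forall>z. \<exists>D. (f has_derivative D) (at z) \<and> (\<forall>a v. D (scaleC2 a v) = scaleC2 a (D v)))"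

lemma complex_differentiable2_iterate:
  assumes "complex_differentiable2 f"
  shows "complex_differentiable2 (f ^^ n)"
proof (induction n)
  case 0
  have "(id has_derivative (\<lambda>x. x)) (at z)" for z :: "complex \<times> complex" unfolding id_def by (rule has_derivative_ident)
  then show ?case unfolding complex_differentiable2_def funpow.simps by blast
next
  case (Suc n)
  show ?case unfolding complex_differentiable2_def
  proof
    fix z
    obtain D where D: "((f ^^ n) has_derivative D) (at z)" "\<And>a v. D (scaleC2 a v) = scaleC2 a (D v)"
      using Suc unfolding complex_differentiable2_def by blast
    obtain E where E: "(f has_derivative E) (at ((f ^^ n) z))" "\<And>a v. E (scaleC2 a v) = scaleC2 a (E v)"
      using assms unfolding complex_differentiable2_def by blast
    have "((f ^^ Suc n) has_derivative E \<circ> D) (at z)" using diff_chain_at[OF D(1) E(1)] by simp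
    moreover have "\<forall>a v. (E \<circ> D) (scaleC2 a v) = scaleC2 a ((E \<circ> D) v)" using D E by simp
    ultimately show "\<exists>D. ((f ^^ Suc n) has_derivative D) (at z) \<and> (\<forall>a v. D (scaleC2 a v) = scaleC2 a (D v))"
      by blast
  qed
qed

text \<open>A map of this kind is a second order recurrence: \<open>Q\<close> remembers the previous value of \<open>P\<close>. The Henon map is one
  with \<open>(P, Q) = (fst, snd)\<close> and its inverse is one with \<open>(P, Q) = (snd, fst)\<close>, so both directions of time are
  treated together.\<close>

locale delay_map =
  fixes f :: "complex \<times> complex \<Rightarrow> complex \<times> complex"
    and P Q :: "complex \<times> complex \<Rightarrow> complex" and R :: real
  assumes coords: "P = fst \<and> Q = snd \<or> P = snd \<and> Q = fst"
    and delay: "Q (f z) = P z"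
    and grow: "R < cmod (P z) \<Longrightarrow> cmod (Q z) \<le> cmod (P z) \<Longrightarrow> 2 * cmod (P z) \<le> cmod (P (f z))"
    and R_pos: "0 < R"
    and diff: "complex_differentiable2 f"
begin

lemma bounded_linear_P: "bounded_linear P" and bounded_linear_Q: "bounded_linear Q"
  using coords by (auto simp: bounded_linear_fst bounded_linear_snd)

lemma norm_coord_le: "cmod (P z) \<le> norm z" "cmod (Q z) \<le> norm z" "norm z \<le> cmod (P z) + cmod (Q z)"
  using coords norm_fst_le[of "fst z" "snd z"] norm_snd_le[of "snd z" "fst z"]
    norm_Pair_le[of "fst z" "snd z"] by auto

lemma continuous_iterate: "continuous_on A (f ^^ n)"
  using complex_differentiable2_iterate[OF diff, of n] unfolding complex_differentiable2_def
  by (meson continuous_at_imp_continuous_on has_derivative_continuous)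

text \<open>The orbit is governed by the sequence \<open>\<bar>Q z\<bar>, \<bar>P z\<bar>, \<bar>P (f z)\<bar>, \<dots>\<close>, to which \<open>escape_dichotomy\<close> applies. The
  bound is locally uniform in \<open>z\<close>, which is what Cauchy's estimate needs below.\<close>

lemma bounded_orbit_iff:
  "z \<in> bounded_orbit_set f \<longleftrightarrow> (\<forall>n. cmod (P ((f ^^ n) z)) \<le> max R (cmod (Q z)))"
proof -
  define t where "t = case_nat (cmod (Q z)) (\<lambda>n. cmod (P ((f ^^ n) z)))"
  have tQ: "t n = cmod (Q ((f ^^ n) z))" for n
    by (cases n) (auto simp: t_def delay)
  have dich: "bounded (range t) \<longleftrightarrow> (\<forall>n. t n \<le> max R (t 0))"
  proof (rule escape_dichotomy)
    fix n assume "R < t (Suc n)" "t n \<le> t (Suc n)"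
    then show "2 * t (Suc n) \<le> t (Suc (Suc n))"
      using grow[of "(f ^^ n) z"] by (simp add: tQ[of n]) (simp add: t_def)
  qed (auto simp: tQ R_pos)
  have tP: "cmod (P ((f ^^ n) z)) = t (Suc n)" for n by (simp add: t_def)
  have "z \<in> bounded_orbit_set f \<longleftrightarrow> bounded (range t)"
  proof
    assume "z \<in> bounded_orbit_set f"
    then obtain B where "\<And>n. norm ((f ^^ n) z) \<le> B" unfolding bounded_orbit_set_def bounded_iff by auto
    then have "t n \<le> B" for n unfolding tQ using norm_coord_le(2) order_trans by blast
    then have "norm (t n) \<le> B" for n by (simp add: tQ)
    then show "bounded (range t)" unfolding bounded_iff by blast
  next
    assume "bounded (range t)"
    then obtain B where B: "\<And>n. norm (t n) \<le> B" unfolding bounded_iff by auto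
    have "norm ((f ^^ n) z) \<le> B + B" for n
      using norm_coord_le(3)[of "(f ^^ n) z"] B[of n] B[of "Suc n"] unfolding tP tQ[symmetric] real_norm_def by linarith
    then show "z \<in> bounded_orbit_set f" unfolding bounded_orbit_set_def bounded_iff by blast
  qed
  also have "\<dots> \<longleftrightarrow> (\<forall>n. cmod (P ((f ^^ n) z)) \<le> max R (cmod (Q z)))"
    unfolding dich tP
  proof (intro iffI allI)
    fix n assume "\<forall>n. t (Suc n) \<le> max R (cmod (Q z))"
    then show "t n \<le> max R (t 0)" using tQ[of 0] by (cases n) auto
  qed (use tQ[of 0] in auto)
  finally show ?thesis .
qed

lemma closed_bounded_orbit_set: "closed (bounded_orbit_set f)"
proof -
  have "continuous_on UNIV P" "continuous_on UNIV Q"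
    using bounded_linear_P bounded_linear_Q by (auto intro: linear_continuous_on)
  then have "continuous_on UNIV (\<lambda>z. P ((f ^^ n) z))" for n
    using continuous_on_compose2[of UNIV P UNIV "f ^^ n"] continuous_iterate by auto
  then have "closed {z. cmod (P ((f ^^ n) z)) \<le> max R (cmod (Q z))}" for n
    using \<open>continuous_on UNIV Q\<close> by (intro closed_Collect_le continuous_intros) auto
  moreover have "bounded_orbit_set f = (\<Inter>n. {z. cmod (P ((f ^^ n) z)) \<le> max R (cmod (Q z))})"
    using bounded_orbit_iff by auto
  ultimately show ?thesis by auto
qed

text \<open>Restrict the iterates to the complex line through \<open>z\<close> in direction \<open>v\<close>. On a disc in this line they are
  holomorphic with a common bound, and Cauchy's estimate bounds their derivatives at \<open>z\<close>.\<close>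

lemma interior_derivative_bounded:
  assumes "z \<in> interior (bounded_orbit_set f)"
  obtains B where "\<And>n D. ((f ^^ n) has_derivative D) (at z) \<Longrightarrow> cmod (P (D v)) \<le> B"
proof -
  obtain r where r: "r > 0" "ball z r \<subseteq> bounded_orbit_set f"
    using assms mem_interior by blast
  define d where "d = r / (2 * (norm v + 1))"
  have d: "d > 0" using r by (simp add: d_def add_nonneg_pos)
  have small: "norm (scaleC2 t v) < r" if "cmod t \<le> d" for t
  proof -
    have "norm (scaleC2 t v) \<le> d * norm v" unfolding norm_scaleC2 using that by (intro mult_right_mono) auto
    also have "\<dots> \<le> d * (norm v + 1)" using d by simp
    also have "\<dots> = r / 2" by (simp add: d_def field_simps add_nonneg_eq_0_iff)
    finally show ?thesis using r by simp
  qed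
  show ?thesis
  proof
    fix n D assume D: "((f ^^ n) has_derivative D) (at z)"
    let ?B = "max R (cmod (Q z) + r)"
    define h where "h t = P ((f ^^ n) (z + scaleC2 t v))" for t
    have hd: "(h has_field_derivative P (E v)) (at t)" 
      if E: "((f ^^ n) has_derivative E) (at (z + scaleC2 t v))" "\<And>a v. E (scaleC2 a v) = scaleC2 a (E v)" for E t
    proof -
      have "((\<lambda>t. z + scaleC2 t v) has_derivative (\<lambda>s. scaleC2 s v)) (at t)"
        using has_derivative_add[OF has_derivative_const bounded_linear_imp_has_derivative[OF bounded_linear_scaleC2]] by simp
      from diff_chain_at[OF diff_chain_at[OF this E(1)] bounded_linear_imp_has_derivative[OF bounded_linear_P]]
      have "(h has_derivative (\<lambda>s. P (E (scaleC2 s v)))) (at t)" unfolding h_def[abs_def] by (simp add: o_def)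
      moreover have "P (E (scaleC2 s v)) = P (E v) * s" for s using E(2) coords by (auto simp: mult.commute)
      ultimately show ?thesis by (simp add: has_field_derivative_def)
    qed
    have ex: "\<exists>E. ((f ^^ n) has_derivative E) (at y) \<and> (\<forall>a v. E (scaleC2 a v) = scaleC2 a (E v))" for y
      using complex_differentiable2_iterate[OF diff, of n] unfolding complex_differentiable2_def by blast
    have hol: "h holomorphic_on UNIV"
      unfolding holomorphic_on_def field_differentiable_def using hd ex by (metis has_field_derivative_at_within)
    have "cmod ((deriv ^^ 1) h 0) \<le> fact 1 * ?B / d ^ 1"
    proof (rule Cauchy_inequality)
      show "h holomorphic_on ball 0 d" "continuous_on (cball 0 d) h"
        using hol holomorphic_on_imp_continuous_on holomorphic_on_subset by blast+
      fix t :: complex assume "cmod (0 - t) = d"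
      then have s: "norm (scaleC2 t v) < r" using small by simp
      then have "z + scaleC2 t v \<in> ball z r" by (simp add: dist_norm)
      then have "cmod (h t) \<le> max R (cmod (Q (z + scaleC2 t v)))"
        using r bounded_orbit_iff unfolding h_def by blast
      moreover have "Q (z + scaleC2 t v) = Q z + Q (scaleC2 t v)" using coords by auto
      then have "cmod (Q (z + scaleC2 t v)) \<le> cmod (Q z) + r"
        using norm_triangle_ineq[of "Q z" "Q (scaleC2 t v)"] norm_coord_le(2)[of "scaleC2 t v"] s by simp
      ultimately show "cmod (h t) \<le> ?B" by linarith
    qed (rule d)
    moreover have "deriv h 0 = P (D v)"
    proof -
      obtain E where E: "((f ^^ n) has_derivative E) (at z)" "\<And>a v. E (scaleC2 a v) = scaleC2 a (E v)"
        using ex by blast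
      then have "E = D" using D has_derivative_unique by blast
      moreover have "z + scaleC2 0 v = z" by (simp add: scaleC2_def flip: zero_prod_def)
      then have "(h has_field_derivative P (E v)) (at 0)" using hd[of E 0] E by simp
      ultimately show ?thesis using DERIV_imp_deriv by blast
    qed
    ultimately show "cmod (P (D v)) \<le> ?B / d" by simp
  qed
qed

end

section \<open>The Henon map and its inverse\<close>

definition henon_inv :: "complex \<Rightarrow> complex \<Rightarrow> complex \<times> complex \<Rightarrow> complex \<times> complex" where
  "henon_inv c b = (\<lambda>(u, v). (v, (v\<^sup>2 + c - u) / b))"

lemma fst_snd_henon [simp]:
  "fst (henon c b z) = (fst z)\<^sup>2 + c - b * snd z" "snd (henon c b z) = fst z"
  by (simp_all add: henon_def split_beta)

lemma fst_snd_henon_inv [simp]: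
  "fst (henon_inv c b z) = snd z" "snd (henon_inv c b z) = ((snd z)\<^sup>2 + c - fst z) / b"
  by (simp_all add: henon_inv_def split_beta)

lemma henon_inverse:
  assumes "b \<noteq> 0"
  shows "henon c b (henon_inv c b z) = z" "henon_inv c b (henon c b z) = z"
  using assms by (auto simp: prod_eq_iff)

lemma bij_henon: "b \<noteq> 0 \<Longrightarrow> bij (henon c b)"
  by (rule o_bij[of "henon_inv c b"]) (auto simp: henon_inverse)

lemma inv_henon: "b \<noteq> 0 \<Longrightarrow> inv (henon c b) = henon_inv c b"
  by (rule inv_equality) (auto simp: henon_inverse)

definition Dhenon :: "complex \<Rightarrow> complex \<times> complex \<Rightarrow> complex \<times> complex \<Rightarrow> complex \<times> complex" where
  "Dhenon b z v = (2 * fst z * fst v - b * snd v, fst v)"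

definition Dhenon_inv :: "complex \<Rightarrow> complex \<times> complex \<Rightarrow> complex \<times> complex \<Rightarrow> complex \<times> complex" where
  "Dhenon_inv b z v = (snd v, (2 * snd z * snd v - fst v) / b)"

lemma has_derivative_henon: "(henon c b has_derivative Dhenon b z) (at z)"
proof -
  have "((\<lambda>z. ((fst z)\<^sup>2 + c - b * snd z, fst z)) has_derivative (\<lambda>v. (2 * fst z * fst v - b * snd v, fst v))) (at z)"
    by (auto intro!: derivative_eq_intros)
  moreover have "henon c b = (\<lambda>z. ((fst z)\<^sup>2 + c - b * snd z, fst z))" by (simp add: fun_eq_iff prod_eq_iff)
  ultimately show ?thesis by (simp add: Dhenon_def[abs_def])
qed

lemma has_derivative_henon_inv:
  assumes "b \<noteq> 0"
  shows "(henon_inv c b has_derivative Dhenon_inv b z) (at z)"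
proof -
  have "((\<lambda>z. (snd z, ((snd z)\<^sup>2 + c - fst z) * inverse b)) has_derivative
      (\<lambda>v. (snd v, (2 * snd z * snd v - fst v) * inverse b))) (at z)"
    by (auto intro!: derivative_eq_intros)
  moreover have "henon_inv c b = (\<lambda>z. (snd z, ((snd z)\<^sup>2 + c - fst z) * inverse b))"
    by (simp add: fun_eq_iff prod_eq_iff divide_inverse)
  ultimately show ?thesis by (simp add: Dhenon_inv_def[abs_def] divide_inverse)
qed

lemma frechet_derivative_henon: "frechet_derivative (henon c b) (at z) = Dhenon b z"
  using has_derivative_henon by (rule frechet_derivative_at[symmetric])

lemma diffeomorphism_henon:
  assumes "b \<noteq> 0"
  shows "diffeomorphism (henon c b)"
proof -
  have "C1_map (henon c b)"
    unfolding C1_map_def frechet_derivative_henon differentiable_on_def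
    using differentiable_at_withinI[OF differentiableI[OF has_derivative_henon]]
    by (auto simp: Dhenon_def intro!: continuous_intros)
  moreover have "frechet_derivative (henon_inv c b) (at z) = Dhenon_inv b z" for z
    using has_derivative_henon_inv[OF assms] by (rule frechet_derivative_at[symmetric])
  then have "C1_map (henon_inv c b)"
    unfolding C1_map_def differentiable_on_def
    using differentiable_at_withinI[OF differentiableI[OF has_derivative_henon_inv[OF assms]]] assms
    by (auto simp: Dhenon_inv_def intro!: continuous_intros)
  ultimately show ?thesis using bij_henon[OF assms] by (simp add: diffeomorphism_def inv_henon[OF assms])
qed

lemma delay_map_henon:
  assumes R: "3 + cmod c \<le> R" and "cmod b \<le> 1"
  shows "delay_map (henon c b) fst snd R"
proof
  have "\<exists>D. (henon c b has_derivative D) (at z) \<and> (\<forall>a v. D (scaleC2 a v) = scaleC2 a (D v))" for z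
    using has_derivative_henon
    by (intro exI[of _ "Dhenon b z"]) (auto simp: Dhenon_def scaleC2_def algebra_simps)
  then show "complex_differentiable2 (henon c b)" by (simp add: complex_differentiable2_def)
  show "0 < R" using R norm_ge_zero[of c] by linarith
qed (use henon_growth(1)[OF R] assms in auto)

lemma delay_map_henon_inv:
  assumes R: "3 + cmod c \<le> R" and "cmod b \<le> 1" "b \<noteq> 0"
  shows "delay_map (henon_inv c b) snd fst R"
proof
  have "\<exists>D. (henon_inv c b has_derivative D) (at z) \<and> (\<forall>a v. D (scaleC2 a v) = scaleC2 a (D v))" for z
    using has_derivative_henon_inv[OF assms(3)] assms(3)
    by (intro exI[of _ "Dhenon_inv b z"]) (auto simp: Dhenon_inv_def scaleC2_def field_simps)
  then show "complex_differentiable2 (henon_inv c b)" by (simp add: complex_differentiable2_def)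
  show "0 < R" using R norm_ge_zero[of c] by linarith
qed (use henon_growth(2)[OF R] assms in auto)

text \<open>The orbit of \<open>(s 1, s 0)\<close> under \<open>henon c b\<close> consists of the points \<open>(s (n + 1), s n)\<close>.\<close>

definition henon_recurrence :: "complex \<Rightarrow> complex \<Rightarrow> (int \<Rightarrow> complex) \<Rightarrow> bool" where
  "henon_recurrence c b s \<longleftrightarrow> (\<forall>n. s (n + 1) = (s n)\<^sup>2 + c - b * s (n - 1))"

lemma henon_recurrence_iterate:
  assumes "henon_recurrence c b s"
  shows "(henon c b ^^ k) (s n, s (n - 1)) = (s (n + int k), s (n + int k - 1))"
proof (induction k)
  case (Suc k)
  have "s (n + int k + 1) = (s (n + int k))\<^sup>2 + c - b * s (n + int k - 1)"
    using assms unfolding henon_recurrence_def by blast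
  with Suc show ?case by (simp add: henon_def algebra_simps)
qed simp

lemma henon_recurrence_iterate_inv:
  assumes "henon_recurrence c b s" "b \<noteq> 0"
  shows "(henon_inv c b ^^ k) (s n, s (n - 1)) = (s (n - int k), s (n - int k - 1))"
proof (induction k)
  case (Suc k)
  have "s (n - int k) = (s (n - int k - 1))\<^sup>2 + c - b * s (n - int k - 2)"
    using assms(1)[unfolded henon_recurrence_def, rule_format, of "n - int k - 1"] by (simp add: algebra_simps)
  then have "s (n - int k - 2) = ((s (n - int k - 1))\<^sup>2 + c - s (n - int k)) / b"
    using assms(2) by (simp add: field_simps)
  with Suc show ?case by (simp add: henon_inv_def algebra_simps)
qed simp

lemma henon_recurrence_unique:
  assumes "henon_recurrence c b s" "henon_recurrence c b t" "b \<noteq> 0" "s 1 = t 1" "s 0 = t 0"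
  shows "s = t"
proof
  fix n :: int
  show "s n = t n"
  proof (cases "n \<ge> 0")
    case True
    then show ?thesis
      using henon_recurrence_iterate[OF assms(1), of "nat n" 1] henon_recurrence_iterate[OF assms(2), of "nat n" 1] assms(4,5)
      by simp
  next
    case False
    then show ?thesis
      using henon_recurrence_iterate_inv[OF assms(1,3), of "nat (- n)" 1] henon_recurrence_iterate_inv[OF assms(2,3), of "nat (-n)" 1] assms(4,5)
      by simp
  qed
qed

lemma henon_recurrence_exists:
  assumes "b \<noteq> 0"
  obtains s where "henon_recurrence c b s" "z = (s 1, s 0)"
proof
  define w where "w n = (if n \<ge> 0 then (henon c b ^^ nat n) z else (henon_inv c b ^^ nat (- n)) z)" for n :: int
  have step: "w (n + 1) = henon c b (w n)" for n
  proof (cases "n \<ge> 0")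
    case True
    then show ?thesis by (simp add: w_def nat_add_distrib)
  next
    case False
    then have "nat (- n) = Suc (nat (- (n + 1)))" by linarith
    then have "w n = henon_inv c b ((henon_inv c b ^^ nat (- (n + 1))) z)" using False by (simp add: w_def)
    moreover have "(henon_inv c b ^^ nat (- (n + 1))) z = w (n + 1)" using False
      by (cases "n = -1") (auto simp: w_def)
    ultimately show ?thesis using henon_inverse(1)[OF assms] by simp
  qed
  define s where "s n = snd (w n)" for n
  have fw: "fst (w n) = s (n + 1)" for n by (simp add: s_def step)
  have w: "w n = (s (n + 1), s n)" for n by (simp add: prod_eq_iff fw s_def)
  show "henon_recurrence c b s" unfolding henon_recurrence_def
  proof
    fix n
    have "s (n + 1) = fst (w (n - 1 + 1))" by (simp add: fw)
    also have "\<dots> = (fst (w (n - 1)))\<^sup>2 + c - b * snd (w (n - 1))" unfolding step by simp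
    also have "\<dots> = (s n)\<^sup>2 + c - b * s (n - 1)" by (simp add: w)
    finally show "s (n + 1) = (s n)\<^sup>2 + c - b * s (n - 1)" .
  qed
  show "z = (s 1, s 0)" using w[of 0] by (simp add: w_def)
qed

text \<open>The escape criterion applies to a two-sided sequence in both directions of time. At each place the larger one of two
  neighbouring entries is at most \<open>R\<close>, since otherwise it would start an escape, forward or backward.\<close>

lemma bounded_recurrence_iff:
  assumes R: "3 + cmod c \<le> R" and b: "cmod b \<le> 1" "b \<noteq> 0" and s: "henon_recurrence c b s"
  shows "(s (n + 1), s n) \<in> bounded_orbit_set (henon c b) \<inter> bounded_orbit_set (inv (henon c b))
    \<longleftrightarrow> (\<forall>n. cmod (s n) \<le> R)"
proof -
  interpret f: delay_map "henon c b" fst snd R by (rule delay_map_henon[OF R b(1)])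
  interpret g: delay_map "henon_inv c b" snd fst R by (rule delay_map_henon_inv[OF R b])
  have F: "(henon c b ^^ k) (s (n + 1), s n) = (s (n + 1 + int k), s (n + int k))" for k
    using henon_recurrence_iterate[OF s, of k "n + 1"] by (simp add: algebra_simps)
  have G: "(henon_inv c b ^^ k) (s (n + 1), s n) = (s (n + 1 - int k), s (n - int k))" for k
    using henon_recurrence_iterate_inv[OF s b(2), of k "n + 1"] by (simp add: algebra_simps)
  show ?thesis unfolding inv_henon[OF b(2)] Int_iff f.bounded_orbit_iff g.bounded_orbit_iff F G fst_conv snd_conv
  proof safe
    fix k
    assume f: "\<forall>k. cmod (s (n + 1 + int k)) \<le> max R (cmod (s n))"
      and g: "\<forall>k. cmod (s (n - int k)) \<le> max R (cmod (s (n + 1)))"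
    have up: "cmod (s (n + 1)) \<le> max R (cmod (s n))" using f[rule_format, of 0] by simp
    have dn: "cmod (s n) \<le> max R (cmod (s (n + 1)))" using g[rule_format, of 0] by simp
    have "cmod (s (n + 1)) \<le> R"
    proof (rule ccontr)
      assume *: "\<not> ?thesis"
      then have "2 * cmod (s (n + 1)) \<le> cmod (s (n + 1 + 1))"
        using f.grow[of "(s (n + 1), s n)"] up dn s[unfolded henon_recurrence_def, rule_format, of "n + 1"] by auto
      then show False using f[rule_format, of 1] up dn * f.R_pos by (simp add: algebra_simps)
    qed
    with dn have "cmod (s n) \<le> R" by simp
    show "cmod (s k) \<le> R"
    proof (cases "k > n")
      case True
      then show ?thesis using f[rule_format, of "nat (k - n - 1)"] \<open>cmod (s n) \<le> R\<close> by simp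
    next
      case False
      then show ?thesis using g[rule_format, of "nat (n - k)"] \<open>cmod (s (n + 1)) \<le> R\<close> by simp
    qed
  qed (auto simp: le_max_iff_disj)
qed

section \<open>Continuation of orbits\<close>

text \<open>\<open>\<eta>\<close> is the distance within which orbits are continued, and \<open>\<epsilon>\<close> bounds the parameter \<open>b\<close>. \<open>self_map\<close> and
  \<open>contraction\<close> make the fixed point equation for the correction solvable in the ball of radius \<open>\<eta>\<close>, with
  uniqueness in the ball of radius \<open>2 * \<eta>\<close>. \<open>unstable\<close> keeps half of the excess of the expansion rate
  \<open>\<kappa>\<close> over \<open>1\<close> for the derivative of the perturbed map. The bounds in terms of \<open>a\<close> keep the denominators in the
  equations for the invariant directions away from \<open>0\<close>.\<close>

locale small_perturbation = repeller +
  fixes R \<eta> \<epsilon> :: real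
  assumes R: "3 + cmod c \<le> R"
    and le_R: "y \<in> \<Lambda> \<Longrightarrow> cmod y \<le> R"
    and eta_pos: "0 < \<eta>" and eta_le: "\<eta> \<le> a / 4" 
    and eps_pos: "0 < \<epsilon>" and eps_le: "\<epsilon> \<le> 1" "\<epsilon> \<le> a / 2" "\<epsilon> \<le> a\<^sup>2 / 2"
    and self_map: "\<eta> / \<kappa> + M / (2 * a) * (\<eta>\<^sup>2 + \<epsilon> * (R + \<eta>)) \<le> \<eta>"
    and contraction: "1 / \<kappa> + M / (2 * a) * (4 * \<eta> + \<epsilon>) < 1"
    and unstable: "(2 * \<eta> + \<epsilon> / a) * M \<le> (\<kappa> - 1) / 2"

lemma (in repeller) small_perturbation_exists:
  assumes R: "3 + cmod c \<le> R" and le_R: "\<And>y. y \<in> \<Lambda> \<Longrightarrow> cmod y \<le> R"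
  obtains \<eta> \<epsilon>0 where "0 < \<epsilon>0" "\<And>\<epsilon>. 0 < \<epsilon> \<Longrightarrow> \<epsilon> \<le> \<epsilon>0 \<Longrightarrow> small_perturbation c \<Lambda> \<rho> \<kappa> M a R \<eta> \<epsilon>"
proof -
  define g L where "g = 1 - 1 / \<kappa>" and "L = M / (2 * a)"
  have g: "g > 0" and L: "L > 0" using kappa M_pos a_pos by (auto simp: g_def L_def)
  have R0: "R > 0" using R norm_ge_zero[of c] by linarith
  \<comment> \<open>First \<open>\<eta>\<close> makes the quadratic errors small, then \<open>\<epsilon>\<close> is chosen small relative to \<open>\<eta>\<close>.\<close>
  define \<eta> where "\<eta> = min (min 1 (a / 4)) (min (g / (16 * L)) ((\<kappa> - 1) / (8 * M)))"
  have \<eta>: "\<eta> > 0" "\<eta> \<le> 1" "\<eta> \<le> a / 4" "\<eta> \<le> g / (16 * L)" "\<eta> \<le> (\<kappa> - 1) / (8 * M)"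
    using g L a_pos kappa M_pos by (auto simp: \<eta>_def)
  then have \<eta>': "L * \<eta> \<le> g / 16" "2 * \<eta> * M \<le> (\<kappa> - 1) / 4" using L M_pos by (auto simp: field_simps)
  define \<epsilon>0 where "\<epsilon>0 = min (min (min 1 (a / 2)) (a\<^sup>2 / 2)) (min (min (g / (4 * L)) (g * \<eta> / (2 * L * (R + 1)))) ((\<kappa> - 1) * a / (4 * M)))"
  show ?thesis
  proof
    show "0 < \<epsilon>0" using g L a_pos kappa M_pos \<eta> R0 by (auto simp: \<epsilon>0_def)
    fix \<epsilon> assume e: "0 < \<epsilon>" "\<epsilon> \<le> \<epsilon>0"
    have e1: "\<epsilon> \<le> 1" "\<epsilon> \<le> a / 2" "\<epsilon> \<le> a\<^sup>2 / 2" "\<epsilon> \<le> g / (4 * L)" "\<epsilon> \<le> g * \<eta> / (2 * L * (R + 1))" 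
      "\<epsilon> \<le> (\<kappa> - 1) * a / (4 * M)"
      using e(2) by (auto simp: \<epsilon>0_def)
    have e2: "L * \<epsilon> \<le> g / 4" "L * \<epsilon> * (R + 1) \<le> g * \<eta> / 2" "\<epsilon> / a * M \<le> (\<kappa> - 1) / 4"
    proof -
      show "L * \<epsilon> \<le> g / 4" "\<epsilon> / a * M \<le> (\<kappa> - 1) / 4"
        using e1(4,6) L M_pos a_pos by (auto simp: field_simps)
      have "\<epsilon> * (2 * L * (R + 1)) \<le> g * \<eta>" using e1(5) L R0 by (simp add: pos_le_divide_eq)
      then show "L * \<epsilon> * (R + 1) \<le> g * \<eta> / 2" by (simp add: algebra_simps)
    qed
    have k: "1 / \<kappa> = 1 - g" by (simp add: g_def)
    show "small_perturbation c \<Lambda> \<rho> \<kappa> M a R \<eta> \<epsilon>"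
    proof unfold_locales
      show "1 / \<kappa> + M / (2 * a) * (4 * \<eta> + \<epsilon>) < 1"
        unfolding k L_def[symmetric] using \<eta>' e2 g by (simp add: algebra_simps)
      show "(2 * \<eta> + \<epsilon> / a) * M \<le> (\<kappa> - 1) / 2"
        unfolding distrib_right using \<eta>'(2) e2(3) by linarith
      have "L * \<epsilon> * (R + \<eta>) \<le> L * \<epsilon> * (R + 1)" using L e \<eta> by (intro mult_left_mono) auto
      moreover have "L * \<eta> * \<eta> \<le> g / 16 * \<eta>" using \<eta>' \<eta> by (intro mult_right_mono) auto
      moreover have "g * \<eta> > 0" using g \<eta> by simp
      ultimately have "L * (\<eta>\<^sup>2 + \<epsilon> * (R + \<eta>)) \<le> g * \<eta>" using e2
        by (simp add: algebra_simps power2_eq_square)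
      moreover have "\<eta> / \<kappa> = \<eta> - g * \<eta>" by (simp add: g_def algebra_simps)
      ultimately show "\<eta> / \<kappa> + M / (2 * a) * (\<eta>\<^sup>2 + \<epsilon> * (R + \<eta>)) \<le> \<eta>"
        unfolding L_def[symmetric] by simp
    qed (use R le_R \<eta> e e1 in auto)
  qed
qed

definition quad_orbits :: "complex \<Rightarrow> complex set \<Rightarrow> (int \<Rightarrow> complex) set" where
  "quad_orbits c \<Lambda> = {x. \<forall>n. x n \<in> \<Lambda> \<and> x (n + 1) = quad c (x n)}"

text \<open>For \<open>s = x + e\<close> and an orbit \<open>x\<close> of \<open>quad c\<close>, the recurrence for \<open>s\<close> reads
  \<open>e (n + 1) = 2 * x n * e n + (e n)\<^sup>2 - b * (x (n - 1) + e (n - 1))\<close>. Solved for the linear term \<open>e n\<close> it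
  becomes \<open>e = correction_step b x e\<close>: the future is pulled back by the contracting inverse of the derivative.\<close>

definition correction_step :: "complex \<Rightarrow> (int \<Rightarrow> complex) \<Rightarrow> (int \<Rightarrow> complex) \<Rightarrow> int \<Rightarrow> complex" where
  "correction_step b x e n = (e (n + 1) - (e n)\<^sup>2 + b * (x (n - 1) + e (n - 1))) / (2 * x n)"

definition correction_iter :: "complex \<Rightarrow> (int \<Rightarrow> complex) \<Rightarrow> nat \<Rightarrow> int \<Rightarrow> complex" where
  "correction_iter b x k = (correction_step b x ^^ k) (\<lambda>_. 0)"

lemma correction_iter_simps [simp]:
  "correction_iter b x 0 = (\<lambda>_. 0)"
  "correction_iter b x (Suc k) = correction_step b x (correction_iter b x k)"
  by (simp_all add: correction_iter_def)

text \<open>The limit of \<open>correction_iter b x\<close>, as a telescoping series so that the Weierstrass test applies.\<close>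

definition correction :: "complex \<Rightarrow> (int \<Rightarrow> complex) \<Rightarrow> int \<Rightarrow> complex" where
  "correction b x n = (\<Sum>k. correction_iter b x (Suc k) n - correction_iter b x k n)"

definition continuation :: "complex \<Rightarrow> (int \<Rightarrow> complex) \<Rightarrow> int \<Rightarrow> complex" where
  "continuation b x n = x n + correction b x n"

context repeller
begin

lemma quad_orbitsD:
  assumes "x \<in> quad_orbits c \<Lambda>"
  shows "x n \<in> \<Lambda>" "x (n + 1) = quad c (x n)" "x n \<noteq> 0" "1 \<le> \<rho> (x n)" "\<rho> (x n) \<le> M" "a \<le> cmod (x n)"
  using assms rho_ge_1 rho_le a_le[of "x n"] a_pos by (auto simp: quad_orbits_def)

text \<open>Dividing by \<open>2 * x n\<close> undoes one step of the expansion, hence gains \<open>\<kappa>\<close> when the weight at \<open>x (n + 1)\<close> is used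
  for the main term \<open>u\<close>. The error term \<open>v\<close> is only estimated crudely.\<close>

lemma weighted_division:
  assumes "x \<in> quad_orbits c \<Lambda>"
  shows "\<rho> (x n) * cmod ((u + v) / (2 * x n)) \<le> \<rho> (x (n + 1)) * cmod u / \<kappa> + M / (2 * a) * cmod v"
proof -
  note x = quad_orbitsD[OF assms]
  have pos: "cmod (x n) > 0" using x(3)[of n] by simp
  have "\<rho> (x n) * cmod ((u + v) / (2 * x n)) = \<rho> (x n) / (2 * cmod (x n)) * cmod (u + v)"
    by (simp add: norm_divide norm_mult)
  also have "\<dots> \<le> \<rho> (x n) / (2 * cmod (x n)) * (cmod u + cmod v)"
    using x(4)[of n] by (intro mult_left_mono norm_triangle_ineq) auto
  also have "\<dots> = \<rho> (x n) / (2 * cmod (x n)) * cmod u + \<rho> (x n) / (2 * cmod (x n)) * cmod v"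
    by (rule distrib_left)
  also have "\<dots> \<le> \<rho> (x (n + 1)) / \<kappa> * cmod u + M / (2 * a) * cmod v"
  proof (intro add_mono mult_right_mono)
    show "\<rho> (x n) / (2 * cmod (x n)) \<le> \<rho> (x (n + 1)) / \<kappa>"
      using expand[OF x(1), of n] pos kappa unfolding x(2) by (simp add: field_simps)
    show "\<rho> (x n) / (2 * cmod (x n)) \<le> M / (2 * a)"
      using x(5)[of n] x(6)[of n] M_pos a_pos by (intro frac_le) auto
  qed auto
  finally show ?thesis by simp
qed

end

context small_perturbation
begin

definition contraction_factor :: real ("\<mu>") where
  "\<mu> = 1 / \<kappa> + M / (2 * a) * (4 * \<eta> + \<epsilon>)"

lemma contraction_factor: "0 \<le> \<mu>" "\<mu> < 1"
  using contraction kappa M_pos a_pos eta_pos eps_pos by (auto simp: contraction_factor_def)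

text \<open>The main term contracts by \<open>1 / \<kappa>\<close>. The quadratic term and the coupling to the past have small Lipschitz constants
  because \<open>\<eta>\<close> and \<open>\<epsilon>\<close> are small.\<close>

lemma correction_step_contracts:
  assumes x: "x \<in> quad_orbits c \<Lambda>" and b: "cmod b \<le> \<epsilon>"
    and e: "\<And>n. cmod (e n) \<le> 2 * \<eta>" and f: "\<And>n. cmod (f n) \<le> 2 * \<eta>"
    and d: "\<And>n. \<rho> (x n) * cmod (e n - f n) \<le> B"
  shows "\<rho> (x n) * cmod (correction_step b x e n - correction_step b x f n) \<le> \<mu> * B"
proof -
  note x' = quad_orbitsD[OF x]
  have d': "cmod (e n - f n) \<le> B" for n
    using d[of n] x'(4)[of n] mult_right_mono[of 1 "\<rho> (x n)" "cmod (e n - f n)"] by simp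
  let ?v = "- ((e n - f n) * (e n + f n)) + b * (e (n - 1) - f (n - 1))"
  have "B \<ge> 0" using d'[of 0] norm_ge_zero order_trans by blast
  have "correction_step b x e n - correction_step b x f n = ((e (n + 1) - f (n + 1)) + ?v) / (2 * x n)"
    using x'(3)[of n] by (simp add: correction_step_def field_simps power2_eq_square)
  then have "\<rho> (x n) * cmod (correction_step b x e n - correction_step b x f n)
      \<le> \<rho> (x (n + 1)) * cmod (e (n + 1) - f (n + 1)) / \<kappa> + M / (2 * a) * cmod ?v"
    using weighted_division[OF x] by metis
  also have "\<dots> \<le> B / \<kappa> + M / (2 * a) * ((4 * \<eta> + \<epsilon>) * B)"
  proof (intro add_mono mult_left_mono divide_right_mono d)
    have "cmod (e n + f n) \<le> 4 * \<eta>" using norm_triangle_ineq[of "e n" "f n"] e[of n] f[of n] by linarith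
    then have "cmod (- ((e n - f n) * (e n + f n))) \<le> B * (4 * \<eta>)"
      unfolding norm_minus_cancel norm_mult using d'[of n] \<open>B \<ge> 0\<close> by (intro mult_mono) auto
    moreover have "cmod (b * (e (n - 1) - f (n - 1))) \<le> \<epsilon> * B"
      unfolding norm_mult using d'[of "n - 1"] b eps_pos by (intro mult_mono) auto
    ultimately show "cmod ?v \<le> (4 * \<eta> + \<epsilon>) * B"
      using norm_triangle_ineq[of "- ((e n - f n) * (e n + f n))" "b * (e (n - 1) - f (n - 1))"]
      by (simp add: algebra_simps)
  qed (use kappa M_pos a_pos in auto)
  also have "\<dots> = \<mu> * B" by (simp add: contraction_factor_def algebra_simps)
  finally show ?thesis .
qed

lemma correction_step_ball:
  assumes x: "x \<in> quad_orbits c \<Lambda>" and b: "cmod b \<le> \<epsilon>"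
    and e: "\<And>n. \<rho> (x n) * cmod (e n) \<le> \<eta>"
  shows "\<rho> (x n) * cmod (correction_step b x e n) \<le> \<eta>"
proof -
  note x' = quad_orbitsD[OF x]
  have e': "cmod (e n) \<le> \<eta>" for n
    using e[of n] x'(4)[of n] mult_right_mono[of 1 "\<rho> (x n)" "cmod (e n)"] by simp
  let ?v = "- (e n)\<^sup>2 + b * (x (n - 1) + e (n - 1))"
  have "\<rho> (x n) * cmod (correction_step b x e n) = \<rho> (x n) * cmod ((e (n + 1) + ?v) / (2 * x n))"
    by (simp add: correction_step_def algebra_simps)
  also have "\<dots> \<le> \<rho> (x (n + 1)) * cmod (e (n + 1)) / \<kappa> + M / (2 * a) * cmod ?v"
    by (rule weighted_division[OF x])
  also have "\<dots> \<le> \<eta> / \<kappa> + M / (2 * a) * (\<eta>\<^sup>2 + \<epsilon> * (R + \<eta>))"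
  proof (intro add_mono mult_left_mono divide_right_mono e)
    have "cmod (x (n - 1) + e (n - 1)) \<le> R + \<eta>"
      using norm_triangle_mono[OF le_R[OF x'(1)] e'] .
    then have "cmod (b * (x (n - 1) + e (n - 1))) \<le> \<epsilon> * (R + \<eta>)"
      unfolding norm_mult using b eps_pos by (intro mult_mono) auto
    moreover have "cmod (- (e n)\<^sup>2) \<le> \<eta>\<^sup>2" using e'[of n] by (simp add: norm_power power_mono)
    ultimately show "cmod ?v \<le> \<eta>\<^sup>2 + \<epsilon> * (R + \<eta>)" using norm_triangle_mono by blast
  qed (use kappa M_pos a_pos in auto)
  also have "\<dots> \<le> \<eta>" by (rule self_map)
  finally show ?thesis .
qed

lemma correction_iter_bounds:
  assumes x: "x \<in> quad_orbits c \<Lambda>" and b: "cmod b \<le> \<epsilon>"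
  shows "\<rho> (x n) * cmod (correction_iter b x k n) \<le> \<eta>"
    and "cmod (correction_iter b x k n) \<le> \<eta>"
    and "\<rho> (x n) * cmod (correction_iter b x (Suc k) n - correction_iter b x k n) \<le> \<mu> ^ k * \<eta>"
    and "cmod (correction_iter b x (Suc k) n - correction_iter b x k n) \<le> \<mu> ^ k * \<eta>"
proof -
  note x' = quad_orbitsD[OF x]
  have drop: "cmod u \<le> B" if "\<rho> (x n) * cmod u \<le> B" for u B n
    using that x'(4)[of n] mult_right_mono[of 1 "\<rho> (x n)" "cmod u"] by simp
  have 1: "\<rho> (x n) * cmod (correction_iter b x k n) \<le> \<eta>" for k n
  proof (induction k arbitrary: n)
    case 0
    then show ?case using eta_pos by simp
  next
    case (Suc k)
    then show ?case using correction_step_ball[OF x b] by simp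
  qed
  have 2: "cmod (correction_iter b x k n) \<le> \<eta>" for k n using drop[OF 1] .
  have eta2: "cmod (correction_iter b x k n) \<le> 2 * \<eta>" for k n
    using 2[of k n] eta_pos by linarith
  have 3: "\<rho> (x n) * cmod (correction_iter b x (Suc k) n - correction_iter b x k n) \<le> \<mu> ^ k * \<eta>" for k n
  proof (induction k arbitrary: n)
    case 0
    then show ?case using 1[of n "Suc 0"] by simp
  next
    case (Suc k)
    have "\<rho> (x n) * cmod (correction_step b x (correction_iter b x (Suc k)) n
        - correction_step b x (correction_iter b x k) n) \<le> \<mu> * (\<mu> ^ k * \<eta>)"
      by (rule correction_step_contracts[OF x b eta2 eta2 Suc])
    then show ?case by (simp add: mult.assoc)
  qed
  show "\<rho> (x n) * cmod (correction_iter b x k n) \<le> \<eta>"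
    and "cmod (correction_iter b x k n) \<le> \<eta>"
    and "\<rho> (x n) * cmod (correction_iter b x (Suc k) n - correction_iter b x k n) \<le> \<mu> ^ k * \<eta>"
    and "cmod (correction_iter b x (Suc k) n - correction_iter b x k n) \<le> \<mu> ^ k * \<eta>"
    using 1 2 3 drop[OF 3] by blast+
qed

text \<open>Uniformity in \<open>b\<close> gives holomorphy and uniformity in \<open>x\<close> gives continuity of the limit.\<close>

lemma correction_uniform_limit:
  "uniform_limit (cball 0 \<epsilon> \<times> quad_orbits c \<Lambda>) (\<lambda>k (b, x). correction_iter b x k n)
     (\<lambda>(b, x). correction b x n) sequentially"
proof -
  have "uniform_limit (cball 0 \<epsilon> \<times> quad_orbits c \<Lambda> :: (complex \<times> (int \<Rightarrow> complex)) set)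
      (\<lambda>m (p :: complex \<times> (int \<Rightarrow> complex)). \<Sum>k<m. correction_iter (fst p) (snd p) (Suc k) n - correction_iter (fst p) (snd p) k n)
      (\<lambda>p. \<Sum>k. correction_iter (fst p) (snd p) (Suc k) n - correction_iter (fst p) (snd p) k n) sequentially"
  proof (rule Weierstrass_m_test)
    fix k and p :: "complex \<times> (int \<Rightarrow> complex)" assume "p \<in> cball 0 \<epsilon> \<times> quad_orbits c \<Lambda>"
    then show "norm (correction_iter (fst p) (snd p) (Suc k) n - correction_iter (fst p) (snd p) k n) \<le> \<mu> ^ k * \<eta>"
      by (intro correction_iter_bounds(4)) auto
  next
    show "summable (\<lambda>k. \<mu> ^ k * \<eta>)"
      using contraction_factor by (intro summable_mult2 summable_geometric) auto
  qed
  moreover have "(\<Sum>k<m. correction_iter b x (Suc k) n - correction_iter b x k n) = correction_iter b x m n" for m b x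
    using sum_lessThan_telescope[of "\<lambda>k. correction_iter b x k n" m] by simp
  ultimately show ?thesis
    unfolding correction_def case_prod_beta by (simp del: correction_iter_simps(2))
qed

lemma correction_limit:
  assumes "x \<in> quad_orbits c \<Lambda>" "cmod b \<le> \<epsilon>"
  shows "(\<lambda>k. correction_iter b x k n) \<longlonglongrightarrow> correction b x n"
  using tendsto_uniform_limitI[OF correction_uniform_limit, of "(b, x)" n] assms by simp

lemma continuation_near:
  assumes "x \<in> quad_orbits c \<Lambda>" "cmod b \<le> \<epsilon>"
  shows "cmod (continuation b x n - x n) \<le> \<eta>"
proof -
  have "cmod (correction b x n) \<le> \<eta>"
    using correction_iter_bounds(2)[OF assms]
    by (intro LIMSEQ_le_const2[OF tendsto_norm[OF correction_limit[OF assms]]]) auto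
  then show ?thesis by (simp add: continuation_def)
qed

lemma continuation_recurrence:
  assumes x: "x \<in> quad_orbits c \<Lambda>" and b: "cmod b \<le> \<epsilon>"
  shows "henon_recurrence c b (continuation b x)"
  unfolding henon_recurrence_def
proof
  fix n
  have "(\<lambda>k. correction_iter b x (Suc k) n) \<longlonglongrightarrow> correction_step b x (correction b x) n"
    unfolding correction_iter_simps correction_step_def using quad_orbitsD(3)[OF x, of n]
    by (intro tendsto_intros correction_limit x b) auto
  moreover have "(\<lambda>k. correction_iter b x (Suc k) n) \<longlonglongrightarrow> correction b x n"
    using correction_limit[OF x b] by (rule LIMSEQ_Suc)
  ultimately have "correction b x n = correction_step b x (correction b x) n"
    using LIMSEQ_unique by blast
  then show "continuation b x (n + 1) = (continuation b x n)\<^sup>2 + c - b * continuation b x (n - 1)"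
    using quad_orbitsD(2,3)[OF x, of n]
    by (simp add: continuation_def correction_step_def quad_def field_simps power2_eq_square)
qed

text \<open>Both corrections are fixed by \<open>correction_step\<close>, so the contraction forces them to agree. The radius \<open>2 * \<eta>\<close> is
  twice that of the construction: two orbits of \<open>quad c\<close> with the same continuation are \<open>2 * \<eta>\<close>-close,
  and the case \<open>b = 0\<close> then identifies them.\<close>

lemma recurrence_near_orbit_unique:
  assumes x: "x \<in> quad_orbits c \<Lambda>" and b: "cmod b \<le> \<epsilon>"
    and s: "henon_recurrence c b s" "\<And>n. cmod (s n - x n) \<le> 2 * \<eta>"
    and t: "henon_recurrence c b t" "\<And>n. cmod (t n - x n) \<le> 2 * \<eta>"
  shows "s = t"
proof
  fix n
  note x' = quad_orbitsD[OF x]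
  have fixed: "correction_step b x (\<lambda>n. s n - x n) n = s n - x n" if "henon_recurrence c b s" for s n
  proof -
    have "s (n + 1) = (s n)\<^sup>2 + c - b * s (n - 1)" "x (n + 1) = (x n)\<^sup>2 + c"
      using that x'(2)[of n] by (auto simp: henon_recurrence_def quad_def)
    then show ?thesis using x'(3)[of n] by (simp add: correction_step_def field_simps power2_eq_square)
  qed
  have *: "\<rho> (x n) * cmod ((s n - x n) - (t n - x n)) \<le> \<mu> ^ k * (M * (4 * \<eta>))" for k n
  proof (induction k arbitrary: n)
    case 0
    have "cmod ((s n - x n) - (t n - x n)) \<le> 4 * \<eta>"
      using norm_triangle_ineq4[of "s n - x n" "t n - x n"] s(2)[of n] t(2)[of n] by linarith
    then have "\<rho> (x n) * cmod ((s n - x n) - (t n - x n)) \<le> M * (4 * \<eta>)"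
      using x'(4)[of n] x'(5)[of n] M_pos by (intro mult_mono) auto
    then show ?case by simp
  next
    case (Suc k)
    have "\<rho> (x n) * cmod (correction_step b x (\<lambda>n. s n - x n) n - correction_step b x (\<lambda>n. t n - x n) n)
       \<le> \<mu> * (\<mu> ^ k * (M * (4 * \<eta>)))"
      by (rule correction_step_contracts[OF x b s(2) t(2) Suc])
    then show ?case unfolding fixed[OF s(1)] fixed[OF t(1)] by (simp add: mult.assoc)
  qed
  have "(\<lambda>k. \<mu> ^ k * (M * (4 * \<eta>))) \<longlonglongrightarrow> 0"
    using contraction_factor by (intro tendsto_mult_left_zero LIMSEQ_power_zero) auto
  then have "\<rho> (x n) * cmod ((s n - x n) - (t n - x n)) \<le> 0"
    using * by (intro LIMSEQ_le_const) auto
  then show "s n = t n" using x'(4)[of n] by (simp add: mult_le_0_iff)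
qed

lemma continuation_holomorphic:
  assumes x: "x \<in> quad_orbits c \<Lambda>"
  shows "(\<lambda>b. continuation b x n) holomorphic_on ball 0 \<epsilon>"
proof -
  have hol: "(\<lambda>b. correction_iter b x k n) holomorphic_on S" for k n S
  proof (induction k arbitrary: n)
    case (Suc k)
    show ?case unfolding correction_iter_simps correction_step_def using quad_orbitsD(3)[OF x, of n]
      by (intro holomorphic_intros Suc) auto
  qed simp
  have "(\<lambda>b. correction b x n) holomorphic_on ball 0 \<epsilon>"
  proof (rule holomorphic_uniform_sequence[OF open_ball hol])
    fix b :: complex assume "b \<in> ball 0 \<epsilon>"
    then obtain d where d: "d > 0" "cball b d \<subseteq> ball 0 \<epsilon>" using open_contains_cball_eq[of "ball 0 \<epsilon>"] by blast
    have "uniform_limit (cball b d) (\<lambda>k b. correction_iter b x k n) (\<lambda>b. correction b x n) sequentially"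
    proof (rule uniform_limitI)
      fix e :: real assume "e > 0"
      have "\<forall>\<^sub>F k in sequentially. \<forall>p\<in>cball 0 \<epsilon> \<times> quad_orbits c \<Lambda>.
          dist ((\<lambda>(b, x). correction_iter b x k n) p) ((\<lambda>(b, x). correction b x n) p) < e"
        by (rule uniform_limitD[OF correction_uniform_limit \<open>e > 0\<close>])
      then show "\<forall>\<^sub>F k in sequentially. \<forall>b\<in>cball b d. dist (correction_iter b x k n) (correction b x n) < e"
        using d(2) ball_subset_cball x by (elim eventually_mono) (auto simp del: mem_cball)
    qed
    then show "\<exists>d>0. cball b d \<subseteq> ball 0 \<epsilon> \<and>
        uniform_limit (cball b d) (\<lambda>k b. correction_iter b x k n) (\<lambda>b. correction b x n) sequentially"
      using d by blast
  qed
  then show ?thesis unfolding continuation_def by (intro holomorphic_intros)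
qed

lemma continuation_continuous:
  assumes b: "cmod b \<le> \<epsilon>"
  shows "continuous_on (quad_orbits c \<Lambda>) (\<lambda>x. continuation b x n)"
proof -
  have coord: "continuous_on S (\<lambda>x. x i)" for S and i :: int
    using continuous_on_product_coordinates by (rule continuous_on_subset) simp
  have cont: "continuous_on (quad_orbits c \<Lambda>) (\<lambda>x. correction_iter b x k n)" for k n
  proof (induction k arbitrary: n)
    case (Suc k)
    show ?case unfolding correction_iter_simps correction_step_def using quad_orbitsD(3)
      by (intro continuous_intros Suc coord) auto
  qed simp
  have "uniform_limit (quad_orbits c \<Lambda>) (\<lambda>k x. correction_iter b x k n) (\<lambda>x. correction b x n) sequentially"
  proof (rule uniform_limitI)
    fix e :: real assume "e > 0"
    have "\<forall>\<^sub>F k in sequentially. \<forall>p\<in>cball 0 \<epsilon> \<times> quad_orbits c \<Lambda>.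
        dist ((\<lambda>(b, x). correction_iter b x k n) p) ((\<lambda>(b, x). correction b x n) p) < e"
      by (rule uniform_limitD[OF correction_uniform_limit \<open>e > 0\<close>])
    then show "\<forall>\<^sub>F k in sequentially. \<forall>x\<in>quad_orbits c \<Lambda>. dist (correction_iter b x k n) (correction b x n) < e"
      using b by (elim eventually_mono) auto
  qed
  then have "continuous_on (quad_orbits c \<Lambda>) (\<lambda>x. correction b x n)"
    by (rule uniform_limit_theorem[rotated]) (auto intro!: cont always_eventually)
  then show ?thesis unfolding continuation_def by (intro continuous_intros coord)
qed

end

section \<open>Hyperbolicity from invariant line bundles\<close>

text \<open>Graph transform: iterate \<open>\<sigma> \<mapsto> (\<lambda>z. G z (\<sigma> (f z)))\<close> from the zero section. The iterates are continuous and converge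
  uniformly at the rate \<open>1 / 2\<close>.\<close>

lemma invariant_section:
  fixes f :: "'a::topological_space \<Rightarrow> 'a" and G :: "'a \<Rightarrow> complex \<Rightarrow> complex"
  assumes f: "f ` S \<subseteq> S" "continuous_on S f" and r: "0 \<le> r"
    and self: "\<And>z u. z \<in> S \<Longrightarrow> cmod u \<le> r \<Longrightarrow> cmod (G z u) \<le> r"
    and lip: "\<And>z u v. z \<in> S \<Longrightarrow> cmod u \<le> r \<Longrightarrow> cmod v \<le> r \<Longrightarrow> cmod (G z u - G z v) \<le> cmod (u - v) / 2"
    and cont: "\<And>\<sigma>. continuous_on S \<sigma> \<Longrightarrow> (\<And>z. z \<in> S \<Longrightarrow> cmod (\<sigma> z) \<le> r) \<Longrightarrow> continuous_on S (\<lambda>z. G z (\<sigma> z))"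
  obtains \<sigma> where "continuous_on S \<sigma>" "\<And>z. z \<in> S \<Longrightarrow> cmod (\<sigma> z) \<le> r" "\<And>z. z \<in> S \<Longrightarrow> \<sigma> z = G z (\<sigma> (f z))"
proof -
  define s where "s k = ((\<lambda>\<tau> z. G z (\<tau> (f z))) ^^ k) (\<lambda>_. 0)" for k
  have s: "s 0 = (\<lambda>_. 0)" "s (Suc k) = (\<lambda>z. G z (s k (f z)))" for k by (simp_all add: s_def)
  have bd: "cmod (s k z) \<le> r" if "z \<in> S" for k z
    using that
  proof (induction k arbitrary: z)
    case (Suc k)
    have "f z \<in> S" using Suc.prems f by blast
    then show ?case using Suc self by (simp add: s)
  qed (simp add: s r)
  have co: "continuous_on S (s k)" for k
  proof (induction k)
    case (Suc k)
    have "continuous_on S (\<lambda>z. s k (f z))" using continuous_on_compose2[OF Suc f(2)] f(1) by blast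
    moreover have "cmod (s k (f z)) \<le> r" if "z \<in> S" for z using that bd f by blast
    ultimately show ?case unfolding s(2) by (rule cont)
  qed (simp add: s)
  have step: "cmod (s (Suc k) z - s k z) \<le> r * (1 / 2) ^ k" if "z \<in> S" for k z
    using that
  proof (induction k arbitrary: z)
    case 0
    then show ?case using bd[of z 1] by (simp add: s(1))
  next
    case (Suc k)
    have fz: "f z \<in> S" using Suc.prems f by blast
    then have "cmod (s (Suc (Suc k)) z - s (Suc k) z) \<le> cmod (s (Suc k) (f z) - s k (f z)) / 2"
      unfolding s(2)[of "Suc k"] s(2)[of k, THEN fun_cong, of z] using lip[OF Suc.prems bd bd] by blast
    with Suc.IH[OF fz] show ?case by simp
  qed
  define \<sigma> where "\<sigma> z = (\<Sum>k. s (Suc k) z - s k z)" for z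
  have "uniform_limit S (\<lambda>m z. \<Sum>k<m. s (Suc k) z - s k z) \<sigma> sequentially"
    unfolding \<sigma>_def
  proof (rule Weierstrass_m_test)
    show "summable (\<lambda>k. r * (1 / 2) ^ k)" by (intro summable_mult summable_geometric) auto
  qed (rule step)
  moreover have "(\<Sum>k<m. s (Suc k) z - s k z) = s m z" for m z
    using sum_lessThan_telescope[of "\<lambda>k. s k z" m] by (simp add: s(1))
  ultimately have lim: "uniform_limit S s \<sigma> sequentially" by simp
  have ptw: "(\<lambda>k. s k z) \<longlonglongrightarrow> \<sigma> z" if "z \<in> S" for z
    using tendsto_uniform_limitI[OF lim that] .
  have bds: "cmod (\<sigma> z) \<le> r" if "z \<in> S" for z
    using bd that by (intro LIMSEQ_le_const2[OF tendsto_norm[OF ptw]]) auto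
  show ?thesis
  proof
    show "continuous_on S \<sigma>" by (rule uniform_limit_theorem[OF _ lim]) (auto intro!: co always_eventually)
    show "cmod (\<sigma> z) \<le> r" if "z \<in> S" for z using bds that .
    fix z assume z: "z \<in> S"
    then have fz: "f z \<in> S" using f by blast
    have "(\<lambda>k. cmod (s k (f z) - \<sigma> (f z)) / 2) \<longlonglongrightarrow> 0"
      using ptw[OF fz] by (simp add: LIM_zero_iff tendsto_norm_zero_iff)
    then have "(\<lambda>k. s (Suc k) z - G z (\<sigma> (f z))) \<longlonglongrightarrow> 0"
    proof (rule Lim_null_comparison[rotated], intro always_eventually allI)
      show "cmod (s (Suc k) z - G z (\<sigma> (f z))) \<le> cmod (s k (f z) - \<sigma> (f z)) / 2" for k
        unfolding s(2) by (rule lip[OF z bd[OF fz] bds[OF fz]])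
    qed
    then have "(\<lambda>k. s (Suc k) z) \<longlonglongrightarrow> G z (\<sigma> (f z))" by (simp add: LIM_zero_iff)
    then show "\<sigma> z = G z (\<sigma> (f z))" using LIMSEQ_Suc[OF ptw[OF z]] LIMSEQ_unique by blast
  qed
qed

text \<open>\<open>k\<close> and \<open>m\<close> are the slopes of the stable line spanned by \<open>(k z, 1)\<close> and of the unstable line spanned by
  \<open>(1, m z)\<close>. Since the derivative of \<open>henon c b\<close> at \<open>z\<close> is \<open>(\<xi>, \<eta>) \<mapsto> (2 * fst z * \<xi> - b * \<eta>, \<xi>)\<close>,
  \<open>stable\<close> and \<open>unstable\<close> say that these lines are invariant. A step along the stable line multiplies the
  second component by \<open>k z\<close>, and a backward step along the unstable line multiplies the first one by
  \<open>m z\<close>. The first rate is at most \<open>1 / 2\<close>, and the second one is measured with the weight \<open>w\<close>.\<close>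

locale hyperbolic_bundles =
  fixes c b :: complex and S :: "(complex \<times> complex) set"
    and k m :: "complex \<times> complex \<Rightarrow> complex" and w :: "complex \<times> complex \<Rightarrow> real" and lu B M :: real
  assumes b: "b \<noteq> 0" "cmod b \<le> 1" and compact: "compact S"
    and forward: "z \<in> S \<Longrightarrow> henon c b z \<in> S" and backward: "z \<in> S \<Longrightarrow> henon_inv c b z \<in> S"
    and cont: "continuous_on S k" "continuous_on S m"
    and stable: "z \<in> S \<Longrightarrow> k z * (2 * fst z - k (henon c b z)) = b"
    and unstable: "z \<in> S \<Longrightarrow> m z * (2 * snd z - b * m (henon_inv c b z)) = 1"
    and transversal: "z \<in> S \<Longrightarrow> cmod (k z * m z) < 1"
    and k_le: "z \<in> S \<Longrightarrow> cmod (k z) \<le> 1 / 2" and m_le: "z \<in> S \<Longrightarrow> cmod (m z) \<le> B"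
    and weight: "z \<in> S \<Longrightarrow> 1 \<le> w z" "z \<in> S \<Longrightarrow> w z \<le> M"
    and lambda: "1 < lu" and unstable_rate: "z \<in> S \<Longrightarrow> lu * w (henon_inv c b z) * cmod (m z) \<le> w z"
begin

definition Es :: "complex \<times> complex \<Rightarrow> (complex \<times> complex) set" where
  "Es z = {(k z * \<eta>, \<eta>) | \<eta>. True}"

definition Eu :: "complex \<times> complex \<Rightarrow> (complex \<times> complex) set" where
  "Eu z = {(\<xi>, m z * \<xi>) | \<xi>. True}"

lemma nonzero: "z \<in> S \<Longrightarrow> k z \<noteq> 0" "z \<in> S \<Longrightarrow> m z \<noteq> 0" "z \<in> S \<Longrightarrow> 1 - k z * m z \<noteq> 0"
  using stable[of z] unstable[of z] transversal[of z] b(1) by auto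

lemma Dhenon_stable:
  assumes "z \<in> S"
  shows "Dhenon b z (k z * \<eta>, \<eta>) = (k (henon c b z) * (k z * \<eta>), k z * \<eta>)"
proof -
  have "2 * fst z * (k z * \<eta>) - b * \<eta> = (2 * fst z * k z - k z * (2 * fst z - k (henon c b z))) * \<eta>"
    unfolding stable[OF assms] by (simp add: algebra_simps)
  then show ?thesis by (simp add: Dhenon_def algebra_simps)
qed

lemma Dhenon_unstable:
  assumes "z \<in> S"
  shows "Dhenon b z (\<xi>, m z * \<xi>) = (\<xi> / m (henon c b z), m (henon c b z) * (\<xi> / m (henon c b z)))"
proof -
  have "m (henon c b z) * (2 * fst z - b * m z) = 1"
    using unstable[OF forward[OF assms]] by (simp add: henon_inverse b)
  then have "m (henon c b z) * (2 * fst z * \<xi> - b * (m z * \<xi>)) = \<xi>"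
    by (metis left_diff_distrib mult.assoc mult_1)
  then have "2 * fst z * \<xi> - b * (m z * \<xi>) = \<xi> / m (henon c b z)"
    using nonzero(2)[OF forward[OF assms]] by (metis nonzero_mult_div_cancel_left)
  then show ?thesis using nonzero(2)[OF forward[OF assms]] by (simp add: Dhenon_def)
qed

lemma Dhenon_inv_unstable:
  assumes "z \<in> S"
  shows "Dhenon_inv b z (\<xi>, m z * \<xi>) = (m z * \<xi>, m (henon_inv c b z) * (m z * \<xi>))"
proof -
  have "2 * snd z * (m z * \<xi>) - \<xi> = 2 * snd z * (m z * \<xi>) - m z * (2 * snd z - b * m (henon_inv c b z)) * \<xi>"
    unfolding unstable[OF assms] by simp
  then show ?thesis using b by (simp add: Dhenon_inv_def field_simps)
qed

lemma Dhenon_inv_stable: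
  assumes "z \<in> S"
  shows "Dhenon_inv b z (k z * \<eta>, \<eta>) = (k (henon_inv c b z) * (\<eta> / k (henon_inv c b z)), \<eta> / k (henon_inv c b z))"
proof -
  have "k (henon_inv c b z) * (2 * snd z - k z) = b"
    using stable[OF backward[OF assms]] by (simp add: henon_inverse b)
  then have "k (henon_inv c b z) * (2 * snd z * \<eta> - k z * \<eta>) = b * \<eta>"
    by (metis left_diff_distrib mult.assoc)
  then show ?thesis using b nonzero(1)[OF backward[OF assms]]
    by (simp add: Dhenon_inv_def field_simps)
qed

text \<open>The estimate along \<open>(k z, 1)\<close> is the stable half of hyperbolicity. The growth along \<open>(1, m z)\<close> serves to exclude
  \<open>z\<close> from the interior of the set of bounded forward orbits.\<close>

lemma iterate_derivative:
  assumes z: "z \<in> S"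
  shows "(henon c b ^^ n) z \<in> S" and "\<exists>D. ((henon c b ^^ n) has_derivative D) (at z) \<and>
    (\<forall>\<eta>. \<exists>\<eta>'. D (k z * \<eta>, \<eta>) = (k ((henon c b ^^ n) z) * \<eta>', \<eta>') \<and> cmod \<eta>' \<le> (1 / 2) ^ n * cmod \<eta>) \<and>
    (\<forall>\<xi>. \<exists>\<xi>'. D (\<xi>, m z * \<xi>) = (\<xi>', m ((henon c b ^^ n) z) * \<xi>') \<and>
       lu ^ n * w z * cmod \<xi> \<le> w ((henon c b ^^ n) z) * cmod \<xi>')" (is "?P n")
proof -
  show S: "(henon c b ^^ n) z \<in> S" for n by (induction n) (auto simp: z forward)
  show "?P n"
  proof (induction n)
    case 0
    show ?case unfolding funpow.simps id_def
      by (rule exI[of _ "\<lambda>v. v"]) auto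
  next
    case (Suc n)
    let ?y = "(henon c b ^^ n) z"
    obtain D where D: "((henon c b ^^ n) has_derivative D) (at z)"
      and Ds: "\<And>\<eta>. \<exists>\<eta>'. D (k z * \<eta>, \<eta>) = (k ?y * \<eta>', \<eta>') \<and> cmod \<eta>' \<le> (1 / 2) ^ n * cmod \<eta>"
      and Du: "\<And>\<xi>. \<exists>\<xi>'. D (\<xi>, m z * \<xi>) = (\<xi>', m ?y * \<xi>') \<and> lu ^ n * w z * cmod \<xi> \<le> w ?y * cmod \<xi>'"
      using Suc by blast
    have "((henon c b ^^ Suc n) has_derivative Dhenon b ?y \<circ> D) (at z)"
      using diff_chain_at[OF D has_derivative_henon] by simp
    moreover have "\<exists>\<eta>'. (Dhenon b ?y \<circ> D) (k z * \<eta>, \<eta>) = (k ((henon c b ^^ Suc n) z) * \<eta>', \<eta>') \<and> cmod \<eta>' \<le> (1 / 2) ^ Suc n * cmod \<eta>" for \<eta>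
    proof -
      obtain \<eta>' where e: "D (k z * \<eta>, \<eta>) = (k ?y * \<eta>', \<eta>')" "cmod \<eta>' \<le> (1 / 2) ^ n * cmod \<eta>" using Ds by blast
      have "cmod (k ?y * \<eta>') \<le> 1 / 2 * ((1 / 2) ^ n * cmod \<eta>)"
        unfolding norm_mult using k_le[OF S] e(2) by (intro mult_mono) auto
      then show ?thesis using Dhenon_stable[OF S] e(1) by (intro exI[of _ "k ?y * \<eta>'"]) (simp add: o_def)
    qed
    moreover have "\<exists>\<xi>'. (Dhenon b ?y \<circ> D) (\<xi>, m z * \<xi>) = (\<xi>', m ((henon c b ^^ Suc n) z) * \<xi>') \<and>
       lu ^ Suc n * w z * cmod \<xi> \<le> w ((henon c b ^^ Suc n) z) * cmod \<xi>'" for \<xi>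
    proof -
      obtain \<xi>' where e: "D (\<xi>, m z * \<xi>) = (\<xi>', m ?y * \<xi>')" "lu ^ n * w z * cmod \<xi> \<le> w ?y * cmod \<xi>'" using Du by blast
      have nz: "m (henon c b ?y) \<noteq> 0" using nonzero(2)[OF forward[OF S]] .
      have "lu * (lu ^ n * w z * cmod \<xi>) \<le> lu * (w ?y * cmod \<xi>')" using e(2) lambda by (intro mult_left_mono) auto
      also have "\<dots> = lu * w ?y * cmod (m (henon c b ?y)) * cmod (\<xi>' / m (henon c b ?y))"
        using nz by (simp add: norm_divide)
      also have "\<dots> \<le> w (henon c b ?y) * cmod (\<xi>' / m (henon c b ?y))"
        using unstable_rate[OF forward[OF S]] by (intro mult_right_mono) (auto simp: henon_inverse b)
      finally show ?thesis using Dhenon_unstable[OF S] e(1)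
        by (intro exI[of _ "\<xi>' / m (henon c b ?y)"]) (simp add: o_def mult.assoc)
    qed
    ultimately show ?case by blast
  qed
qed

text \<open>The estimate along \<open>(1, m z)\<close> is the unstable half of hyperbolicity. The growth along \<open>(k z, 1)\<close> serves to exclude
  \<open>z\<close> from the interior of the set of bounded backward orbits.\<close>

lemma iterate_inv_derivative:
  assumes z: "z \<in> S"
  shows "(henon_inv c b ^^ n) z \<in> S" and "\<exists>D. ((henon_inv c b ^^ n) has_derivative D) (at z) \<and>
    (\<forall>\<eta>. \<exists>\<eta>'. D (k z * \<eta>, \<eta>) = (k ((henon_inv c b ^^ n) z) * \<eta>', \<eta>') \<and> 2 ^ n * cmod \<eta> \<le> cmod \<eta>') \<and>
    (\<forall>\<xi>. \<exists>\<xi>'. D (\<xi>, m z * \<xi>) = (\<xi>', m ((henon_inv c b ^^ n) z) * \<xi>') \<and>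
       lu ^ n * w ((henon_inv c b ^^ n) z) * cmod \<xi>' \<le> w z * cmod \<xi>)" (is "?P n")
proof -
  show S: "(henon_inv c b ^^ n) z \<in> S" for n by (induction n) (auto simp: z backward)
  show "?P n"
  proof (induction n)
    case 0
    show ?case unfolding funpow.simps id_def
      by (rule exI[of _ "\<lambda>v. v"]) auto
  next
    case (Suc n)
    let ?y = "(henon_inv c b ^^ n) z"
    obtain D where D: "((henon_inv c b ^^ n) has_derivative D) (at z)"
      and Ds: "\<And>\<eta>. \<exists>\<eta>'. D (k z * \<eta>, \<eta>) = (k ?y * \<eta>', \<eta>') \<and> 2 ^ n * cmod \<eta> \<le> cmod \<eta>'"
      and Du: "\<And>\<xi>. \<exists>\<xi>'. D (\<xi>, m z * \<xi>) = (\<xi>', m ?y * \<xi>') \<and> lu ^ n * w ?y * cmod \<xi>' \<le> w z * cmod \<xi>"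
      using Suc by blast
    have "((henon_inv c b ^^ Suc n) has_derivative Dhenon_inv b ?y \<circ> D) (at z)"
      using diff_chain_at[OF D has_derivative_henon_inv[OF b(1)]] by simp
    moreover have "\<exists>\<eta>'. (Dhenon_inv b ?y \<circ> D) (k z * \<eta>, \<eta>) = (k ((henon_inv c b ^^ Suc n) z) * \<eta>', \<eta>') \<and> 2 ^ Suc n * cmod \<eta> \<le> cmod \<eta>'" for \<eta>
    proof -
      obtain \<eta>' where e: "D (k z * \<eta>, \<eta>) = (k ?y * \<eta>', \<eta>')" "2 ^ n * cmod \<eta> \<le> cmod \<eta>'" using Ds by blast
      let ?k = "k (henon_inv c b ?y)"
      have "cmod ?k \<le> 1 / 2" "?k \<noteq> 0" using k_le nonzero(1) backward[OF S] by blast+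
      then have "2 * cmod \<eta>' \<le> cmod (\<eta>' / ?k)"
        using mult_right_mono[of "cmod ?k" "1/2" "cmod \<eta>'"] by (simp add: norm_divide field_simps)
      then show ?thesis using Dhenon_inv_stable[OF S] e
        by (intro exI[of _ "\<eta>' / ?k"]) (simp add: o_def)
    qed
    moreover have "\<exists>\<xi>'. (Dhenon_inv b ?y \<circ> D) (\<xi>, m z * \<xi>) = (\<xi>', m ((henon_inv c b ^^ Suc n) z) * \<xi>') \<and>
       lu ^ Suc n * w ((henon_inv c b ^^ Suc n) z) * cmod \<xi>' \<le> w z * cmod \<xi>" for \<xi>
    proof -
      obtain \<xi>' where e: "D (\<xi>, m z * \<xi>) = (\<xi>', m ?y * \<xi>')" "lu ^ n * w ?y * cmod \<xi>' \<le> w z * cmod \<xi>" using Du by blast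
      have "lu ^ Suc n * w (henon_inv c b ?y) * cmod (m ?y * \<xi>') = lu ^ n * cmod \<xi>' * (lu * w (henon_inv c b ?y) * cmod (m ?y))"
        by (simp add: norm_mult)
      also have "\<dots> \<le> lu ^ n * cmod \<xi>' * w ?y"
        using unstable_rate[OF S] lambda by (intro mult_left_mono) auto
      also have "\<dots> \<le> w z * cmod \<xi>" using e(2) by (simp add: mult_ac)
      finally show ?thesis using Dhenon_inv_unstable[OF S] e(1)
        by (intro exI[of _ "m ?y * \<xi>'"]) (simp add: o_def)
    qed
    ultimately show ?case by blast
  qed
qed

lemma direct_sum2_bundles:
  assumes "z \<in> S"
  shows "direct_sum2 (Es z) (Eu z)"
    and "splitting_proj (Es z) (Eu z) v =
      (k z * ((snd v - m z * fst v) / (1 - k z * m z)), (snd v - m z * fst v) / (1 - k z * m z))"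
proof -
  note nz = nonzero(3)[OF assms]
  interpret vs: vector_space scaleC2 by (rule vector_space_scaleC2)
  have sub: "csubspace2 (Es z)" "csubspace2 (Eu z)"
    unfolding csubspace2_def vs.subspace_def Es_def Eu_def
    by (auto simp: scaleC2_def zero_prod_def algebra_simps)
  have int: "x = 0" if "x \<in> Es z" "x \<in> Eu z" for x
  proof -
    obtain \<eta> \<xi> where "x = (k z * \<eta>, \<eta>)" "x = (\<xi>, m z * \<xi>)" using \<open>x \<in> Es z\<close> \<open>x \<in> Eu z\<close> unfolding Es_def Eu_def by blast
    moreover from this have "(1 - k z * m z) * \<eta> = 0" by (auto simp: algebra_simps)
    ultimately show ?thesis using nz by (simp add: zero_prod_def)
  qed
  let ?p = "\<lambda>v. (k z * ((snd v - m z * fst v) / (1 - k z * m z)), (snd v - m z * fst v) / (1 - k z * m z))"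
  have p: "?p v \<in> Es z" "v - ?p v \<in> Eu z" for v
  proof -
    show "?p v \<in> Es z" by (auto simp: Es_def)
    let ?e = "(snd v - m z * fst v) / (1 - k z * m z)"
    have "?e * (1 - k z * m z) = snd v - m z * fst v" using nz by simp
    then have "snd v - ?e = m z * (fst v - k z * ?e)" by (simp only: algebra_simps) algebra
    then show "v - ?p v \<in> Eu z" unfolding Eu_def by (auto simp: prod_eq_iff)
  qed
  have "0 \<in> Es z \<inter> Eu z" by (auto simp: Es_def Eu_def zero_prod_def)
  then have "Es z \<inter> Eu z = {0}" using int by blast
  moreover have "\<exists>x\<in>Es z. \<exists>y\<in>Eu z. v = x + y" for v
    using p[of v] by (intro bexI[of _ "?p v"] bexI[of _ "v - ?p v"]) auto
  ultimately show "direct_sum2 (Es z) (Eu z)" using sub by (simp add: direct_sum2_def)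
  show "splitting_proj (Es z) (Eu z) v = ?p v" unfolding splitting_proj_def
  proof (rule the_equality)
    fix x assume x: "x \<in> Es z \<and> v - x \<in> Eu z"
    have "x - ?p v \<in> Es z" using x p(1)[of v] sub(1) vs.subspace_diff unfolding csubspace2_def by blast
    moreover have "(v - ?p v) - (v - x) \<in> Eu z" using x p(2)[of v] sub(2) vs.subspace_diff unfolding csubspace2_def by blast
    moreover have "(v - y) - (v - x) = x - y" for y :: "complex \<times> complex" by simp
    ultimately have "x - ?p v = 0" using int by metis
    then show "x = ?p v" by simp
  qed (use p in blast)
qed

lemma image_Es: "z \<in> S \<Longrightarrow> Dhenon b z ` Es z = Es (henon c b z)"
proof (intro equalityI subsetI)
  assume z: "z \<in> S"
  show "v \<in> Es (henon c b z)" if "v \<in> Dhenon b z ` Es z" for v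
    using that unfolding Es_def by (auto simp: Dhenon_stable[OF z])
  fix v assume "v \<in> Es (henon c b z)"
  then obtain \<eta> where v: "v = (k (henon c b z) * \<eta>, \<eta>)" by (auto simp: Es_def)
  have "Dhenon b z (k z * (\<eta> / k z), \<eta> / k z) = v" 
    unfolding Dhenon_stable[OF z] using v nonzero(1)[OF z] by simp
  moreover have "(k z * (\<eta> / k z), \<eta> / k z) \<in> Es z" by (auto simp: Es_def)
  ultimately show "v \<in> Dhenon b z ` Es z" by (metis image_eqI)
qed

lemma image_Eu: "z \<in> S \<Longrightarrow> Dhenon b z ` Eu z = Eu (henon c b z)"
proof (intro equalityI subsetI)
  assume z: "z \<in> S"
  show "v \<in> Eu (henon c b z)" if "v \<in> Dhenon b z ` Eu z" for v
    using that unfolding Eu_def by (auto simp: Dhenon_unstable[OF z])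
  fix v assume "v \<in> Eu (henon c b z)"
  then obtain \<xi> where v: "v = (\<xi>, m (henon c b z) * \<xi>)" by (auto simp: Eu_def)
  let ?x = "m (henon c b z) * \<xi>"
  have "Dhenon b z (?x, m z * ?x) = v" 
    unfolding Dhenon_unstable[OF z] using v nonzero(2)[OF forward[OF z]] by simp
  moreover have "(?x, m z * ?x) \<in> Eu z" by (auto simp: Eu_def)
  ultimately show "v \<in> Dhenon b z ` Eu z" by (metis image_eqI)
qed

lemma hyperbolic: "hyperbolic_set (henon c b) S"
proof -
  have inv: "invariant_set (henon c b) S" unfolding invariant_set_def
    using forward backward henon_inverse(2)[OF b(1)] by (metis (mono_tags, lifting) equalityI subsetI vimage_eq)
  have splitting: "continuous_splitting_on S Es Eu"
    unfolding continuous_splitting_on_def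
  proof (intro conjI ballI allI)
    fix v
    have "continuous_on S (\<lambda>z. (k z * ((snd v - m z * fst v) / (1 - k z * m z)), (snd v - m z * fst v) / (1 - k z * m z)))"
      using nonzero(3) by (intro continuous_intros cont) auto
    then show "continuous_on S (\<lambda>z. splitting_proj (Es z) (Eu z) v)"
      by (rule continuous_on_eq) (simp add: direct_sum2_bundles(2))
  qed (rule direct_sum2_bundles(1))
  have st: "norm (frechet_derivative (henon c b ^^ n) (at z) v) \<le> 2 * (1 / 2) ^ n * norm v"
    if z: "z \<in> S" and v: "v \<in> Es z" for z n v
  proof -
    obtain \<eta> where v: "v = (k z * \<eta>, \<eta>)" using v by (auto simp: Es_def)
    let ?y = "(henon c b ^^ n) z"
    obtain D \<eta>' where D: "((henon c b ^^ n) has_derivative D) (at z)"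
      "D v = (k ?y * \<eta>', \<eta>')" "cmod \<eta>' \<le> (1 / 2) ^ n * cmod \<eta>"
      using iterate_derivative(2)[OF z, of n] v by metis
    have "norm (D v) \<le> cmod (k ?y * \<eta>') + cmod \<eta>'" unfolding D(2) by (rule norm_Pair_le)
    also have "\<dots> \<le> 1 / 2 * cmod \<eta>' + cmod \<eta>'"
      unfolding norm_mult using k_le[OF iterate_derivative(1)[OF z]] by (intro add_mono mult_right_mono) auto
    also have "\<dots> \<le> 2 * cmod \<eta>'" by simp
    also have "\<dots> \<le> 2 * ((1 / 2) ^ n * norm v)"
    proof -
      have "(1 / 2) ^ n * cmod \<eta> \<le> (1 / 2) ^ n * norm v"
        unfolding v by (intro mult_left_mono norm_snd_le) auto
      then show ?thesis using D(3) by linarith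
    qed
    finally show ?thesis using frechet_derivative_at[OF D(1)] by simp
  qed
  have M: "1 \<le> max 1 M" and B: "0 \<le> max 1 B" by auto
  have un: "norm (frechet_derivative (henon_inv c b ^^ n) (at z) v) \<le> max 1 M * (1 + max 1 B) * (1 / lu) ^ n * norm v"
    if z: "z \<in> S" and v: "v \<in> Eu z" for z n v
  proof -
    obtain \<xi> where v: "v = (\<xi>, m z * \<xi>)" using v by (auto simp: Eu_def)
    let ?y = "(henon_inv c b ^^ n) z"
    obtain D \<xi>' where D: "((henon_inv c b ^^ n) has_derivative D) (at z)"
      "D v = (\<xi>', m ?y * \<xi>')" "lu ^ n * w ?y * cmod \<xi>' \<le> w z * cmod \<xi>"
      using iterate_inv_derivative(2)[OF z, of n] v by metis
    note y = iterate_inv_derivative(1)[OF z, of n]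
    have l: "lu ^ n > 0" using lambda by simp
    have "norm (D v) \<le> cmod \<xi>' + cmod (m ?y * \<xi>')" unfolding D(2) by (rule norm_Pair_le)
    also have "\<dots> \<le> cmod \<xi>' + max 1 B * cmod \<xi>'"
      unfolding norm_mult using m_le[OF y] by (intro add_mono mult_right_mono) auto
    finally have 1: "norm (D v) \<le> (1 + max 1 B) * cmod \<xi>'" by (simp add: algebra_simps)
    have "lu ^ n * cmod \<xi>' * 1 \<le> lu ^ n * cmod \<xi>' * w ?y" using weight(1)[OF y] l by (intro mult_left_mono) auto
    also have "\<dots> \<le> w z * cmod \<xi>" using D(3) by (simp add: mult_ac)
    also have "\<dots> \<le> max 1 M * norm v"
      using weight(2)[OF z] norm_fst_le[of \<xi> "m z * \<xi>"] unfolding v by (intro mult_mono) auto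
    finally have "cmod \<xi>' \<le> max 1 M * (1 / lu) ^ n * norm v" using l by (simp add: power_divide field_simps)
    then have "(1 + max 1 B) * cmod \<xi>' \<le> (1 + max 1 B) * (max 1 M * (1 / lu) ^ n * norm v)"
      using B by (intro mult_left_mono) auto
    with 1 show ?thesis using frechet_derivative_at[OF D(1)] by (simp add: mult_ac)
  qed
  have pos: "0 < max 1 M * (1 + max 1 B)" by (intro mult_pos_pos) auto
  have bundles: "\<exists>Es Eu Cs Cu ls lu. Cs > 0 \<and> Cu > 0 \<and> 0 < ls \<and> ls < 1 \<and> 1 < lu \<and>
        continuous_splitting_on S Es Eu \<and>
        (\<forall>z\<in>S. frechet_derivative (henon c b) (at z) ` Es z = Es (henon c b z) \<and>
                frechet_derivative (henon c b) (at z) ` Eu z = Eu (henon c b z)) \<and>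
        (\<forall>z\<in>S. \<forall>n\<ge>1. \<forall>v\<in>Es z.
           norm (frechet_derivative (henon c b ^^ n) (at z) v) \<le> Cs * ls ^ n * norm v) \<and>
        (\<forall>z\<in>S. \<forall>n\<ge>1. \<forall>v\<in>Eu z.
           norm (frechet_derivative (inv (henon c b) ^^ n) (at z) v) \<le> Cu * (1 / lu) ^ n * norm v)"
  proof (rule exI[of _ Es], rule exI[of _ Eu], rule exI[of _ 2], rule exI[of _ "max 1 M * (1 + max 1 B)"],
      rule exI[of _ "1 / 2"], rule exI[of _ lu], intro conjI ballI allI impI)
    fix z assume z: "z \<in> S"
    show "frechet_derivative (henon c b) (at z) ` Es z = Es (henon c b z)"
      "frechet_derivative (henon c b) (at z) ` Eu z = Eu (henon c b z)"
      unfolding frechet_derivative_henon using image_Es[OF z] image_Eu[OF z] by blast+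
    fix n :: nat and v
    show "norm (frechet_derivative (henon c b ^^ n) (at z) v) \<le> 2 * (1 / 2) ^ n * norm v" if "v \<in> Es z"
      using st[OF z that] .
    show "norm (frechet_derivative (inv (henon c b) ^^ n) (at z) v) \<le> max 1 M * (1 + max 1 B) * (1 / lu) ^ n * norm v" if "v \<in> Eu z"
      unfolding inv_henon[OF b(1)] using un[OF z that] .
  qed (use splitting pos lambda in auto)
  show ?thesis unfolding hyperbolic_set_def
    by (intro conjI diffeomorphism_henon[OF b(1)] compact inv bundles)
qed

text \<open>Orbits in the compact invariant set \<open>S\<close> are bounded in both directions of time. In the interior of the set of bounded
  orbits the derivatives of the iterates would be bounded, contrary to their growth along the unstable direction forward
  and along the stable direction backward.\<close>

lemma subset_henon_julia: "S \<subseteq> henon_julia (henon c b)"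
proof
  fix z assume z: "z \<in> S"
  interpret f: delay_map "henon c b" fst snd "3 + cmod c" by (rule delay_map_henon) (use b in auto)
  interpret g: delay_map "henon_inv c b" snd fst "3 + cmod c" by (rule delay_map_henon_inv) (use b in auto)
  have "bounded S" using compact by (rule compact_imp_bounded)
  then have "z \<in> bounded_orbit_set (henon c b)" "z \<in> bounded_orbit_set (henon_inv c b)"
    using iterate_derivative(1)[OF z] iterate_inv_derivative(1)[OF z]
    unfolding bounded_orbit_set_def by (auto elim!: bounded_subset)
  moreover have "z \<notin> interior (bounded_orbit_set (henon c b))"
  proof
    assume "z \<in> interior (bounded_orbit_set (henon c b))"
    then obtain X where X: "\<And>n D. ((henon c b ^^ n) has_derivative D) (at z) \<Longrightarrow> cmod (fst (D (1, m z))) \<le> X"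
      using f.interior_derivative_bounded by metis
    have bd: "lu ^ n \<le> M * X" for n
    proof -
      obtain D \<xi>' where D: "((henon c b ^^ n) has_derivative D) (at z)"
        "D (1, m z * 1) = (\<xi>', m ((henon c b ^^ n) z) * \<xi>')" "lu ^ n * w z * cmod 1 \<le> w ((henon c b ^^ n) z) * cmod \<xi>'"
        using iterate_derivative(2)[OF z, of n] by metis
      have "lu ^ n * 1 \<le> lu ^ n * w z" using lambda weight(1)[OF z] by (intro mult_left_mono) auto
      also have "\<dots> \<le> w ((henon c b ^^ n) z) * cmod \<xi>'" using D(3) by simp
      also have "\<dots> \<le> M * X" 
        using X[OF D(1)] D(2) weight[OF iterate_derivative(1)[OF z, of n]] by (intro mult_mono) auto
      finally show ?thesis by simp
    qed
    obtain n where "M * X < lu ^ n" using real_arch_pow[OF lambda] by blast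
    with bd[of n] show False by simp
  qed
  moreover have "z \<notin> interior (bounded_orbit_set (henon_inv c b))"
  proof
    assume "z \<in> interior (bounded_orbit_set (henon_inv c b))"
    then obtain X where X: "\<And>n D. ((henon_inv c b ^^ n) has_derivative D) (at z) \<Longrightarrow> cmod (snd (D (k z, 1))) \<le> X"
      using g.interior_derivative_bounded by metis
    have bd: "2 ^ n \<le> X" for n
    proof -
      obtain D \<eta>' where D: "((henon_inv c b ^^ n) has_derivative D) (at z)"
        "D (k z * 1, 1) = (k ((henon_inv c b ^^ n) z) * \<eta>', \<eta>')" "2 ^ n * cmod 1 \<le> cmod \<eta>'"
        using iterate_inv_derivative(2)[OF z, of n] by metis
      then show ?thesis using X[OF D(1)] by simp
    qed
    obtain n where "X < 2 ^ n" using real_arch_pow[of 2] by auto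
    with bd[of n] show False by simp
  qed
  ultimately show "z \<in> henon_julia (henon c b)"
    using closure_subset unfolding henon_julia_def frontier_def inv_henon[OF b(1)] by blast
qed

end

section \<open>The continued set\<close>

lemma compact_quad_orbits:
  assumes "compact \<Lambda>"
  shows "compact (quad_orbits c \<Lambda>)"
proof -
  have "compactin (product_topology (\<lambda>i::int. euclidean) UNIV) (PiE UNIV (\<lambda>_. \<Lambda>))"
    unfolding compactin_PiE using assms by simp
  then have "compact (PiE (UNIV :: int set) (\<lambda>_. \<Lambda>))" by (simp add: euclidean_product_topology)
  moreover have "closed {x :: int \<Rightarrow> complex. \<forall>n. x (n + 1) = quad c (x n)}"
    unfolding quad_def
    by (intro closed_Collect_all closed_Collect_eq continuous_intros continuous_on_product_coordinates)
  ultimately have "compact (PiE (UNIV :: int set) (\<lambda>_. \<Lambda>) \<inter> {x. \<forall>n. x (n + 1) = quad c (x n)})"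
    by (rule compact_Int_closed)
  moreover have "PiE UNIV (\<lambda>_. \<Lambda>) \<inter> {x. \<forall>n. x (n + 1) = quad c (x n)} = quad_orbits c \<Lambda>"
    by (auto simp: quad_orbits_def PiE_UNIV_domain)
  ultimately show ?thesis by simp
qed

lemma quad_orbits_shift: "x \<in> quad_orbits c \<Lambda> \<Longrightarrow> (\<lambda>i. x (i + j)) \<in> quad_orbits c \<Lambda>"
  unfolding quad_orbits_def by (auto simp: add.assoc add.commute[of 1 j])
    (metis add.assoc add.commute)

lemma quad_orbits_recurrence: "x \<in> quad_orbits c \<Lambda> \<Longrightarrow> henon_recurrence c 0 x"
  by (auto simp: quad_orbits_def henon_recurrence_def quad_def)

lemma henon_recurrence_shift: "henon_recurrence c b s \<Longrightarrow> henon_recurrence c b (\<lambda>n. s (n + j))"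
  unfolding henon_recurrence_def
proof
  fix n assume "\<forall>n. s (n + 1) = (s n)\<^sup>2 + c - b * s (n - 1)"
  from spec[OF this, of "n + j"] show "s (n + 1 + j) = (s (n + j))\<^sup>2 + c - b * s (n - 1 + j)"
    by (simp add: algebra_simps)
qed

definition continued_point :: "complex \<Rightarrow> (int \<Rightarrow> complex) \<Rightarrow> complex \<times> complex" where
  "continued_point b x = (continuation b x 1, continuation b x 0)"

context small_perturbation
begin

lemma continuation_shift:
  assumes x: "x \<in> quad_orbits c \<Lambda>" and b: "cmod b \<le> \<epsilon>"
  shows "continuation b (\<lambda>i. x (i + j)) n = continuation b x (n + j)"
proof -
  note x' = quad_orbits_shift[OF x, of j]
  have "continuation b (\<lambda>i. x (i + j)) = (\<lambda>n. continuation b x (n + j))"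
  proof (rule recurrence_near_orbit_unique[OF x' b])
    show "henon_recurrence c b (continuation b (\<lambda>i. x (i + j)))"
      by (rule continuation_recurrence[OF x' b])
    show "henon_recurrence c b (\<lambda>n. continuation b x (n + j))"
      by (rule henon_recurrence_shift continuation_recurrence x b)+
    show "cmod (continuation b (\<lambda>i. x (i + j)) n - x (n + j)) \<le> 2 * \<eta>" for n
      using continuation_near[OF x' b, of n] eta_pos by linarith
    show "cmod (continuation b x (n + j) - x (n + j)) \<le> 2 * \<eta>" for n
      using continuation_near[OF x b, of "n + j"] eta_pos by linarith
  qed
  then show ?thesis by meson
qed

lemma continued_point_shift:
  assumes x: "x \<in> quad_orbits c \<Lambda>" and b: "cmod b \<le> \<epsilon>"
  shows "continued_point b (\<lambda>i. x (i + j)) = (continuation b x (j + 1), continuation b x j)"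
  unfolding continued_point_def continuation_shift[OF x b] by (simp add: add.commute)

lemma henon_continued_point:
  assumes x: "x \<in> quad_orbits c \<Lambda>" and b: "cmod b \<le> \<epsilon>"
  shows "henon c b (continued_point b x) = continued_point b (\<lambda>i. x (i + 1))"
    and "b \<noteq> 0 \<Longrightarrow> henon_inv c b (continued_point b x) = continued_point b (\<lambda>i. x (i + - 1))"
  using henon_recurrence_iterate[OF continuation_recurrence[OF x b], of 1 1]
    henon_recurrence_iterate_inv[OF continuation_recurrence[OF x b], of 1 1]
  unfolding continued_point_shift[OF x b] by (simp_all add: continued_point_def)

text \<open>A point determines its whole orbit because \<open>b \<noteq> 0\<close>. Two orbits of \<open>quad c\<close> with the same continuation stay within
  \<open>2 * \<eta>\<close> of each other, so expansion makes them equal.\<close>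

lemma inj_continued_point:
  assumes b: "cmod b \<le> \<epsilon>" "b \<noteq> 0"
  shows "inj_on (continued_point b) (quad_orbits c \<Lambda>)"
proof (rule inj_onI)
  fix x y assume x: "x \<in> quad_orbits c \<Lambda>" and y: "y \<in> quad_orbits c \<Lambda>"
    and eq: "continued_point b x = continued_point b y"
  have same: "continuation b x = continuation b y"
    using eq by (intro henon_recurrence_unique[OF continuation_recurrence continuation_recurrence] x y b)
      (auto simp: continued_point_def)
  have "y = x"
  proof (rule recurrence_near_orbit_unique[OF x, of 0])
    show "cmod (y n - x n) \<le> 2 * \<eta>" for n
      using continuation_near[OF x b(1), of n] continuation_near[OF y b(1), of n]
        norm_triangle_ineq4[of "continuation b x n - x n" "continuation b x n - y n"] by (simp add: same)
  qed (use x y eps_pos eta_pos quad_orbits_recurrence in auto)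
  then show "x = y" ..
qed

lemma continuous_continued_point:
  "cmod b \<le> \<epsilon> \<Longrightarrow> continuous_on (quad_orbits c \<Lambda>) (continued_point b)"
  unfolding continued_point_def[abs_def] by (intro continuous_intros continuation_continuous)

lemma continued_point_bounds:
  assumes x: "x \<in> quad_orbits c \<Lambda>" and b: "cmod b \<le> \<epsilon>"
  shows "2 * cmod (x 1) - 2 * \<eta> \<le> cmod (2 * fst (continued_point b x))"
    and "2 * cmod (x 0) - 2 * \<eta> \<le> cmod (2 * snd (continued_point b x))"
    and "3 / 2 * a \<le> cmod (2 * fst (continued_point b x))"
    and "3 / 2 * a \<le> cmod (2 * snd (continued_point b x))"
proof -
  have 1: "cmod (x n) - \<eta> \<le> cmod (continuation b x n)" for n
    using continuation_near[OF x b, of n] norm_triangle_ineq2[of "x n" "continuation b x n"] 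
    by (simp add: norm_minus_commute)
  then show 2: "2 * cmod (x 1) - 2 * \<eta> \<le> cmod (2 * fst (continued_point b x))"
    and 3: "2 * cmod (x 0) - 2 * \<eta> \<le> cmod (2 * snd (continued_point b x))"
    unfolding continued_point_def fst_conv snd_conv norm_mult norm_numeral using 1[of 0] 1[of 1] by linarith+
  show "3 / 2 * a \<le> cmod (2 * fst (continued_point b x))"
    and "3 / 2 * a \<le> cmod (2 * snd (continued_point b x))"
    using 2 3 quad_orbitsD(6)[OF x, of 0] quad_orbitsD(6)[OF x, of 1] eta_le by linarith+
qed

text \<open>Both slopes come from \<open>invariant_section\<close>, with \<open>henon c b\<close> for \<open>k\<close> and its inverse for \<open>m\<close>. On the continued
  set the coordinates are close to points of \<open>\<Lambda>\<close>, so all denominators have modulus at least \<open>a\<close>. The weight of a continued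
  point is that of the orbit which it continues.\<close>

lemma continued_hyperbolic_bundles:
  assumes b: "cmod b \<le> \<epsilon>" "b \<noteq> 0"
  obtains k m w lu B M' where "hyperbolic_bundles c b (continued_point b ` quad_orbits c \<Lambda>) k m w lu B M'"
proof -
  let ?S = "continued_point b ` quad_orbits c \<Lambda>"
  have fw: "henon c b ` ?S \<subseteq> ?S" and bw: "henon_inv c b ` ?S \<subseteq> ?S"
    using henon_continued_point[OF _ b(1)] b(2) quad_orbits_shift by (auto simp del: add_uminus_conv_diff)
  have big: "3 / 2 * a \<le> cmod (2 * fst z)" "3 / 2 * a \<le> cmod (2 * snd z)" if "z \<in> ?S" for z
    using that continued_point_bounds(3,4)[OF _ b(1)] by auto
  have denominator: "a \<le> cmod (p - u)" if "3 / 2 * a \<le> cmod p" "cmod u \<le> a / 2" for p u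
    using that norm_triangle_ineq2[of p u] by linarith
  have eps: "\<epsilon> / a \<le> a / 2" "\<epsilon> / a \<le> 1 / 2"
    using eps_le a_pos by (auto simp: field_simps power2_eq_square)
  \<comment> \<open>Covers both equations: \<open>p = b\<close> for the stable slope and \<open>p = 1\<close> for the unstable one.\<close>
  have lipschitz: "cmod (p / A - p / A') \<le> cmod q / 2"
    if "a \<le> cmod A" "a \<le> cmod A'" "p * (A' - A) = b * q" for p A A' q
  proof -
    have nz: "A \<noteq> 0" "A' \<noteq> 0" using that a_pos by auto
    then have "p / A - p / A' = b * q / (A * A')" using that(3) by (simp add: field_simps)
    then have "cmod (p / A - p / A') = cmod b * cmod q / (cmod A * cmod A')"
      by (simp add: norm_mult norm_divide)
    also have "\<dots> \<le> (a\<^sup>2 / 2) * cmod q / (a * a)"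
      using that b eps_le a_pos by (intro frac_le mult_mono mult_right_mono) auto
    also have "\<dots> = cmod q / 2" using a_pos by (simp add: power2_eq_square)
    finally show ?thesis .
  qed
  obtain k where k: "continuous_on ?S k" "\<And>z. z \<in> ?S \<Longrightarrow> cmod (k z) \<le> a / 2"
      "\<And>z. z \<in> ?S \<Longrightarrow> k z = b / (2 * fst z - k (henon c b z))"
  proof (rule invariant_section[where f = "henon c b" and S = ?S and r = "a / 2" and G = "\<lambda>z u. b / (2 * fst z - u)"])
    show "continuous_on ?S (henon c b)"
      unfolding henon_def split_beta by (intro continuous_intros)
    fix z u assume z: "z \<in> ?S" and u: "cmod u \<le> a / 2"
    have "cmod (b / (2 * fst z - u)) \<le> \<epsilon> / a"
      unfolding norm_divide using denominator[OF big(1)[OF z] u] b a_pos eps_pos by (intro frac_le) auto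
    then show "cmod (b / (2 * fst z - u)) \<le> a / 2" using eps by linarith
    fix v assume v: "cmod v \<le> a / 2"
    show "cmod (b / (2 * fst z - u) - b / (2 * fst z - v)) \<le> cmod (u - v) / 2"
      by (rule lipschitz) (use denominator[OF big(1)[OF z]] u v in auto)
  next
    fix \<sigma> assume \<sigma>: "continuous_on ?S \<sigma>" "\<And>z. z \<in> ?S \<Longrightarrow> cmod (\<sigma> z) \<le> a / 2"
    have "2 * fst z - \<sigma> z \<noteq> 0" if "z \<in> ?S" for z
      using denominator[OF big(1)[OF that] \<sigma>(2)[OF that]] a_pos by auto
    then show "continuous_on ?S (\<lambda>z. b / (2 * fst z - \<sigma> z))"
      by (intro continuous_intros \<sigma>) auto
  qed (use fw a_pos in auto)
  have small: "cmod (b * u) \<le> a / 2" if "cmod u \<le> 1 / a" for u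
  proof -
    have "cmod (b * u) \<le> \<epsilon> * (1 / a)" unfolding norm_mult using that b eps_pos by (intro mult_mono) auto
    moreover have "\<epsilon> * (1 / a) = \<epsilon> / a" by simp
    ultimately show ?thesis using eps(1) by linarith
  qed
  obtain m where m: "continuous_on ?S m" "\<And>z. z \<in> ?S \<Longrightarrow> cmod (m z) \<le> 1 / a"
      "\<And>z. z \<in> ?S \<Longrightarrow> m z = 1 / (2 * snd z - b * m (henon_inv c b z))"
  proof (rule invariant_section[where f = "henon_inv c b" and S = ?S and r = "1 / a" and G = "\<lambda>z u. 1 / (2 * snd z - b * u)"])
    show "continuous_on ?S (henon_inv c b)"
      unfolding henon_inv_def split_beta using b by (intro continuous_intros) auto
    fix z u assume z: "z \<in> ?S" and u: "cmod u \<le> 1 / a"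
    show "cmod (1 / (2 * snd z - b * u)) \<le> 1 / a"
      unfolding norm_divide using denominator[OF big(2)[OF z] small[OF u]] a_pos by (intro frac_le) auto
    fix v assume v: "cmod v \<le> 1 / a"
    show "cmod (1 / (2 * snd z - b * u) - 1 / (2 * snd z - b * v)) \<le> cmod (u - v) / 2"
    proof (rule lipschitz)
      show "1 * ((2 * snd z - b * v) - (2 * snd z - b * u)) = b * (u - v)" by (simp add: algebra_simps)
    qed (intro denominator big z small u v)+
  next
    fix \<sigma> assume \<sigma>: "continuous_on ?S \<sigma>" "\<And>z. z \<in> ?S \<Longrightarrow> cmod (\<sigma> z) \<le> 1 / a"
    have "2 * snd z - b * \<sigma> z \<noteq> 0" if "z \<in> ?S" for z
      using denominator[OF big(2)[OF that] small[OF \<sigma>(2)[OF that]]] a_pos by auto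
    then show "continuous_on ?S (\<lambda>z. 1 / (2 * snd z - b * \<sigma> z))"
      by (intro continuous_intros \<sigma>) auto
  qed (use bw a_pos in auto)
  \<comment> \<open>The weight sits at \<open>x 1\<close>, the first coordinate, since \<open>\<xi>\<close> is a variation of that coordinate.\<close>
  define w where "w z = \<rho> (the_inv_into (quad_orbits c \<Lambda>) (continued_point b) z 1)" for z
  have w: "w (continued_point b x) = \<rho> (x 1)" if "x \<in> quad_orbits c \<Lambda>" for x
    unfolding w_def the_inv_into_f_f[OF inj_continued_point[OF b] that] ..
  have "hyperbolic_bundles c b ?S k m w ((\<kappa> + 1) / 2) (1 / a) M"
  proof
    show "b \<noteq> 0" "cmod b \<le> 1" using b eps_le by auto
    show "compact ?S"
      by (intro compact_continuous_image continuous_continued_point compact_quad_orbits compact b)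
    show "continuous_on ?S k" "continuous_on ?S m" by fact+
    show "1 < (\<kappa> + 1) / 2" using kappa by simp
    fix z assume z: "z \<in> ?S"
    then obtain x where x: "x \<in> quad_orbits c \<Lambda>" and zx: "z = continued_point b x" by blast
    show fz: "henon c b z \<in> ?S" and bz: "henon_inv c b z \<in> ?S" using z fw bw by blast+
    note kd = denominator[OF big(1)[OF z] k(2)[OF fz]] and md = denominator[OF big(2)[OF z] small[OF m(2)[OF bz]]]
    show "k z * (2 * fst z - k (henon c b z)) = b"
      using kd a_pos by (subst k(3)[OF z]) auto
    show m1: "m z * (2 * snd z - b * m (henon_inv c b z)) = 1"
      using md a_pos by (subst m(3)[OF z]) auto
    have "cmod (k z) * cmod (m z) \<le> a / 2 * (1 / a)"
      using k(2)[OF z] m(2)[OF z] a_pos by (intro mult_mono) auto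
    then show "cmod (k z * m z) < 1" using a_pos by (simp add: norm_mult)
    have "cmod (k z) \<le> \<epsilon> / a" unfolding k(3)[OF z] norm_divide using kd b a_pos eps_pos by (intro frac_le) auto
    then show "cmod (k z) \<le> 1 / 2" using eps by linarith
    show "cmod (m z) \<le> 1 / a" using m(2)[OF z] .
    show "1 \<le> w z" "w z \<le> M" unfolding zx w[OF x] using quad_orbitsD[OF x] by auto
    have wb: "w (henon_inv c b z) = \<rho> (x 0)"
      unfolding zx henon_continued_point(2)[OF x b] w[OF quad_orbits_shift[OF x]] by simp
    have "cmod (b * m (henon_inv c b z)) \<le> \<epsilon> / a"
      unfolding norm_mult using mult_mono[of "cmod b" \<epsilon> "cmod (m (henon_inv c b z))" "1 / a"] b m(2)[OF bz] eps_pos by simp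
    then have "2 * cmod (x 0) - (2 * \<eta> + \<epsilon> / a) \<le> cmod (2 * snd z - b * m (henon_inv c b z))"
      using continued_point_bounds(2)[OF x b(1)] norm_triangle_ineq2[of "2 * snd z" "b * m (henon_inv c b z)"]
      unfolding zx by linarith
    then have "cmod (m z) * (2 * cmod (x 0) - (2 * \<eta> + \<epsilon> / a)) \<le> cmod (m z) * cmod (2 * snd z - b * m (henon_inv c b z))"
      by (intro mult_left_mono) auto
    also have "\<dots> = 1" using m1 by (metis norm_mult norm_one)
    finally have m2: "cmod (m z) * (2 * cmod (x 0) - (2 * \<eta> + \<epsilon> / a)) \<le> 1" .
    have r1: "0 \<le> \<rho> (x 1)" "\<rho> (x 1) \<le> M" "1 \<le> \<rho> (x 0)" using quad_orbitsD(4,5)[OF x, of 1] quad_orbitsD(4)[OF x, of 0] by auto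
    have "(2 * \<eta> + \<epsilon> / a) * \<rho> (x 1) \<le> (2 * \<eta> + \<epsilon> / a) * M"
      using r1 eta_pos eps_pos a_pos by (intro mult_left_mono) auto
    moreover have "(\<kappa> - 1) / 2 * 1 \<le> (\<kappa> - 1) / 2 * \<rho> (x 0)" using r1 kappa by (intro mult_left_mono) auto
    moreover have "\<kappa> * \<rho> (x 0) \<le> 2 * cmod (x 0) * \<rho> (x 1)"
      using expand[OF quad_orbitsD(1)[OF x], of 0] quad_orbitsD(2)[OF x, of 0] by simp
    moreover have split_half: "(\<kappa> + 1) / 2 * \<rho> (x 0) = \<kappa> * \<rho> (x 0) - (\<kappa> - 1) / 2 * \<rho> (x 0)"
      by (simp add: field_simps)
    ultimately have "(\<kappa> + 1) / 2 * \<rho> (x 0) \<le> (2 * cmod (x 0) - (2 * \<eta> + \<epsilon> / a)) * \<rho> (x 1)"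
      unfolding left_diff_distrib using unstable
      by (subst split_half) linarith
    then have "(\<kappa> + 1) / 2 * \<rho> (x 0) * cmod (m z) \<le> (2 * cmod (x 0) - (2 * \<eta> + \<epsilon> / a)) * \<rho> (x 1) * cmod (m z)"
      by (intro mult_right_mono) auto
    also have "\<dots> \<le> 1 * \<rho> (x 1)" using mult_right_mono[OF m2 r1(1)] by (simp add: mult_ac)
    finally show "(\<kappa> + 1) / 2 * w (henon_inv c b z) * cmod (m z) \<le> w z"
      unfolding wb by (simp add: zx w[OF x])
  qed
  then show ?thesis by (rule that)
qed

lemma continued_set_hyperbolic:
  assumes "cmod b \<le> \<epsilon>" "b \<noteq> 0"
  shows "hyperbolic_set (henon c b) (continued_point b ` quad_orbits c \<Lambda>)"
    and "continued_point b ` quad_orbits c \<Lambda> \<subseteq> henon_julia (henon c b)"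
proof -
  obtain k m w lu B M' where "hyperbolic_bundles c b (continued_point b ` quad_orbits c \<Lambda>) k m w lu B M'"
    using continued_hyperbolic_bundles[OF assms] .
  then show "hyperbolic_set (henon c b) (continued_point b ` quad_orbits c \<Lambda>)"
    and "continued_point b ` quad_orbits c \<Lambda> \<subseteq> henon_julia (henon c b)"
    by (rule hyperbolic_bundles.hyperbolic hyperbolic_bundles.subset_henon_julia)+
qed

end

text \<open>It suffices to continue one repelling cycle of \<open>quad c\<close>. The fixed points are \<open>(1 + d) / 2\<close> and \<open>(1 - d) / 2\<close> with
  \<open>d\<^sup>2 = 1 - 4 * c\<close> and multipliers \<open>1 + d\<close> and \<open>1 - d\<close>; by the parallelogram law one of them is repelling unless
  \<open>d = 0\<close>. For \<open>c = 1 / 4\<close> the cycle of period two is repelling.\<close>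

lemma henon_julia_nonempty:
  obtains \<epsilon> where "0 < \<epsilon>" "\<And>b. b \<noteq> 0 \<Longrightarrow> cmod b \<le> \<epsilon> \<Longrightarrow> henon_julia (henon c b) \<noteq> {}"
proof -
  obtain p q l where pq: "quad c p = q" "quad c q = p" "1 < l" "l \<le> 2 * cmod p" "l \<le> 2 * cmod q"
  proof (cases "c = 1 / 4")
    case False
    define d where "d = csqrt (1 - 4 * c)"
    have d: "d\<^sup>2 = 1 - 4 * c" "d \<noteq> 0" using False by (auto simp: d_def eq_divide_eq mult.commute[of c])
    have fixed: "quad c ((1 + s * d) / 2) = (1 + s * d) / 2" if "s\<^sup>2 = 1" for s
      unfolding quad_def power_divide power2_sum power_mult_distrib d that by (simp add: field_simps)
    have "(cmod (1 + d))\<^sup>2 + (cmod (1 - d))\<^sup>2 = 2 + 2 * (cmod d)\<^sup>2"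
      unfolding cmod_power2 by (simp add: power2_eq_square algebra_simps)
    moreover have "(cmod d)\<^sup>2 > 0" using d by simp
    ultimately have "1 < (cmod (1 + d))\<^sup>2 \<or> 1 < (cmod (1 - d))\<^sup>2" by linarith
    then have "1 < cmod (1 + d) \<or> 1 < cmod (1 - d)"
      by (metis norm_ge_zero not_less power_le_one)
    then obtain s where s: "s\<^sup>2 = 1" "1 < cmod (1 + s * d)"
      using that by (metis (no_types, opaque_lifting) mult_1 mult_minus1 one_power2 power2_minus add_uminus_conv_diff)
    then show ?thesis using fixed[OF s(1)]
      by (intro that[of "(1 + s * d) / 2" "(1 + s * d) / 2" "cmod (1 + s * d)"]) (auto simp: norm_divide)
  next
    case True
    have "quad c (Complex (-1/2) 1) = Complex (-1/2) (-1)" "quad c (Complex (-1/2) (-1)) = Complex (-1/2) 1"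
      using True by (auto simp: quad_def power2_eq_square complex_eq_iff)
    moreover have "1 \<le> cmod (Complex (-1/2) 1)" "1 \<le> cmod (Complex (-1/2) (-1))"
      by (auto simp: cmod_def power2_eq_square)
    ultimately show ?thesis by (intro that[of "Complex (-1/2) 1" "Complex (-1/2) (-1)" 2]) auto
  qed
  interpret repeller c "{p, q}" "\<lambda>_. 1" l 1 "1 / 2"
    by unfold_locales (use pq in auto)
  define R where "R = 3 + cmod c + cmod p + cmod q"
  obtain \<eta> \<epsilon>0 where e: "0 < \<epsilon>0" "\<And>\<epsilon>. 0 < \<epsilon> \<Longrightarrow> \<epsilon> \<le> \<epsilon>0 \<Longrightarrow> small_perturbation c {p, q} (\<lambda>_. 1) l 1 (1 / 2) R \<eta> \<epsilon>"
    by (rule small_perturbation_exists[of R]) (auto simp: R_def)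
  then interpret small_perturbation c "{p, q}" "\<lambda>_. 1" l 1 "1 / 2" R \<eta> \<epsilon>0 by blast
  \<comment> \<open>For a fixed point \<open>p = q\<close>, and this orbit is constant.\<close>
  define x where "x n = (if even n then p else q)" for n :: int
  have "x \<in> quad_orbits c {p, q}" by (auto simp: quad_orbits_def x_def pq)
  then show ?thesis
    using continued_set_hyperbolic(2) by (intro that[OF e(1)]) blast
qed

section \<open>Pseudo-orbits near a totally invariant set\<close>

lemma continuous_on_henon_iterate:
  "continuous_on UNIV (\<lambda>p. (henon c (fst p) ^^ n) (snd p))"
proof (induction n)
  case (Suc n)
  then show ?case unfolding funpow.simps o_def henon_def split_beta by (intro continuous_intros)
qed (simp add: continuous_on_snd)

lemma fst_henon_0_iterate: "fst ((henon c 0 ^^ n) z) = (quad c ^^ n) (fst z)"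
  by (induction n) (auto simp: quad_def)

text \<open>The expansion rate \<open>\<beta>\<close> lies between \<open>1\<close> and \<open>\<kappa>\<close>: the part \<open>\<kappa> - \<beta>\<close> pays for the curvature of \<open>quad c\<close> on the
  neighbourhood of size \<open>D\<close>, and the part \<open>\<beta> - 1\<close> pays for the perturbation \<open>b * y\<close>.\<close>

locale totally_invariant_perturbation = small_perturbation +
  fixes \<beta> D :: real
  assumes preimage: "quad c x \<in> \<Lambda> \<Longrightarrow> x \<in> \<Lambda>"
    and frontier: "frontier (bounded_orbit_set (quad c)) = \<Lambda>"
    and beta: "1 < \<beta>" "\<beta> < \<kappa>"
    and D: "0 < D" "D \<le> \<eta>" "M * (\<beta> * D / a) \<le> \<kappa> - \<beta>"
    and eps_R: "\<epsilon> * (R + 1) * M \<le> (\<beta> - 1) * (D / 2)"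
begin

definition near :: "real \<Rightarrow> complex \<Rightarrow> bool" where
  "near d x \<longleftrightarrow> (\<exists>y\<in>\<Lambda>. \<rho> y * cmod (x - y) < d)"

text \<open>The branch of the inverse that sends \<open>y\<close> to the preimage closest to \<open>x\<close> contracts the weighted distance, since
  \<open>quad c x - y = (x - p) * (x + p)\<close> and \<open>x + p\<close> is close to \<open>2 * p\<close>. Total invariance puts that preimage into \<open>\<Lambda>\<close>.\<close>

lemma nearby_preimage:
  assumes y: "y \<in> \<Lambda>" and d: "d \<le> D" and xy: "\<rho> y * cmod (quad c x - y) < \<beta> * d"
  obtains y' where "y' \<in> \<Lambda>" "quad c y' = y" "\<rho> y' * cmod (x - y') < d"
proof -
  obtain p where p: "quad c p = y" "cmod (x - p) \<le> cmod (x + p)"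
  proof -
    let ?r = "csqrt (y - c)"
    have "quad c ?r = y" "quad c (- ?r) = y" by (auto simp: quad_def)
    moreover have "cmod (x - ?r) \<le> cmod (x + ?r) \<or> cmod (x - - ?r) \<le> cmod (x + - ?r)" by auto
    ultimately show ?thesis using that by blast
  qed
  then have p_in: "p \<in> \<Lambda>" using y preimage by blast
  have rho_y: "1 \<le> \<rho> y" "\<rho> y \<le> M" using y rho_ge_1 rho_le by auto
  have rho_p: "1 \<le> \<rho> p" using p_in rho_ge_1 by auto
  have "0 \<le> \<rho> y * cmod (quad c x - y)" using rho_y by simp
  then have "0 < \<beta> * d" using xy by linarith
  then have d_pos: "0 < d" using beta by (simp add: zero_less_mult_iff)
  have prod: "cmod (quad c x - y) = cmod (x - p) * cmod (x + p)"
    unfolding p(1)[symmetric] by (simp add: quad_def power2_eq_square algebra_simps flip: norm_mult)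
  have two_p: "2 * cmod p \<le> cmod (x + p) + cmod (x - p)"
    using norm_triangle_ineq4[of "x + p" "x - p"] by (simp add: norm_mult)
  then have "a \<le> cmod (x + p)" using p(2) a_le[OF p_in] by linarith
  then have "a * cmod (x - p) \<le> cmod (quad c x - y)"
    unfolding prod by (subst mult.commute) (intro mult_left_mono, auto)
  also have "\<dots> \<le> \<rho> y * cmod (quad c x - y)" using rho_y mult_right_mono[of 1 "\<rho> y"] by simp
  also have "\<dots> \<le> \<beta> * D" using xy d beta mult_left_mono[of d D \<beta>] by linarith
  finally have xp: "cmod (x - p) \<le> \<beta> * D / a" using a_pos by (simp add: field_simps)
  have margin: "(\<kappa> - \<beta>) * 1 \<le> (\<kappa> - \<beta>) * \<rho> p" using beta rho_p by (intro mult_left_mono) auto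
  have "\<kappa> * \<rho> p \<le> 2 * cmod p * \<rho> y" using expand[OF p_in] p(1) by simp
  also have "\<dots> \<le> (cmod (x + p) + cmod (x - p)) * \<rho> y" using two_p rho_y by (intro mult_right_mono) auto
  also have "\<dots> = \<rho> y * cmod (x + p) + \<rho> y * cmod (x - p)" by (simp add: algebra_simps)
  also have "\<rho> y * cmod (x - p) \<le> M * (\<beta> * D / a)" using rho_y xp by (intro mult_mono) auto
  also have "\<dots> \<le> (\<kappa> - \<beta>) * \<rho> p" 

    using D(3) margin by (metis mult.right_neutral order_trans)
  finally have "\<beta> * \<rho> p \<le> \<rho> y * cmod (x + p)" by (simp add: algebra_simps)
  then have "\<beta> * \<rho> p * cmod (x - p) \<le> \<rho> y * cmod (x + p) * cmod (x - p)" by (intro mult_right_mono) auto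
  also have "\<dots> < \<beta> * d" using xy unfolding prod by (simp add: mult_ac)
  finally have "\<rho> p * cmod (x - p) < d" using beta by (simp add: mult.assoc)
  then show ?thesis using that p_in p(1) by blast
qed

lemma near_pullback: "d \<le> D \<Longrightarrow> near (\<beta> * d) (quad c x) \<Longrightarrow> near d x"
  unfolding near_def by (metis nearby_preimage)

lemma near_perturb:
  assumes "near d x" "M * cmod (x - x') \<le> e"
  shows "near (d + e) x'"
proof -
  obtain y where y: "y \<in> \<Lambda>" "\<rho> y * cmod (x - y) < d" using assms(1) by (auto simp: near_def)
  have "\<rho> y * cmod (x' - y) \<le> \<rho> y * (cmod (x - y) + cmod (x - x'))"
    using norm_triangle_ineq4[of "x - y" "x - x'"] rho_ge_1[OF y(1)] by (intro mult_left_mono) auto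
  also have "\<dots> = \<rho> y * cmod (x - y) + \<rho> y * cmod (x - x')" by (rule distrib_left)
  also have "\<dots> \<le> \<rho> y * cmod (x - y) + M * cmod (x - x')"
    using rho_le[OF y(1)] by (intro add_left_mono mult_right_mono) auto
  also have "\<dots> < d + e" using y assms(2) by linarith
  finally show ?thesis using y(1) by (auto simp: near_def)
qed

lemma in_near: "y \<in> \<Lambda> \<Longrightarrow> 0 < d \<Longrightarrow> near d y"
  unfolding near_def by (rule bexI[of _ y]) auto

text \<open>A connected set that avoids \<open>\<Lambda>\<close>, the frontier of the filled Julia set, lies on one side of it.\<close>

lemma not_near_connected:
  assumes "connected S" "\<And>t. t \<in> S \<Longrightarrow> \<not> near d t" "0 < d" "x \<in> S" "x' \<in> S"
  shows "x \<in> bounded_orbit_set (quad c) \<longleftrightarrow> x' \<in> bounded_orbit_set (quad c)"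
proof -
  have "S \<inter> frontier (bounded_orbit_set (quad c)) = {}"
    using assms(2,3) in_near unfolding frontier by blast
  then show ?thesis using connected_Int_frontier[OF assms(1), of "bounded_orbit_set (quad c)"] assms(4,5) by blast
qed

text \<open>By \<open>near_pullback\<close> the unperturbed image is even farther from \<open>\<Lambda>\<close> than \<open>x\<close>, by the factor \<open>\<beta>\<close>, so the whole segment
  from it to the perturbed image stays away from \<open>\<Lambda>\<close>.\<close>

lemma trapped_step:
  assumes b: "cmod b \<le> \<epsilon>" and d: "D / 2 \<le> d" "d \<le> D" and y: "cmod y \<le> R + 1" and x: "\<not> near d x"
  shows "\<not> near d (quad c x - b * y)"
    and "quad c x - b * y \<in> bounded_orbit_set (quad c) \<longleftrightarrow> x \<in> bounded_orbit_set (quad c)"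
proof -
  let ?S = "closed_segment (quad c x) (quad c x - b * y)"
  have far: "\<not> near d t" if t: "t \<in> ?S" for t
  proof
    assume "near d t"
    have "cmod (t - quad c x) \<le> cmod (b * y)" using dist_in_closed_segment[OF t] by (simp add: dist_norm norm_minus_commute)
    also have "\<dots> \<le> \<epsilon> * (R + 1)" unfolding norm_mult using b y eps_pos by (intro mult_mono) auto
    finally have "M * cmod (t - quad c x) \<le> M * (\<epsilon> * (R + 1))" using M_pos by (intro mult_left_mono) auto
    also have "\<dots> \<le> (\<beta> - 1) * (D / 2)" using eps_R by (simp add: mult_ac)
    also have "\<dots> \<le> (\<beta> - 1) * d" using beta d by (intro mult_left_mono) auto
    finally have "near (d + (\<beta> - 1) * d) (quad c x)" by (rule near_perturb[OF \<open>near d t\<close>])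
    then show False using near_pullback[OF d(2)] x by (simp add: algebra_simps)
  qed
  then show "\<not> near d (quad c x - b * y)" by simp
  have "quad c x \<in> bounded_orbit_set (quad c) \<longleftrightarrow> quad c x - b * y \<in> bounded_orbit_set (quad c)"
    using not_near_connected[OF connected_segment(1) far] d D by auto
  then show "quad c x - b * y \<in> bounded_orbit_set (quad c) \<longleftrightarrow> x \<in> bounded_orbit_set (quad c)"
    by (simp add: quad_bounded_orbit_invariant)
qed

lemma K_bounded: "x \<in> bounded_orbit_set (quad c) \<Longrightarrow> cmod x \<le> R"
  using bounded_orbit_quad_iff[OF R, of x] by (metis funpow_0)

lemma trapped_bounded:
  assumes b: "cmod b \<le> \<epsilon>" and x: "x \<in> bounded_orbit_set (quad c)" "\<not> near (D / 2) x" and y: "cmod y \<le> R + 1"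
  shows "(x, y) \<in> bounded_orbit_set (henon c b)"
proof -
  let ?z = "\<lambda>n. (henon c b ^^ n) (x, y)"
  have inv: "fst (?z n) \<in> bounded_orbit_set (quad c) \<and> \<not> near (D / 2) (fst (?z n)) \<and> cmod (snd (?z n)) \<le> R + 1" for n
  proof (induction n)
    case (Suc n)
    have "fst (?z (Suc n)) = quad c (fst (?z n)) - b * snd (?z n)" "snd (?z (Suc n)) = fst (?z n)"
      by (simp_all add: quad_def)
    moreover have "cmod (fst (?z n)) \<le> R + 1" using Suc K_bounded[of "fst (?z n)"] by simp
    moreover have "D / 2 \<le> D" using D(1) by simp
    ultimately show ?case using Suc trapped_step[OF b order_refl, of "snd (?z n)" "fst (?z n)"] by simp
  qed (use x y in simp)
  have "norm (?z n) \<le> R + (R + 1)" for n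
    using norm_Pair_le[of "fst (?z n)" "snd (?z n)"] K_bounded[of "fst (?z n)"] inv[of n] by simp
  then show ?thesis unfolding bounded_orbit_set_def bounded_iff by blast
qed

text \<open>The set of points that are trapped away from \<open>\<Lambda>\<close> contains a neighbourhood of \<open>(x, y)\<close>. Points close to \<open>x\<close> satisfy the
  condition with \<open>D / 2\<close> in place of \<open>D\<close>, which is why \<open>trapped_step\<close> is stated for a range of distances.\<close>

lemma trapped_interior:
  assumes b: "cmod b \<le> \<epsilon>" and x: "x \<in> bounded_orbit_set (quad c)" "\<not> near D x" and y: "cmod y \<le> R"
  shows "(x, y) \<in> interior (bounded_orbit_set (henon c b))"
proof (rule interiorI)
  define r where "r = D / (2 * M)"
  have r: "0 < r" using D M_pos by (simp add: r_def)
  show "open (ball x r \<times> ball y 1)" by (intro open_Times open_ball)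
  show "(x, y) \<in> ball x r \<times> ball y 1" using r by simp
  have far: "\<not> near (D / 2) u" if "u \<in> ball x r" for u
  proof
    assume "near (D / 2) u"
    have "M * cmod (u - x) \<le> D / 2"
      using that M_pos by (simp add: r_def dist_norm norm_minus_commute field_simps)
    from near_perturb[OF \<open>near (D / 2) u\<close> this] x(2) show False by simp
  qed
  have "u \<in> bounded_orbit_set (quad c)" if "u \<in> ball x r" for u
    using not_near_connected[OF connected_ball far, of x r x u] that x(1) D(1) r by simp
  moreover have "cmod v \<le> R + 1" if "v \<in> ball y 1" for v
    using that y norm_triangle_ineq4[of "y" "y - v"] by (simp add: dist_norm)
  ultimately show "ball x r \<times> ball y 1 \<subseteq> bounded_orbit_set (henon c b)"
    using trapped_bounded[OF b] far by auto
qed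

text \<open>Start from a point of \<open>\<Lambda>\<close> near \<open>s N\<close> and choose nearby preimages along \<open>s (N - 1), s (N - 2), \<dots>\<close>. Contraction
  absorbs the term \<open>b * s (n - 1)\<close> by which \<open>s (n + 1)\<close> differs from \<open>quad c (s n)\<close>, so the distance stays below \<open>D\<close>. After time \<open>N\<close> the orbit is continued forward
  inside \<open>\<Lambda>\<close> without control.\<close>

lemma shadowing_orbit:
  assumes b: "cmod b \<le> \<epsilon>" and s: "henon_recurrence c b s" "\<And>n. cmod (s n) \<le> R"
    and N: "near D (s N)"
  obtains x where "x \<in> quad_orbits c \<Lambda>" "\<And>n. n \<le> N \<Longrightarrow> cmod (s n - x n) \<le> \<eta>"
proof -
  let ?P = "\<lambda>k y. y \<in> \<Lambda> \<and> \<rho> y * cmod (s (N - int k) - y) < D"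
  have "\<exists>Y. \<forall>k. ?P k (Y k) \<and> quad c (Y (Suc k)) = Y k"
  proof (rule dependent_nat_choice)
    show "\<exists>y. ?P 0 y" using N by (auto simp: near_def)
    fix y k assume y: "?P k y"
    let ?n = "N - int k - 1"
    have "s (N - int k) = quad c (s ?n) - b * s (?n - 1)"
      using s(1)[unfolded henon_recurrence_def, rule_format, of ?n] by (simp add: quad_def)
    then have eq: "quad c (s ?n) - y = (s (N - int k) - y) + b * s (?n - 1)" by simp
    have drift: "cmod (b * s (?n - 1)) \<le> \<epsilon> * (R + 1)"
      unfolding norm_mult using b s(2)[of "?n - 1"] eps_pos by (intro mult_mono) auto
    have error: "M * (\<epsilon> * (R + 1)) \<le> (\<beta> - 1) * (D / 2)" using eps_R by (simp add: mult_ac)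
    have "\<rho> y * cmod (quad c (s ?n) - y) \<le> \<rho> y * (cmod (s (N - int k) - y) + \<epsilon> * (R + 1))"
      unfolding eq using rho_ge_1[of y] y drift by (intro mult_left_mono norm_triangle_le) auto
    also have "\<dots> = \<rho> y * cmod (s (N - int k) - y) + \<rho> y * (\<epsilon> * (R + 1))" by (rule distrib_left)
    also have "\<dots> \<le> \<rho> y * cmod (s (N - int k) - y) + M * (\<epsilon> * (R + 1))"
      using rho_le[of y] y eps_pos order_trans[OF norm_ge_zero s(2)[of 0]]
      by (intro add_left_mono mult_right_mono mult_nonneg_nonneg) auto
    also have "\<dots> < D + (\<beta> - 1) * (D / 2)" using y error by linarith
    also have "\<dots> \<le> \<beta> * D" 
      using beta D(1) mult_pos_pos[of "\<beta> - 1" D] by (simp add: field_simps)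
    finally obtain y' where "y' \<in> \<Lambda>" "quad c y' = y" "\<rho> y' * cmod (s ?n - y') < D"
      using nearby_preimage[of y D] y by blast
    then show "\<exists>y'. ?P (Suc k) y' \<and> quad c y' = y" by (auto simp: algebra_simps)
  qed
  then obtain Y where Y: "\<And>k. ?P k (Y k)" "\<And>k. quad c (Y (Suc k)) = Y k" by blast
  define x where "x n = (if n \<le> N then Y (nat (N - n)) else (quad c ^^ nat (n - N)) (Y 0))" for n
  have "(quad c ^^ j) (Y 0) \<in> \<Lambda>" for j by (induction j) (auto simp: Y(1) forward)
  then have "x n \<in> \<Lambda>" for n by (simp add: x_def Y(1))
  moreover have "x (n + 1) = quad c (x n)" for n
  proof -
    consider "n < N" | "n \<ge> N" by linarith
    then show ?thesis
    proof cases
      case 1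
      then have "nat (N - n) = Suc (nat (N - (n + 1)))" by linarith
      then show ?thesis using 1 Y(2) by (simp add: x_def)
    next
      case 2
      then have "nat (n + 1 - N) = Suc (nat (n - N))" by linarith
      then show ?thesis using 2 by (auto simp: x_def)
    qed
  qed
  ultimately have "x \<in> quad_orbits c \<Lambda>" by (simp add: quad_orbits_def)
  moreover have "cmod (s n - x n) \<le> \<eta>" if "n \<le> N" for n
  proof -
    have P: "Y (nat (N - n)) \<in> \<Lambda>" "\<rho> (Y (nat (N - n))) * cmod (s n - Y (nat (N - n))) < D"
      using Y(1)[of "nat (N - n)"] that by auto
    have "1 * cmod (s n - Y (nat (N - n))) \<le> \<rho> (Y (nat (N - n))) * cmod (s n - Y (nat (N - n)))"
      using rho_ge_1[OF P(1)] by (intro mult_right_mono) auto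
    then show ?thesis using P(2) D(2) that by (simp add: x_def)
  qed
  ultimately show ?thesis by (rule that)
qed

text \<open>For \<open>b = 0\<close> every point outside the filled Julia set leaves the disc of radius \<open>R\<close>. The points in question form a
  compact set, and leaving the disc is an open condition on \<open>b\<close>, \<open>x\<close> and \<open>y\<close> together.\<close>

lemma escape_outside:
  obtains \<epsilon>' where "0 < \<epsilon>'" "\<And>b x y. cmod b < \<epsilon>' \<Longrightarrow> cmod x \<le> R \<Longrightarrow> cmod y \<le> R \<Longrightarrow>
    x \<notin> bounded_orbit_set (quad c) \<Longrightarrow> \<not> near D x \<Longrightarrow> \<exists>n. R < cmod (fst ((henon c b ^^ n) (x, y)))"
proof -
  let ?K = "bounded_orbit_set (quad c)"
  define C where "C = cball 0 R \<inter> - (interior ?K \<union> (\<Union>y\<in>\<Lambda>. {x. \<rho> y * cmod (x - y) < D}))"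
  have "open (\<Union>y\<in>\<Lambda>. {x. \<rho> y * cmod (x - y) < D})"
    by (intro open_UN ballI open_Collect_less continuous_intros)
  then have compact_C: "compact C" unfolding C_def
    by (intro compact_Int_closed compact_cball closed_Compl open_Un open_interior)
  have not_K: "x \<notin> ?K" if "x \<in> C" for x
  proof
    assume "x \<in> ?K"
    then have "x \<in> \<Lambda>" using that closure_subset unfolding C_def frontier[symmetric] frontier_def by auto
    then show False using that in_near[of x D] D(1) by (auto simp: C_def near_def)
  qed
  define U where "U = (\<Union>n. {p. R < cmod (fst ((henon c (fst p) ^^ n) (snd p)))})"
  have "open U" unfolding U_def
    by (intro open_UN ballI open_Collect_less continuous_intros continuous_on_henon_iterate)
  moreover have "compact ({0 :: complex} \<times> (C \<times> cball (0 :: complex) R))"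
    by (intro compact_Times compact_C) auto
  moreover have "{0} \<times> (C \<times> cball 0 R) \<subseteq> U"
  proof
    fix p :: "complex \<times> complex \<times> complex" assume p: "p \<in> {0} \<times> (C \<times> cball 0 R)"
    then have "\<not> (\<forall>n. cmod ((quad c ^^ n) (fst (snd p))) \<le> R)"
      using not_K bounded_orbit_quad_iff[OF R] by auto
    then show "p \<in> U" using p by (auto simp: U_def fst_henon_0_iterate not_le)
  qed
  ultimately obtain \<epsilon>' where e: "0 < \<epsilon>'" "(\<Union>p\<in>{0} \<times> (C \<times> cball 0 R). ball p \<epsilon>') \<subseteq> U"
    using compact_subset_open_imp_ball_epsilon_subset by metis
  show ?thesis
  proof
    fix b x y assume *: "cmod b < \<epsilon>'" "cmod x \<le> R" "cmod y \<le> R" "x \<notin> ?K" "\<not> near D x"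
    then have "x \<in> C" using interior_subset by (auto simp: C_def near_def)
    moreover have "dist (0, x, y) (b, x, y) = cmod b" by (simp add: dist_Pair_Pair)
    ultimately have "(b, x, y) \<in> U" using * e(2) by (fastforce simp: dist_commute)
    then show "\<exists>n. R < cmod (fst ((henon c b ^^ n) (x, y)))" by (auto simp: U_def)
  qed (rule e)
qed

text \<open>The orbit of a point of the Julia set is bounded by \<open>R\<close>, and at positive times it stays near \<open>\<Lambda>\<close>: otherwise it would
  be trapped, hence interior to the set of bounded orbits, or escape. So for each \<open>N\<close> some orbit in \<open>\<Lambda>\<close>
  shadows it up to time \<open>N + 1\<close>. By compactness of the orbit space one orbit shadows it at all times, and the
  shadowed sequence is its continuation by uniqueness.\<close>

lemma henon_julia_subset:
  obtains \<epsilon>' where "0 < \<epsilon>'" "\<And>b. b \<noteq> 0 \<Longrightarrow> cmod b < \<epsilon>' \<Longrightarrow> cmod b \<le> \<epsilon> \<Longrightarrow>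
    henon_julia (henon c b) \<subseteq> continued_point b ` quad_orbits c \<Lambda>"
proof -
  obtain \<epsilon>' where e: "0 < \<epsilon>'" "\<And>b x y. cmod b < \<epsilon>' \<Longrightarrow> cmod x \<le> R \<Longrightarrow> cmod y \<le> R \<Longrightarrow>
    x \<notin> bounded_orbit_set (quad c) \<Longrightarrow> \<not> near D x \<Longrightarrow> \<exists>n. R < cmod (fst ((henon c b ^^ n) (x, y)))"
    by (rule escape_outside) blast
  show ?thesis
  proof (rule that[OF e(1)], rule subsetI)
    fix b z assume b: "b \<noteq> 0" "cmod b < \<epsilon>'" "cmod b \<le> \<epsilon>" and z: "z \<in> henon_julia (henon c b)"
    have b1: "cmod b \<le> 1" using b eps_le by simp
    interpret f: delay_map "henon c b" fst snd R by (rule delay_map_henon[OF R b1])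
    interpret g: delay_map "henon_inv c b" snd fst R by (rule delay_map_henon_inv[OF R b1 b(1)])
    obtain s where s: "henon_recurrence c b s" "z = (s 1, s 0)"
      using henon_recurrence_exists[OF b(1)] .
    have zK: "z \<in> bounded_orbit_set (henon c b) \<inter> bounded_orbit_set (inv (henon c b))"
      and z_int: "z \<notin> interior (bounded_orbit_set (henon c b))"
      using z f.closed_bounded_orbit_set g.closed_bounded_orbit_set
      unfolding henon_julia_def inv_henon[OF b(1)] frontier_def by (auto simp: closure_closed)
    have sR: "cmod (s n) \<le> R" for n
      using bounded_recurrence_iff[OF R b1 b(1) s(1), of 0] zK s(2) by simp
    have near: "near D (s (int N + 1))" for N :: nat
    proof (rule ccontr)
      assume far: "\<not> near D (s (int N + 1))"
      have it: "(henon c b ^^ n) (s (int N + 1), s (int N)) = (s (int N + 1 + int n), s (int N + int n))" for n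
        using henon_recurrence_iterate[OF s(1), of n "int N + 1"] by (simp add: algebra_simps)
      show False
      proof (cases "s (int N + 1) \<in> bounded_orbit_set (quad c)")
        case True
        let ?T = "(henon c b ^^ N) -` interior (bounded_orbit_set (henon c b))"
        have "(s (int N + 1), s (int N)) \<in> interior (bounded_orbit_set (henon c b))"
          by (rule trapped_interior[OF b(3) True far sR])
        moreover have "(henon c b ^^ N) z = (s (int N + 1), s (int N))"
          using henon_recurrence_iterate[OF s(1), of N 1] by (simp add: s(2) algebra_simps)
        ultimately have "z \<in> ?T" by simp
        moreover have "open ?T" by (intro open_vimage open_interior f.continuous_iterate)
        moreover have "?T \<subseteq> bounded_orbit_set (henon c b)"
        proof
          fix u assume "u \<in> ?T"
          then have "(henon c b ^^ N) u \<in> bounded_orbit_set (henon c b)" using interior_subset by auto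
          then have bd: "bounded (range (\<lambda>n. (henon c b ^^ (n + N)) u))"
            by (simp add: bounded_orbit_set_def funpow_add)
          have "range (\<lambda>n. (henon c b ^^ n) u) \<subseteq> (\<lambda>n. (henon c b ^^ n) u) ` {..<N} \<union> range (\<lambda>n. (henon c b ^^ (n + N)) u)"
          proof
            fix v assume "v \<in> range (\<lambda>n. (henon c b ^^ n) u)"
            then obtain n where v: "v = (henon c b ^^ n) u" by blast
            show "v \<in> (\<lambda>n. (henon c b ^^ n) u) ` {..<N} \<union> range (\<lambda>n. (henon c b ^^ (n + N)) u)"
            proof (cases "n < N")
              case False
              then have "v = (henon c b ^^ (n - N + N)) u" using v by simp
              then show ?thesis by blast
            qed (use v in auto)
          qed
          moreover have "bounded ((\<lambda>n. (henon c b ^^ n) u) ` {..<N} \<union> range (\<lambda>n. (henon c b ^^ (n + N)) u))"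
            using bd by (simp add: finite_imp_bounded)
          ultimately show "u \<in> bounded_orbit_set (henon c b)"
            unfolding bounded_orbit_set_def using bounded_subset by blast
        qed
        ultimately show False using z_int interior_maximal by blast
      next
        case False
        from e(2)[OF b(2) sR sR False far, of "int N"] show False
          unfolding it using sR by (auto simp: not_less[symmetric])
      qed
    qed
    define F where "F N = {x. \<forall>n. n \<le> int N + 1 \<longrightarrow> cmod (s n - x n) \<le> \<eta>}" for N :: nat
    have "quad_orbits c \<Lambda> \<inter> (\<Inter>N\<in>UNIV. F N) \<noteq> {}"
    proof (rule compact_imp_fip_image)
      show "compact (quad_orbits c \<Lambda>)" by (rule compact_quad_orbits[OF compact])
      show "closed (F N)" for N
        unfolding F_def
        by (intro closed_Collect_all closed_Collect_imp open_Collect_const closed_Collect_le continuous_intros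
            continuous_on_product_coordinates)
      fix I' :: "nat set" assume fin: "finite I'"
      obtain x where x: "x \<in> quad_orbits c \<Lambda>" "\<And>n. n \<le> int (Max (insert 0 I')) + 1 \<Longrightarrow> cmod (s n - x n) \<le> \<eta>"
        using shadowing_orbit[OF b(3) s(1) sR near] by blast
      have "x \<in> F N" if "N \<in> I'" for N
      proof -
        have "N \<le> Max (insert 0 I')" using that fin by (intro Max_ge) auto
        then show ?thesis using x(2) unfolding F_def by auto
      qed
      then show "quad_orbits c \<Lambda> \<inter> (\<Inter>N\<in>I'. F N) \<noteq> {}" using x(1) by blast
    qed
    then obtain x where x: "x \<in> quad_orbits c \<Lambda>" "\<And>N. x \<in> F N" by blast
    have sx: "cmod (s n - x n) \<le> \<eta>" for n using x(2)[of "nat n"] by (auto simp: F_def)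
    have "s = continuation b x"
    proof (rule recurrence_near_orbit_unique[OF x(1) b(3) s(1)])
      show "cmod (s n - x n) \<le> 2 * \<eta>" for n using sx[of n] eta_pos by linarith
      show "cmod (continuation b x n - x n) \<le> 2 * \<eta>" for n using continuation_near[OF x(1) b(3), of n] eta_pos by linarith
    qed (rule continuation_recurrence[OF x(1) b(3)])
    then show "z \<in> continued_point b ` quad_orbits c \<Lambda>"
      using x(1) by (simp add: s(2) continued_point_def)
  qed
qed

end

section \<open>The Banach-valued continuation\<close>

lemma bounded_linear_linf_scaleC: "bounded_linear (\<lambda>h. linf_scaleC h D)"
proof (rule bounded_linear_intro)
  show "linf_scaleC (h + k) D = linf_scaleC h D + linf_scaleC k D" for h k
    by (rule bcontfun_eqI) (simp add: apply_linf_scaleC scaleC2_def plus_bcontfun.rep_eq algebra_simps)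
  show "linf_scaleC (r *\<^sub>R h) D = r *\<^sub>R linf_scaleC h D" for r h
    by (rule bcontfun_eqI) (simp add: apply_linf_scaleC scaleC2_def scaleR_bcontfun.rep_eq)
  show "norm (linf_scaleC h D) \<le> norm h * norm D" for h
    by (rule norm_bound) (simp add: apply_linf_scaleC norm_scaleC2 mult_left_mono norm_bounded)
qed

lemma bounded_linear_apply_linf: "bounded_linear (\<lambda>z :: linf. apply_bcontfun z i)"
  by (rule bounded_linear_intro[where K = 1])
     (auto simp: plus_bcontfun.rep_eq scaleR_bcontfun.rep_eq norm_bounded)

lemma linf_holomorphic_on_coordinates:
  assumes "linf_holomorphic_on \<phi> U"
  shows "(\<lambda>b. fst (apply_bcontfun (\<phi> b) i)) holomorphic_on U"
    and "(\<lambda>b. snd (apply_bcontfun (\<phi> b) i)) holomorphic_on U"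
proof -
  have ex: "\<exists>d. ((\<lambda>b. p (apply_bcontfun (\<phi> b) i)) has_field_derivative d) (at b within U)"
    if b: "b \<in> U" and p: "bounded_linear p" "\<And>h v. p (scaleC2 h v) = p v * h" 
    for b and p :: "complex \<times> complex \<Rightarrow> complex"
  proof -
    obtain D where D: "(\<phi> has_derivative (\<lambda>h. linf_scaleC h D)) (at b)"
      using assms b unfolding linf_holomorphic_on_def by blast
    have "((\<lambda>b. p (apply_bcontfun (\<phi> b) i)) has_derivative
        (\<lambda>h. p (apply_bcontfun (linf_scaleC h D) i))) (at b)"
      by (rule bounded_linear.has_derivative[OF p(1) bounded_linear.has_derivative[OF bounded_linear_apply_linf D]])
    then have "((\<lambda>b. p (apply_bcontfun (\<phi> b) i)) has_field_derivative p (apply_bcontfun D i)) (at b)"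
      unfolding has_field_derivative_def apply_linf_scaleC p(2) .
    then show ?thesis using has_field_derivative_at_within by blast
  qed
  show "(\<lambda>b. fst (apply_bcontfun (\<phi> b) i)) holomorphic_on U"
    unfolding holomorphic_on_def field_differentiable_def
    using ex[of _ fst] bounded_linear_fst by (auto simp: mult.commute)
  show "(\<lambda>b. snd (apply_bcontfun (\<phi> b) i)) holomorphic_on U"
    unfolding holomorphic_on_def field_differentiable_def
    using ex[of _ snd] bounded_linear_snd by (auto simp: mult.commute)
qed

text \<open>The constants depend only on the bound \<open>B\<close> and the radius \<open>d\<close>. This makes the estimate uniform over the entries of a
  bounded sequence of holomorphic functions.\<close>

lemma holomorphic_quadratic_remainder:
  assumes hol: "h holomorphic_on cball b (2 * d)" and d: "0 < d"
    and B: "\<And>u. u \<in> cball b (2 * d) \<Longrightarrow> cmod (h u) \<le> B"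
  shows "cmod (deriv h b) \<le> B / d"
    and "cmod (u - b) \<le> d \<Longrightarrow> cmod (h u - h b - (u - b) * deriv h b) \<le> 2 * B / d\<^sup>2 * (cmod (u - b))\<^sup>2"
proof -
  have sub: "cball p d \<subseteq> cball b (2 * d)" if "p \<in> cball b d" for p
  proof
    fix u assume "u \<in> cball p d"
    then show "u \<in> cball b (2 * d)" using that dist_triangle[of b u p] by simp
  qed
  have cauchy: "cmod ((deriv ^^ n) h p) \<le> fact n * B / d ^ n" if "p \<in> cball b d" for n p
  proof (rule Cauchy_inequality)
    have "h holomorphic_on cball p d" using hol sub[OF that] holomorphic_on_subset by blast
    then show "h holomorphic_on ball p d" "continuous_on (cball p d) h"
      using holomorphic_on_subset ball_subset_cball holomorphic_on_imp_continuous_on by blast+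
    show "cmod (h x) \<le> B" if "cmod (p - x) = d" for x
      using B sub[OF \<open>p \<in> cball b d\<close>] that by (simp add: dist_norm subset_eq)
  qed (rule d)
  show "cmod (deriv h b) \<le> B / d" using cauchy[of b 1] d by simp
  assume u: "cmod (u - b) \<le> d"
  have hol1: "h holomorphic_on ball b (2 * d)" using hol ball_subset_cball holomorphic_on_subset by blast
  have "cmod ((deriv ^^ 0) h u - (\<Sum>i\<le>1. (deriv ^^ i) h b * (u - b) ^ i / fact i))
      \<le> (2 * B / d\<^sup>2) * cmod (u - b) ^ Suc 1 / fact 1"
  proof (rule complex_Taylor[where S = "cball b d"])
    fix i x assume x: "x \<in> cball b d"
    have "(deriv ^^ i) h holomorphic_on ball b (2 * d)" using hol1 by (rule holomorphic_higher_deriv) simp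
    then have "((deriv ^^ i) h has_field_derivative deriv ((deriv ^^ i) h) x) (at x)"
      using x d by (intro holomorphic_derivI[of _ "ball b (2 * d)"]) auto
    then show "((deriv ^^ i) h has_field_derivative (deriv ^^ Suc i) h x) (at x within cball b d)"
      by (simp add: has_field_derivative_at_within)
  next
    show "cmod ((deriv ^^ Suc 1) h x) \<le> 2 * B / d\<^sup>2" if "x \<in> cball b d" for x
      using cauchy[OF that, of 2] by (simp add: numeral_2_eq_2)
  qed (use u d in \<open>auto simp: dist_norm norm_minus_commute\<close>)
  then show "cmod (h u - h b - (u - b) * deriv h b) \<le> 2 * B / d\<^sup>2 * (cmod (u - b))\<^sup>2"
    by (simp add: power2_eq_square algebra_simps)
qed

text \<open>Entrywise holomorphy together with a uniform bound gives holomorphy in the supremum norm, as the difference quotients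
  of all entries converge at a common rate.\<close>

lemma linf_holomorphic_onI:
  assumes hol: "\<And>i. (\<lambda>b. fst (apply_bcontfun (\<phi> b) i)) holomorphic_on U"
      "\<And>i. (\<lambda>b. snd (apply_bcontfun (\<phi> b) i)) holomorphic_on U"
    and U: "open U" and B: "\<And>b. b \<in> U \<Longrightarrow> norm (\<phi> b) \<le> B"
  shows "linf_holomorphic_on \<phi> U"
  unfolding linf_holomorphic_on_def
proof
  fix b assume b: "b \<in> U"
  then obtain e where e: "0 < e" "cball b e \<subseteq> U" using U open_contains_cball by blast
  define d where "d = e / 2"
  have d: "0 < d" "cball b (2 * d) \<subseteq> U" using e by (auto simp: d_def)
  let ?h1 = "\<lambda>i b. fst (apply_bcontfun (\<phi> b) i)" and ?h2 = "\<lambda>i b. snd (apply_bcontfun (\<phi> b) i)"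
  have bd: "cmod (?h1 i u) \<le> B" "cmod (?h2 i u) \<le> B" if "u \<in> cball b (2 * d)" for i u
  proof -
    have "norm (apply_bcontfun (\<phi> u) i) \<le> B" using norm_bounded[of "\<phi> u" i] B[of u] that d(2) by auto
    then show "cmod (?h1 i u) \<le> B" "cmod (?h2 i u) \<le> B"
      using norm_fst_le[of "?h1 i u" "?h2 i u"] norm_snd_le[of "?h2 i u" "?h1 i u"] by auto
  qed
  note R1 = holomorphic_quadratic_remainder[OF holomorphic_on_subset[OF hol(1) d(2)] d(1) bd(1)]
    and R2 = holomorphic_quadratic_remainder[OF holomorphic_on_subset[OF hol(2) d(2)] d(1) bd(2)]
  let ?D = "\<lambda>i. (deriv (?h1 i) b, deriv (?h2 i) b)"
  have "norm (?D i) \<le> B / d + B / d" for i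
    using norm_Pair_le[of "deriv (?h1 i) b" "deriv (?h2 i) b"] R1(1)[of i] R2(1)[of i] by linarith
  then have "?D \<in> bcontfun" by (auto simp: bcontfun_def bounded_iff)
  then have D: "apply_bcontfun (Bcontfun ?D) = ?D" by (simp add: Bcontfun_inverse)
  have "(\<phi> has_derivative (\<lambda>h. linf_scaleC h (Bcontfun ?D))) (at b)"
  proof (rule has_derivativeI_sandwich[OF d(1) bounded_linear_linf_scaleC])
    let ?C = "2 * B / d\<^sup>2"
    fix u assume u: "u \<noteq> b" "dist u b < d"
    have "norm (\<phi> u - \<phi> b - linf_scaleC (u - b) (Bcontfun ?D)) \<le> 2 * ?C * (cmod (u - b))\<^sup>2"
    proof (rule norm_bound)
      fix i
      have eq: "apply_bcontfun (\<phi> u - \<phi> b - linf_scaleC (u - b) (Bcontfun ?D)) i =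
          (?h1 i u - ?h1 i b - (u - b) * deriv (?h1 i) b, ?h2 i u - ?h2 i b - (u - b) * deriv (?h2 i) b)"
        by (simp add: minus_bcontfun.rep_eq apply_linf_scaleC D scaleC2_def prod_eq_iff)
      show "norm (apply_bcontfun (\<phi> u - \<phi> b - linf_scaleC (u - b) (Bcontfun ?D)) i) \<le> 2 * ?C * (cmod (u - b))\<^sup>2"
        unfolding eq using R1(2)[of u i] R2(2)[of u i] u(2)
        by (intro order_trans[OF norm_Pair_le]) (simp add: dist_norm)
    qed
    then show "norm (\<phi> u - \<phi> b - linf_scaleC (u - b) (Bcontfun ?D)) / norm (u - b) \<le> 2 * ?C * cmod (u - b)"
      using u by (simp add: pos_divide_le_eq power2_eq_square mult.assoc)
  next
    have "((\<lambda>u. 2 * (2 * B / d\<^sup>2) * cmod (u - b)) \<longlongrightarrow> 2 * (2 * B / d\<^sup>2) * cmod (b - b)) (at b)"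
      by (intro tendsto_intros)
    then show "((\<lambda>u. 2 * (2 * B / d\<^sup>2) * cmod (u - b)) \<longlongrightarrow> 0) (at b)" by simp
  qed
  then show "\<exists>D. (\<phi> has_derivative (\<lambda>h. linf_scaleC h D)) (at b)" by blast
qed

lemma Sigma_orbits_lifted_set:
  "w \<in> Sigma_orbits (lifted_set c \<Lambda>) (henon c 0) \<longleftrightarrow>
     (\<lambda>i. snd (w i)) \<in> quad_orbits c \<Lambda> \<and> w = (\<lambda>i. (snd (w (i + 1)), snd (w i)))"
proof
  assume w: "w \<in> Sigma_orbits (lifted_set c \<Lambda>) (henon c 0)"
  have 1: "snd (w i) \<in> \<Lambda>" "w i = (quad c (snd (w i)), snd (w i))" for i
  proof -
    have "w i \<in> lifted_set c \<Lambda>" using w by (simp add: Sigma_orbits_def)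
    then show "snd (w i) \<in> \<Lambda>" "w i = (quad c (snd (w i)), snd (w i))" by (auto simp: lifted_set_def)
  qed
  have 2: "snd (w (i + 1)) = quad c (snd (w i))" for i
  proof -
    have "w (i + 1) = henon c 0 (w i)" using w by (simp add: Sigma_orbits_def)
    then have "snd (w (i + 1)) = fst (w i)" by simp
    then show ?thesis using 1(2)[of i] by (metis fst_conv)
  qed
  show "(\<lambda>i. snd (w i)) \<in> quad_orbits c \<Lambda> \<and> w = (\<lambda>i. (snd (w (i + 1)), snd (w i)))"
    using 1 by (auto simp: quad_orbits_def 2)
next
  assume "(\<lambda>i. snd (w i)) \<in> quad_orbits c \<Lambda> \<and> w = (\<lambda>i. (snd (w (i + 1)), snd (w i)))"
  then obtain x where x: "x \<in> quad_orbits c \<Lambda>" "w = (\<lambda>i. (x (i + 1), x i))" by auto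
  then show "w \<in> Sigma_orbits (lifted_set c \<Lambda>) (henon c 0)"
    by (auto simp: Sigma_orbits_def lifted_set_def quad_orbits_def henon_def quad_def)
qed

lemma Sigma_orbits_eq_image:
  "Sigma_orbits (lifted_set c \<Lambda>) (henon c 0) = (\<lambda>x i. (x (i + 1), x i)) ` quad_orbits c \<Lambda>"
proof (intro equalityI subsetI)
  fix w assume "w \<in> Sigma_orbits (lifted_set c \<Lambda>) (henon c 0)"
  then show "w \<in> (\<lambda>x i. (x (i + 1), x i)) ` quad_orbits c \<Lambda>"
    unfolding Sigma_orbits_lifted_set by (intro image_eqI[where x = "\<lambda>i. snd (w i)"]) auto
qed (auto simp: Sigma_orbits_lifted_set)

text \<open>A member of \<open>linf\<close> only where the sequence is bounded, see \<open>apply_continued_orbit\<close>.\<close>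

definition continued_orbit :: "complex \<Rightarrow> (int \<Rightarrow> complex) \<Rightarrow> linf" where
  "continued_orbit b x = Bcontfun (\<lambda>i. (continuation b x (i + 1), continuation b x i))"

context small_perturbation
begin

lemma continuation_bounded:
  assumes x: "x \<in> quad_orbits c \<Lambda>" and b: "cmod b \<le> \<epsilon>"
  shows "cmod (continuation b x n) \<le> R + \<eta>"
  using continuation_near[OF x b, of n] le_R[OF quad_orbitsD(1)[OF x, of n]]
    norm_triangle_ineq[of "continuation b x n - x n" "x n"] by simp

lemma apply_continued_orbit:
  assumes x: "x \<in> quad_orbits c \<Lambda>" and b: "cmod b \<le> \<epsilon>"
  shows "apply_bcontfun (continued_orbit b x) i = (continuation b x (i + 1), continuation b x i)"
    and "norm (continued_orbit b x) \<le> 2 * (R + \<eta>)"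
proof -
  let ?z = "\<lambda>i. (continuation b x (i + 1), continuation b x i)"
  have bd: "norm (?z i) \<le> 2 * (R + \<eta>)" for i
    using norm_Pair_le[of "continuation b x (i + 1)" "continuation b x i"]
      continuation_bounded[OF x b, of i] continuation_bounded[OF x b, of "i + 1"]
    unfolding mult_2 by linarith
  then have "?z \<in> bcontfun" by (auto simp: bcontfun_def bounded_iff)
  then have "apply_bcontfun (continued_orbit b x) = ?z" by (simp add: continued_orbit_def Bcontfun_inverse)
  then show "apply_bcontfun (continued_orbit b x) i = ?z i" "norm (continued_orbit b x) \<le> 2 * (R + \<eta>)"
    using bd by (auto intro: norm_bound)
qed

lemma continuation_0: "x \<in> quad_orbits c \<Lambda> \<Longrightarrow> continuation 0 x = x"
  using eps_pos eta_pos continuation_near[of x 0]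
  by (intro recurrence_near_orbit_unique[of x 0] continuation_recurrence quad_orbits_recurrence[of x c \<Lambda>])
     (auto intro: order_trans[of _ \<eta>])

lemma is_theta_continued_orbit:
  assumes x: "x \<in> quad_orbits c \<Lambda>"
  shows "is_theta c (\<lambda>i. (x (i + 1), x i)) \<epsilon> (\<lambda>b. continued_orbit b x)"
proof -
  have ap: "apply_bcontfun (continued_orbit b x) i = (continuation b x (i + 1), continuation b x i)"
    if "b \<in> ball 0 \<epsilon>" for b i
    using that apply_continued_orbit(1)[OF x] by simp
  have "linf_holomorphic_on (\<lambda>b. continued_orbit b x) (ball 0 \<epsilon>)"
  proof (rule linf_holomorphic_onI[OF _ _ open_ball, where B = "2 * (R + \<eta>)"])
    fix i
    show "(\<lambda>b. fst (apply_bcontfun (continued_orbit b x) i)) holomorphic_on ball 0 \<epsilon>"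
      "(\<lambda>b. snd (apply_bcontfun (continued_orbit b x) i)) holomorphic_on ball 0 \<epsilon>"
      using continuation_holomorphic[OF x, of "i + 1"] continuation_holomorphic[OF x, of i]
      by (auto intro: holomorphic_transform simp: ap)
  qed (use apply_continued_orbit(2)[OF x] in auto)
  moreover have "apply_bcontfun (continued_orbit 0 x) = (\<lambda>i. (x (i + 1), x i))"
    using ap[of 0] eps_pos by (auto simp: continuation_0[OF x])
  moreover have "\<forall>\<^sub>F b in nhds 0. henon_F c b (continued_orbit b x) = 0"
  proof (rule eventually_nhds_in_open[of "ball 0 \<epsilon>", THEN eventually_mono])
    fix b :: complex assume b: "b \<in> ball 0 \<epsilon>"
    have rec: "henon_recurrence c b (continuation b x)" using continuation_recurrence[OF x] b by simp
    show "henon_F c b (continued_orbit b x) = 0"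
    proof (rule bcontfun_eqI)
      fix i
      have "continuation b x (i + 1 + 1) = (continuation b x (i + 1))\<^sup>2 + c - b * continuation b x i"
        using rec[unfolded henon_recurrence_def, rule_format, of "i + 1"] by simp
      then show "apply_bcontfun (henon_F c b (continued_orbit b x)) i = apply_bcontfun 0 i"
        by (simp add: apply_henon_F ap[OF b] henon_def zero_prod_def)
    qed
  qed (use eps_pos in auto)
  ultimately show ?thesis using eps_pos by (simp add: is_theta_def)
qed

text \<open>Near \<open>0\<close> the sequence \<open>\<phi> b\<close> is an orbit close to \<open>x\<close>, hence equals the continuation. The identity theorem, applied to
  each entry, extends the equality to the common disc.\<close>

lemma is_theta_unique:
  assumes x: "x \<in> quad_orbits c \<Lambda>" and \<phi>: "is_theta c (\<lambda>i. (x (i + 1), x i)) r \<phi>"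
    and b: "cmod b < \<epsilon>" "cmod b < r"
  shows "\<phi> b = continued_orbit b x"
proof -
  have r: "0 < r" and hol: "linf_holomorphic_on \<phi> (ball 0 r)"
    and \<phi>0: "apply_bcontfun (\<phi> 0) = (\<lambda>i. (x (i + 1), x i))"
    and F: "\<forall>\<^sub>F b in nhds 0. henon_F c b (\<phi> b) = 0"
    using \<phi> by (auto simp: is_theta_def)
  have "isCont \<phi> 0"
    using hol r has_derivative_continuous unfolding linf_holomorphic_on_def by fastforce
  then have "\<forall>\<^sub>F b in nhds 0. dist (\<phi> b) (\<phi> 0) < \<eta>"
    using eta_pos by (simp add: continuous_at tendsto_iff eventually_nhds_conv_at)
  then have "\<forall>\<^sub>F b in nhds 0. henon_F c b (\<phi> b) = 0 \<and> dist (\<phi> b) (\<phi> 0) < \<eta>"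
    using F by eventually_elim auto
  then obtain e where e: "0 < e" "\<And>b. dist b 0 < e \<Longrightarrow> henon_F c b (\<phi> b) = 0 \<and> dist (\<phi> b) (\<phi> 0) < \<eta>"
    unfolding eventually_nhds_metric by blast
  define U where "U = ball (0 :: complex) (min r \<epsilon>)"
  define V where "V = ball (0 :: complex) (min e (min r \<epsilon>))"
  have germ: "snd (apply_bcontfun (\<phi> b) i) = continuation b x i \<and> fst (apply_bcontfun (\<phi> b) i) = continuation b x (i + 1)"
    if "b \<in> V" for b i
  proof -
    define s where "s i = snd (apply_bcontfun (\<phi> b) i)" for i
    have b: "dist b 0 < e" "cmod b \<le> \<epsilon>" using that by (auto simp: V_def)
    have step: "apply_bcontfun (\<phi> b) (i + 1) = henon c b (apply_bcontfun (\<phi> b) i)" for i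
      using apply_henon_F[of c b "\<phi> b" i] e(2)[OF b(1)] by simp
    have fst: "fst (apply_bcontfun (\<phi> b) i) = s (i + 1)" for i by (simp add: s_def step)
    have "henon_recurrence c b s" unfolding henon_recurrence_def
    proof
      fix n
      show "s (n + 1) = (s n)\<^sup>2 + c - b * s (n - 1)"
        using step[of "n - 1", THEN arg_cong[of _ _ fst]] fst[of n] fst[of "n - 1"] by (simp add: s_def)
    qed
    moreover have "cmod (s n - x n) \<le> 2 * \<eta>" for n
    proof -
      have "dist (apply_bcontfun (\<phi> b) n) (apply_bcontfun (\<phi> 0) n) < \<eta>"
        using dist_bounded[of "\<phi> b" n "\<phi> 0"] e(2)[OF b(1)] by simp
      moreover have "dist (s n) (x n) \<le> dist (apply_bcontfun (\<phi> b) n) (apply_bcontfun (\<phi> 0) n)"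
        using dist_snd_le[of "apply_bcontfun (\<phi> b) n" "apply_bcontfun (\<phi> 0) n"] by (simp add: s_def \<phi>0)
      ultimately show ?thesis using eta_pos by (simp add: dist_norm)
    qed
    moreover have "cmod (continuation b x n - x n) \<le> 2 * \<eta>" for n
      using continuation_near[OF x b(2), of n] eta_pos by linarith
    ultimately have "s = continuation b x"
      using recurrence_near_orbit_unique[OF x b(2)] continuation_recurrence[OF x b(2)] by blast
    then show ?thesis using fst[of i] by (simp add: s_def[symmetric])
  qed
  have bU: "b \<in> U" using b by (simp add: U_def)
  have V: "open V" "V \<noteq> {}" "V \<subseteq> U" and U: "open U" "connected U"
    using e(1) r eps_pos by (auto simp: U_def V_def)
  have hol': "(\<lambda>b. fst (apply_bcontfun (\<phi> b) i)) holomorphic_on U"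
    "(\<lambda>b. snd (apply_bcontfun (\<phi> b) i)) holomorphic_on U" for i
    using linf_holomorphic_on_coordinates[OF hol] subset_ball[of "min r \<epsilon>" r]
    unfolding U_def by (metis holomorphic_on_subset min.cobounded1)+
  have cont: "(\<lambda>b. continuation b x i) holomorphic_on U" for i
    by (rule holomorphic_on_subset[OF continuation_holomorphic[OF x]]) (auto simp: U_def)
  have "fst (apply_bcontfun (\<phi> b) i) = continuation b x (i + 1)" "snd (apply_bcontfun (\<phi> b) i) = continuation b x i" for i
    using analytic_continuation_open[OF V(1) U(1) V(2) U(2) V(3) hol'(1) cont _ bU]
      analytic_continuation_open[OF V(1) U(1) V(2) U(2) V(3) hol'(2) cont _ bU] germ by blast+
  then show ?thesis using b apply_continued_orbit(1)[OF x]
    by (intro bcontfun_eqI) (auto simp: prod_eq_iff)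
qed

lemma theta_eq_continued_orbit:
  assumes x: "x \<in> quad_orbits c \<Lambda>" and b: "cmod b < \<epsilon>"
  shows "theta c (\<lambda>i. (x (i + 1), x i)) b = continued_orbit b x"
  unfolding theta_def
proof (rule the_equality)
  show "\<exists>r \<phi>. is_theta c (\<lambda>i. (x (i + 1), x i)) r \<phi> \<and> b \<in> ball 0 r \<and> \<phi> b = continued_orbit b x"
    using is_theta_continued_orbit[OF x] b by (intro exI[of _ \<epsilon>] exI[of _ "\<lambda>b. continued_orbit b x"]) simp
  show "z = continued_orbit b x"
    if "\<exists>r \<phi>. is_theta c (\<lambda>i. (x (i + 1), x i)) r \<phi> \<and> b \<in> ball 0 r \<and> \<phi> b = z" for z
    using that is_theta_unique[OF x _ b] by auto
qed

lemma is_theta_theta: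
  assumes w: "w \<in> Sigma_orbits (lifted_set c \<Lambda>) (henon c 0)"
  shows "is_theta c w \<epsilon> (theta c w)"
proof -
  obtain x where x: "x \<in> quad_orbits c \<Lambda>" and w: "w = (\<lambda>i. (x (i + 1), x i))"
    using w by (auto simp: Sigma_orbits_eq_image)
  have eq: "theta c w b = continued_orbit b x" if "b \<in> ball 0 \<epsilon>" for b
    using theta_eq_continued_orbit[OF x] that w by simp
  have "is_theta c w \<epsilon> (\<lambda>b. continued_orbit b x)" using is_theta_continued_orbit[OF x] w by simp
  then have hol: "linf_holomorphic_on (\<lambda>b. continued_orbit b x) (ball 0 \<epsilon>)"
    and 0: "apply_bcontfun (continued_orbit 0 x) = w"
    and F: "\<forall>\<^sub>F b in nhds 0. henon_F c b (continued_orbit b x) = 0" by (auto simp: is_theta_def)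
  have "linf_holomorphic_on (theta c w) (ball 0 \<epsilon>)"
    unfolding linf_holomorphic_on_def
  proof
    fix b :: complex assume b: "b \<in> ball 0 \<epsilon>"
    then obtain E where E: "((\<lambda>b. continued_orbit b x) has_derivative (\<lambda>h. linf_scaleC h E)) (at b)"
      using hol unfolding linf_holomorphic_on_def by blast
    have "(theta c w has_derivative (\<lambda>h. linf_scaleC h E)) (at b)"
      by (rule has_derivative_transform_within_open[OF E open_ball b]) (simp add: eq)
    then show "\<exists>E. (theta c w has_derivative (\<lambda>h. linf_scaleC h E)) (at b)" by blast
  qed
  moreover have "\<forall>\<^sub>F b in nhds 0. henon_F c b (theta c w b) = 0"
  proof -
    have "\<forall>\<^sub>F b in nhds 0. b \<in> ball (0::complex) \<epsilon>" using eps_pos by (intro eventually_nhds_in_open) auto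
    then show ?thesis using F by eventually_elim (simp add: eq)
  qed
  ultimately show ?thesis using eps_pos 0 eq[of 0] by (simp add: is_theta_def)
qed

lemma theta_0_eq_continued_point:
  assumes w: "w \<in> Sigma_orbits (lifted_set c \<Lambda>) (henon c 0)" and b: "cmod b < \<epsilon>"
  shows "apply_bcontfun (theta c w b) 0 = continued_point b (\<lambda>i. snd (w i))"
proof -
  have x: "(\<lambda>i. snd (w i)) \<in> quad_orbits c \<Lambda>" and w: "w = (\<lambda>i. (snd (w (i + 1)), snd (w i)))"
    using w unfolding Sigma_orbits_lifted_set by blast+
  show ?thesis
    using theta_eq_continued_orbit[OF x b] apply_continued_orbit(1)[OF x, of b 0] b
    unfolding w[symmetric] by (simp add: continued_point_def)
qed

lemma continued_set_eq:
  assumes b: "cmod b < \<epsilon>"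
  shows "continued_set c \<Lambda> b = continued_point b ` quad_orbits c \<Lambda>"
proof -
  have "continued_set c \<Lambda> b = (\<lambda>w. continued_point b (\<lambda>i. snd (w i))) ` Sigma_orbits (lifted_set c \<Lambda>) (henon c 0)"
    unfolding continued_set_def using theta_0_eq_continued_point[OF _ b] by force
  also have "\<dots> = continued_point b ` quad_orbits c \<Lambda>"
    unfolding Sigma_orbits_eq_image image_image by simp
  finally show ?thesis .
qed

lemma continued_set_homeomorphism:
  assumes b: "cmod b < \<epsilon>" "b \<noteq> 0"
  shows "\<exists>g. homeomorphism (Sigma_orbits (lifted_set c \<Lambda>) (henon c 0)) (continued_set c \<Lambda> b)
     (\<lambda>w. apply_bcontfun (theta c w b) 0) g"
proof (rule homeomorphism_compact)
  let ?\<Sigma> = "Sigma_orbits (lifted_set c \<Lambda>) (henon c 0)"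
  have coord: "continuous_on S (\<lambda>x. x i)" for S :: "(int \<Rightarrow> 'b::topological_space) set" and i
    using continuous_on_product_coordinates by (rule continuous_on_subset) simp
  show "compact ?\<Sigma>" unfolding Sigma_orbits_eq_image
    by (intro compact_continuous_image compact_quad_orbits compact
        continuous_on_coordinatewise_then_product continuous_intros coord)
  have "continuous_on ?\<Sigma> (\<lambda>w. continued_point b (\<lambda>i. snd (w i)))"
  proof (rule continuous_on_compose2[OF continuous_continued_point[of b]])
    show "continuous_on ?\<Sigma> (\<lambda>w i. snd (w i))"
      by (intro continuous_on_coordinatewise_then_product continuous_intros coord)
  qed (use b in \<open>auto simp: Sigma_orbits_lifted_set\<close>)
  then show "continuous_on ?\<Sigma> (\<lambda>w. apply_bcontfun (theta c w b) 0)"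
    by (rule continuous_on_eq) (simp add: theta_0_eq_continued_point b)
  show "(\<lambda>w. apply_bcontfun (theta c w b) 0) ` ?\<Sigma> = continued_set c \<Lambda> b"
    by (auto simp: continued_set_def)
  show "inj_on (\<lambda>w. apply_bcontfun (theta c w b) 0) ?\<Sigma>"
  proof (rule inj_onI)
    fix v w assume v: "v \<in> ?\<Sigma>" and w: "w \<in> ?\<Sigma>" and eq: "apply_bcontfun (theta c v b) 0 = apply_bcontfun (theta c w b) 0"
    have "(\<lambda>i. snd (v i)) = (\<lambda>i. snd (w i))"
    proof (rule inj_onD[OF inj_continued_point])
      show "continued_point b (\<lambda>i. snd (v i)) = continued_point b (\<lambda>i. snd (w i))"
        using eq by (simp add: theta_0_eq_continued_point v w b)
    qed (use v w b in \<open>auto simp: Sigma_orbits_lifted_set\<close>)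
    then have snd_eq: "snd (v i) = snd (w i)" for i by meson
    have "v = (\<lambda>i. (snd (v (i + 1)), snd (v i)))" "w = (\<lambda>i. (snd (w (i + 1)), snd (w i)))"
      using v w unfolding Sigma_orbits_lifted_set by blast+
    then show "v = w" unfolding snd_eq by (rule trans[OF _ sym])
  qed
qed

lemma theta_shift:
  assumes w: "w \<in> Sigma_orbits (lifted_set c \<Lambda>) (henon c 0)" and b: "cmod b < \<epsilon>"
  shows "apply_bcontfun (theta c (shift w) b) 0 = henon c b (apply_bcontfun (theta c w b) 0)"
proof -
  have "(\<lambda>i. snd (w i)) \<in> quad_orbits c \<Lambda>" using w by (simp add: Sigma_orbits_lifted_set)
  moreover have "shift w \<in> Sigma_orbits (lifted_set c \<Lambda>) (henon c 0)"
    using w by (auto simp: Sigma_orbits_def shift_def)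
  ultimately show ?thesis using henon_continued_point(1)[of "\<lambda>i. snd (w i)" b] w b
    by (simp add: theta_0_eq_continued_point shift_def)
qed

end

section \<open>The continued set and the Julia set\<close>

theorem corollary1p6:
  fixes c :: complex and \<Lambda> :: "complex set"
  assumes "\<Lambda> \<subseteq> julia (quad c)"
    and "compact \<Lambda>"
    and "invariant_set (quad c) \<Lambda>"
    and "expanding_set (quad c) \<Lambda>"
  shows "\<exists>\<epsilon>0>0.
    (\<forall>w \<in> Sigma_orbits (lifted_set c \<Lambda>) (henon c 0). is_theta c w \<epsilon>0 (theta c w)) \<and>
    (\<forall>b. 0 < cmod b \<and> cmod b < \<epsilon>0 \<longrightarrow>
       hyperbolic_set (henon c b) (continued_set c \<Lambda> b) \<and>
       (\<exists>g. homeomorphism (Sigma_orbits (lifted_set c \<Lambda>) (henon c 0)) (continued_set c \<Lambda> b)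
              (\<lambda>w. apply_bcontfun (theta c w b) 0) g) \<and>
       (\<forall>w \<in> Sigma_orbits (lifted_set c \<Lambda>) (henon c 0).
          apply_bcontfun (theta c (shift w) b) 0 = henon c b (apply_bcontfun (theta c w b) 0)) \<and>
       (continued_set c \<Lambda> b = henon_julia (henon c b) \<longleftrightarrow> \<Lambda> = julia (quad c)))"
proof -
  obtain \<rho> \<kappa> M a where rep: "repeller c \<Lambda> \<rho> \<kappa> M a"
    using expanding_set_adapted_weight[OF assms(2,4)] .
  interpret repeller c \<Lambda> \<rho> \<kappa> M a by (rule rep)
  obtain R0 where R0: "\<And>y. y \<in> \<Lambda> \<Longrightarrow> cmod y \<le> R0"
    using compact_imp_bounded[OF assms(2)] unfolding bounded_iff by blast
  define R where "R = max (3 + cmod c) R0"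
  have R: "3 + cmod c \<le> R" and R_le: "\<And>y. y \<in> \<Lambda> \<Longrightarrow> cmod y \<le> R"
    using R0 by (force simp: R_def)+
  obtain \<eta> \<epsilon>1 where e1: "0 < \<epsilon>1"
    "\<And>\<epsilon>. 0 < \<epsilon> \<Longrightarrow> \<epsilon> \<le> \<epsilon>1 \<Longrightarrow> small_perturbation c \<Lambda> \<rho> \<kappa> M a R \<eta> \<epsilon>"
    by (rule small_perturbation_exists[OF R R_le]) blast+
  have inv: "quad c -` \<Lambda> = \<Lambda>" using assms(3) by (simp add: invariant_set_def)
  have "\<exists>\<epsilon>2>0. \<forall>b. b \<noteq> 0 \<longrightarrow> cmod b < \<epsilon>2 \<longrightarrow> cmod b \<le> \<epsilon>1 \<longrightarrow> (continued_point b ` quad_orbits c \<Lambda> = henon_julia (henon c b) \<longleftrightarrow> \<Lambda> = julia (quad c))"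
  proof (cases "\<Lambda> = {}")
    case True
    then have empty: "quad_orbits c \<Lambda> = {}" by (auto simp: quad_orbits_def)
    obtain \<epsilon>2 where "0 < \<epsilon>2" "\<And>b. b \<noteq> 0 \<Longrightarrow> cmod b \<le> \<epsilon>2 \<Longrightarrow> henon_julia (henon c b) \<noteq> {}"
      using henon_julia_nonempty[of c] by blast
    then show ?thesis using True julia_quad_nonempty[of c] unfolding empty by (intro exI[of _ \<epsilon>2]) force
  next
    case False
    have "0 \<notin> \<Lambda>" using a_le a_pos by force
    then have J: "\<Lambda> = julia (quad c)" using totally_invariant_eq_julia[OF assms(1,3,2) False] by blast
    \<comment> \<open>Any rate strictly between \<open>1\<close> and \<open>\<kappa>\<close> would do.\<close>
    define \<beta> where "\<beta> = (1 + \<kappa>) / 2"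
    have beta: "1 < \<beta>" "\<beta> < \<kappa>" using kappa by (auto simp: \<beta>_def)
    interpret s: small_perturbation c \<Lambda> \<rho> \<kappa> M a R \<eta> \<epsilon>1 using e1 by blast
    have R_pos: "0 < R" using R norm_ge_zero[of c] by linarith
    define D where "D = min \<eta> ((\<kappa> - \<beta>) * a / (M * \<beta>))"
    have D: "0 < D" "D \<le> \<eta>" using s.eta_pos beta a_pos M_pos by (auto simp: D_def)
    have "D \<le> (\<kappa> - \<beta>) * a / (M * \<beta>)" by (simp add: D_def)
    then have D3: "M * (\<beta> * D / a) \<le> \<kappa> - \<beta>" using beta a_pos M_pos by (simp add: field_simps)
    define \<epsilon>2 where "\<epsilon>2 = min \<epsilon>1 ((\<beta> - 1) * (D / 2) / ((R + 1) * M))"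
    have "\<epsilon>2 \<le> (\<beta> - 1) * (D / 2) / ((R + 1) * M)" by (simp add: \<epsilon>2_def)
    then have "\<epsilon>2 * ((R + 1) * M) \<le> (\<beta> - 1) * (D / 2)" using R_pos M_pos by (subst (asm) pos_le_divide_eq) auto
    then have e2R: "\<epsilon>2 * (R + 1) * M \<le> (\<beta> - 1) * (D / 2)" by (simp only: mult.assoc)
    have e2: "0 < \<epsilon>2" "\<epsilon>2 \<le> \<epsilon>1" using e1(1) beta D R_pos M_pos by (auto simp: \<epsilon>2_def)
    interpret s2: small_perturbation c \<Lambda> \<rho> \<kappa> M a R \<eta> \<epsilon>2 using e1 e2 by blast
    interpret t: totally_invariant_perturbation c \<Lambda> \<rho> \<kappa> M a R \<eta> \<epsilon>2 \<beta> D
      by unfold_locales (use inv J beta D D3 e2R in \<open>auto simp: julia_def\<close>)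
    obtain \<epsilon>3 where e3: "0 < \<epsilon>3" "\<And>b. b \<noteq> 0 \<Longrightarrow> cmod b < \<epsilon>3 \<Longrightarrow> cmod b \<le> \<epsilon>2 \<Longrightarrow>
        henon_julia (henon c b) \<subseteq> continued_point b ` quad_orbits c \<Lambda>"
      by (rule t.henon_julia_subset) blast
    have "continued_point b ` quad_orbits c \<Lambda> = henon_julia (henon c b)" if "b \<noteq> 0" "cmod b < min \<epsilon>2 \<epsilon>3" for b
      using e3(2)[of b] s2.continued_set_hyperbolic(2)[of b] that by auto
    then show ?thesis using e2 e3 J by (intro exI[of _ "min \<epsilon>2 \<epsilon>3"]) auto
  qed
  then obtain \<epsilon>2 where e2: "0 < \<epsilon>2" "\<And>b. b \<noteq> 0 \<Longrightarrow> cmod b < \<epsilon>2 \<Longrightarrow> cmod b \<le> \<epsilon>1 \<Longrightarrow>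
      (continued_point b ` quad_orbits c \<Lambda> = henon_julia (henon c b) \<longleftrightarrow> \<Lambda> = julia (quad c))" by blast
  define \<epsilon> where "\<epsilon> = min \<epsilon>1 \<epsilon>2"
  have e: "0 < \<epsilon>" "\<epsilon> \<le> \<epsilon>1" "\<epsilon> \<le> \<epsilon>2" using e1 e2 by (auto simp: \<epsilon>_def)
  interpret small_perturbation c \<Lambda> \<rho> \<kappa> M a R \<eta> \<epsilon> using e1 e by blast
  show ?thesis
  proof (intro exI[of _ \<epsilon>] conjI allI impI ballI)
    fix b assume b: "0 < cmod b \<and> cmod b < \<epsilon>"
    then have b': "b \<noteq> 0" "cmod b < \<epsilon>" "cmod b \<le> \<epsilon>" by auto
    show "hyperbolic_set (henon c b) (continued_set c \<Lambda> b)"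
      unfolding continued_set_eq[OF b'(2)] by (rule continued_set_hyperbolic(1)[OF b'(3,1)])
    show "continued_set c \<Lambda> b = henon_julia (henon c b) \<longleftrightarrow> \<Lambda> = julia (quad c)"
      unfolding continued_set_eq[OF b'(2)] using e2(2)[of b] b' e by simp
    show "\<exists>g. homeomorphism (Sigma_orbits (lifted_set c \<Lambda>) (henon c 0)) (continued_set c \<Lambda> b)
        (\<lambda>w. apply_bcontfun (theta c w b) 0) g"
      by (rule continued_set_homeomorphism[OF b'(2,1)])
    show "apply_bcontfun (theta c (shift w) b) 0 = henon c b (apply_bcontfun (theta c w b) 0)"
      if "w \<in> Sigma_orbits (lifted_set c \<Lambda>) (henon c 0)" for w
      by (rule theta_shift[OF that b'(2)])
  qed (use e is_theta_theta in auto)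
qed

end
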